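(* The language $$GCE=\{(N,M,c,\chi)\mid \chi \text{ is a partial mapping of } G_{N,M} \text{ to } [c] \text{ that is extendable to a } c\text{-coloring of } G_{N,M}\}$$ is NP-complete.
   Context: For $x\in\mathbb{N}$, $[x]=\{1,\ldots,x\}$, and $G_{N,M}=[N]\times[M]$. A rectangle of $G_{N,M}$ is a subset of the form $\{(a,b),(a+c_1,b),(a+c_1,b+c_2),(a,b+c_2)\}\subseteq G_{N,M}$ with $a,b,c_1,c_2$ positive integers. A (total) mapping $\chi:G_{N,M}\to[c]$ is a $c$-coloring if no rectangle has all four of its corners mapped to the same color. A partial mapping $\chi$ of $G_{N,M}$ to $[c]$ is extendable to a $c$-coloring if there is a total mapping extending $\chi$ that is a $c$-coloring of $G_{N,M}$. An instance consists of $N,M,c$ and the partial mapping $\chi$ given explicitly (as a table of the values on the colored cells). *)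

theory Defs
  imports Main "HOL-Computational_Algebra.Polynomial"
begin

text \<open>Deterministic multi-tape Turing machines with two-way infinite tapes. States are the
  numbers below \<open>tm_states\<close>, tape symbols the numbers below \<open>tm_symbols\<close>, where 0 is the blank and
  1, 2 represent the bits 0, 1. The transition function maps the current state and the symbols under
  the heads to the next state and, for each tape, the symbol to write and the head movement.\<close>

datatype direction = Left | Stay | Right

record tm =
  tm_tapes :: nat
  tm_symbols :: nat
  tm_states :: nat
  tm_start :: nat
  tm_halt :: nat
  tm_delta :: "nat \<Rightarrow> nat list \<Rightarrow> nat \<times> (nat \<times> direction) list"

definition wf_tm :: "tm \<Rightarrow> bool" where
  "wf_tm M \<longleftrightarrow>
     0 < tm_tapes M \<and> 3 \<le> tm_symbols M \<and>
     tm_start M < tm_states M \<and> tm_halt M < tm_states M \<and>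
     (\<forall>q < tm_states M. \<forall>v. length v = tm_tapes M \<and> (\<forall>s \<in> set v. s < tm_symbols M) \<longrightarrow>
        fst (tm_delta M q v) < tm_states M \<and>
        length (snd (tm_delta M q v)) = tm_tapes M \<and>
        (\<forall>a \<in> set (snd (tm_delta M q v)). fst a < tm_symbols M))"

text \<open>A tape is its contents together with the head position.\<close>

type_synonym tape = "(int \<Rightarrow> nat) \<times> int"
type_synonym config = "nat \<times> tape list"

fun read_tape :: "tape \<Rightarrow> nat" where
  "read_tape (f, h) = f h"

fun shift :: "direction \<Rightarrow> int \<Rightarrow> int" where
  "shift Left h = h - 1"
| "shift Stay h = h"
| "shift Right h = h + 1"

fun act_tape :: "nat \<times> direction \<Rightarrow> tape \<Rightarrow> tape" where
  "act_tape (s, d) (f, h) = (f(h := s), shift d h)"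

fun tm_step :: "tm \<Rightarrow> config \<Rightarrow> config" where
  "tm_step M (q, ts) =
     (if q = tm_halt M then (q, ts)
      else (let (q', as) = tm_delta M q (map read_tape ts) in (q', map2 act_tape as ts)))"

fun bit_symbol :: "bool \<Rightarrow> nat" where
  "bit_symbol False = 1"
| "bit_symbol True = 2"

definition blank_tape :: tape where
  "blank_tape = (\<lambda>_. 0, 0)"

definition input_tape :: "bool list \<Rightarrow> tape" where
  "input_tape x =
     (\<lambda>i. if 0 \<le> i \<and> i < int (length x) then bit_symbol (x ! nat i) else 0, 0)"

definition tm_init :: "tm \<Rightarrow> bool list \<Rightarrow> config" where
  "tm_init M x = (tm_start M, input_tape x # replicate (tm_tapes M - 1) blank_tape)"

text \<open>The output is the word on the first tape that begins under the head and ends before the next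
  blank.\<close>

definition tape_output :: "tape \<Rightarrow> bool list \<Rightarrow> bool" where
  "tape_output tp y \<longleftrightarrow>
     (\<forall>i < length y. fst tp (snd tp + int i) = bit_symbol (y ! i)) \<and>
     fst tp (snd tp + int (length y)) = 0"

definition halts_with :: "tm \<Rightarrow> bool list \<Rightarrow> nat \<Rightarrow> bool list \<Rightarrow> bool" where
  "halts_with M x t y \<longleftrightarrow>
     fst ((tm_step M ^^ t) (tm_init M x)) = tm_halt M \<and>
     tape_output (hd (snd ((tm_step M ^^ t) (tm_init M x)))) y"

definition polytime_computable :: "(bool list \<Rightarrow> bool list) \<Rightarrow> bool" where
  "polytime_computable f \<longleftrightarrow>
     (\<exists>M (p :: nat poly). wf_tm M \<and> (\<forall>x. \<exists>t \<le> poly p (length x). halts_with M x t (f x)))"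

text \<open>Languages are sets of words over \<open>{0, 1}\<close>; a language is decided by computing its
  characteristic function.\<close>

definition polytime_decidable :: "bool list set \<Rightarrow> bool" where
  "polytime_decidable L \<longleftrightarrow> polytime_computable (\<lambda>x. [x \<in> L])"

text \<open>A self-delimiting code: every bit is preceded by 1, and the word is terminated by 0.\<close>

definition delimited :: "bool list \<Rightarrow> bool list" where
  "delimited x = concat (map (\<lambda>b. [True, b]) x) @ [False]"

definition encode_pair :: "bool list \<Rightarrow> bool list \<Rightarrow> bool list" where
  "encode_pair x y = delimited x @ y"

definition in_NP :: "bool list set \<Rightarrow> bool" where
  "in_NP L \<longleftrightarrow>
     (\<exists>V (p :: nat poly). polytime_decidable V \<and>
        (\<forall>x. x \<in> L \<longleftrightarrow> (\<exists>y. length y \<le> poly p (length x) \<and> encode_pair x y \<in> V)))"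

definition polytime_reducible :: "bool list set \<Rightarrow> bool list set \<Rightarrow> bool" where
  "polytime_reducible L L' \<longleftrightarrow> (\<exists>f. polytime_computable f \<and> (\<forall>x. x \<in> L \<longleftrightarrow> f x \<in> L'))"

definition NP_hard :: "bool list set \<Rightarrow> bool" where
  "NP_hard L \<longleftrightarrow> (\<forall>L'. in_NP L' \<longrightarrow> polytime_reducible L' L)"

definition NP_complete :: "bool list set \<Rightarrow> bool" where
  "NP_complete L \<longleftrightarrow> in_NP L \<and> NP_hard L"

definition grid :: "nat \<Rightarrow> nat \<Rightarrow> (nat \<times> nat) set" where
  "grid N M = {1..N} \<times> {1..M}"

definition rectangles :: "nat \<Rightarrow> nat \<Rightarrow> (nat \<times> nat) set set" where
  "rectangles N M =
     {R. R \<subseteq> grid N M \<and>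
         (\<exists>a b c1 c2. 0 < a \<and> 0 < b \<and> 0 < c1 \<and> 0 < c2 \<and>
            R = {(a, b), (a + c1, b), (a + c1, b + c2), (a, b + c2)})}"

definition coloring :: "nat \<Rightarrow> nat \<Rightarrow> nat \<Rightarrow> (nat \<times> nat \<Rightarrow> nat) \<Rightarrow> bool" where
  "coloring N M c \<psi> \<longleftrightarrow>
     (\<forall>z \<in> grid N M. \<psi> z \<in> {1..c}) \<and>
     (\<forall>R \<in> rectangles N M. \<not> (\<exists>k. \<forall>z \<in> R. \<psi> z = k))"

definition partial_mapping :: "nat \<Rightarrow> nat \<Rightarrow> nat \<Rightarrow> (nat \<times> nat \<rightharpoonup> nat) \<Rightarrow> bool" where
  "partial_mapping N M c \<chi> \<longleftrightarrow> dom \<chi> \<subseteq> grid N M \<and> ran \<chi> \<subseteq> {1..c}"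

definition extendable :: "nat \<Rightarrow> nat \<Rightarrow> nat \<Rightarrow> (nat \<times> nat \<rightharpoonup> nat) \<Rightarrow> bool" where
  "extendable N M c \<chi> \<longleftrightarrow>
     (\<exists>\<psi>. coloring N M c \<psi> \<and> (\<forall>z \<in> dom \<chi>. \<chi> z = Some (\<psi> z)))"

definition GCE :: "(nat \<times> nat \<times> nat \<times> (nat \<times> nat \<rightharpoonup> nat)) set" where
  "GCE = {(N, M, c, \<chi>). partial_mapping N M c \<chi> \<and> extendable N M c \<chi>}"

text \<open>Encoding of instances. The partial mapping is given as the list of its colored cells with their
  colors. The side lengths of the grid, and hence the cell coordinates, are written in unary, so that
  the number of cells is polynomially bounded in the size of the instance; the number of colors and the
  colors themselves are written in binary (least significant bit first).\<close>

definition unary :: "nat \<Rightarrow> bool list" where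
  "unary n = replicate n True @ [False]"

fun binary :: "nat \<Rightarrow> bool list" where
  "binary n = (if n = 0 then [] else odd n # binary (n div 2))"

declare binary.simps [simp del]

fun encode_entry :: "(nat \<times> nat) \<times> nat \<Rightarrow> bool list" where
  "encode_entry ((a, b), k) = unary a @ unary b @ delimited (binary k)"

definition encode_instance :: "nat \<Rightarrow> nat \<Rightarrow> nat \<Rightarrow> ((nat \<times> nat) \<times> nat) list \<Rightarrow> bool list" where
  "encode_instance N M c T =
     unary N @ unary M @ delimited (binary c) @ concat (map encode_entry T)"

text \<open>The entries of the table may be listed in any order, but no cell is listed twice.\<close>

definition GCE_language :: "bool list set" where
  "GCE_language =
     {encode_instance N M c T | N M c T. distinct (map fst T) \<and> (N, M, c, map_of T) \<in> GCE}"

end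

(* Polynomial-time computability is established in two layers: programs over finitely many stacks of
bits are compiled to Turing machines, and the functions on binary trees computed by such programs in
polynomial time are closed under iteration as long as the intermediate results stay polynomially
bounded. Via an encoding of data as trees, ordinary functions on numbers and lists inherit this.

Hardness is reduced from the halting of an arbitrary verifier. A CNF formula states the facts about a
run of the verifier on a guessed certificate; all its clauses but the guesses are definite, so every
satisfying assignment contains the facts about an actual run. From a CNF formula we get a grid whose
only free cells lie in one row, one for each clause. A clause selects one of its literals by taking the
colour of the variable of this literal; the other colours are blocked by precoloured cells, and so is
the joint selection of two complementary literals. *)

theory Submission imports Defs begin

section \<open>Stack programs and Turing machines\<close>

text \<open>Filler cells of the grid need colours too, and a clause could take such a filler colour
  unless it is blocked by a row of its own. That row and the row containing the filler then agree in
  a clause column, so the precoloured part on the right must keep them apart. This dictates the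
  right part: the identity for the rows of filler colours, a reflection for the rows of variables,
  shifts for the conflicts, all modulo an odd number of colours, so that a reflection has exactly
  one fixed point and a shift none.

  The formula has no clauses for the uniqueness of state, head position or cell contents. An
  assignment may state more than a run does; the only purely negative clause still says that the run
  contained in it does not reject.

  Numbers are unary in the tree layer, so counting loops and tables over index ranges are
  polynomial. The colours of an instance are binary and may be exponentially large; the verifier
  therefore treats them as words throughout.\<close>

datatype prog =
    Skip | Push nat bool | Pop nat | Seq prog prog | IfTop nat prog prog | While nat prog

type_synonym store = "nat \<Rightarrow> bool list"

text \<open>The counter is the exact number of steps of the compiled machine. A push takes two of
  them since a machine writes before it moves: the first step moves the head to the left, the second
  writes. Every test of an \<open>IfTop\<close> or a \<open>While\<close> costs one step.\<close>

inductive exec :: "prog \<Rightarrow> store \<Rightarrow> nat \<Rightarrow> store \<Rightarrow> bool" where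
  exec_Skip: "exec Skip s 1 s"
| exec_Push: "exec (Push r b) s 2 (s(r := b # s r))"
| exec_Pop: "exec (Pop r) s 1 (s(r := tl (s r)))"
| exec_Seq: "exec a s t s' \<Longrightarrow> exec b s' t' s'' \<Longrightarrow> exec (Seq a b) s (t + t') s''"
| exec_IfTrue: "s r = True # w \<Longrightarrow> exec a s t s' \<Longrightarrow> exec (IfTop r a b) s (Suc t) s'"
| exec_IfFalse: "s r = [] \<or> \<not> hd (s r) \<Longrightarrow> exec b s t s' \<Longrightarrow> exec (IfTop r a b) s (Suc t) s'"
| exec_While_Nil: "s r = [] \<Longrightarrow> exec (While r a) s 1 s"
| exec_While_Cons: "s r \<noteq> [] \<Longrightarrow> exec a s t s' \<Longrightarrow> exec (While r a) s' t' s''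
    \<Longrightarrow> exec (While r a) s (Suc (t + t')) s''"

primrec width :: "prog \<Rightarrow> nat" where
  "width Skip = 0"
| "width (Push r b) = Suc r"
| "width (Pop r) = Suc r"
| "width (Seq a b) = max (width a) (width b)"
| "width (IfTop r a b) = max (Suc r) (max (width a) (width b))"
| "width (While r a) = max (Suc r) (width a)"

primrec psize :: "prog \<Rightarrow> nat" where
  "psize Skip = 1"
| "psize (Push r b) = 2"
| "psize (Pop r) = 1"
| "psize (Seq a b) = psize a + psize b"
| "psize (IfTop r a b) = Suc (psize a + psize b)"
| "psize (While r a) = Suc (psize a)"

definition keep :: "nat list \<Rightarrow> (nat \<times> direction) list" where
  "keep v = map (\<lambda>x. (x, Stay)) v"

text \<open>In \<open>transition P i e\<close> the program occupies the states from \<open>i\<close> on and leaves to state \<open>e\<close>.\<close>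

primrec transition :: "prog \<Rightarrow> nat \<Rightarrow> nat \<Rightarrow> nat \<Rightarrow> nat list \<Rightarrow> nat \<times> (nat \<times> direction) list" where
  "transition Skip i e q v = (e, keep v)"
| "transition (Push r b) i e q v =
     (if q = i then (Suc i, (keep v)[r := (v ! r, Left)])
      else (e, (keep v)[r := (bit_symbol b, Stay)]))"
| "transition (Pop r) i e q v = (e, (keep v)[r := (v ! r, Right)])"
| "transition (Seq a b) i e q v =
     (if q < i + psize a then transition a i (i + psize a) q v else transition b (i + psize a) e q v)"
| "transition (IfTop r a b) i e q v =
     (if q = i then (if v ! r = 2 then Suc i else Suc i + psize a, keep v)
      else if q < Suc i + psize a then transition a (Suc i) e q v
      else transition b (Suc i + psize a) e q v)"
| "transition (While r a) i e q v =
     (if q = i then (if v ! r = 0 then e else Suc i, keep v) else transition a (Suc i) i q v)"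

definition machine :: "nat \<Rightarrow> prog \<Rightarrow> tm" where
  "machine k P = \<lparr>tm_tapes = k, tm_symbols = 3, tm_states = Suc (psize P), tm_start = 0,
     tm_halt = psize P,
     tm_delta = (\<lambda>q v. if q < psize P then transition P 0 (psize P) q v else (q, keep v))\<rparr>"

lemma bit_symbol_less [simp]: "bit_symbol b < 3" "0 < bit_symbol b"
  by (cases b; simp)+

lemma bit_symbol_eq [simp]: "bit_symbol b = 2 \<longleftrightarrow> b" "bit_symbol b = bit_symbol c \<longleftrightarrow> b = c"
  by (cases b; cases c; simp)+

lemma transition_ok:
  "i \<le> q \<Longrightarrow> q < i + psize P \<Longrightarrow> i + psize P \<le> n \<Longrightarrow> e \<le> n \<Longrightarrow> width P \<le> length v
   \<Longrightarrow> \<forall>x \<in> set v. x < 3 \<Longrightarrow>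
   fst (transition P i e q v) \<le> n \<and> length (snd (transition P i e q v)) = length v \<and>
   (\<forall>x \<in> set (snd (transition P i e q v)). fst x < 3)"
proof (induction P arbitrary: i e)
  case (Seq a b)
  show ?case
    using Seq.IH(1)[of i "i + psize a"] Seq.IH(2)[of "i + psize a" e] Seq.prems by simp
next
  case (IfTop r a b)
  show ?case
    using IfTop.IH(1)[of "Suc i" e] IfTop.IH(2)[of "Suc i + psize a" e] IfTop.prems
    by (auto simp: keep_def)
next
  case (While r a)
  show ?case
    using While.IH[of "Suc i" i] While.prems by (auto simp: keep_def)
qed (auto simp: keep_def dest!: subsetD[OF set_update_subset_insert])

lemma wf_machine:
  assumes "width P \<le> k" "0 < k"
  shows "wf_tm (machine k P)"
proof -
  let ?d = "tm_delta (machine k P)"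
  have "fst (?d q v) < Suc (psize P) \<and> length (snd (?d q v)) = k \<and>
        (\<forall>a \<in> set (snd (?d q v)). fst a < 3)"
    if "q < Suc (psize P)" "length v = k \<and> (\<forall>s \<in> set v. s < 3)" for q v
    using transition_ok[of 0 q P "psize P" "psize P" v] that assms
    by (auto simp: machine_def keep_def less_Suc_eq_le)
  then show ?thesis
    using assms unfolding wf_tm_def
    by (intro conjI allI impI) (simp_all add: machine_def)
qed

text \<open>Nothing is said about the cells to the left of the head. A pop moves right and leaves
  the old symbol behind, and a later push overwrites it. All cells beyond the word are blank, so
  popping an empty stack keeps it empty.\<close>

definition on_tape :: "tape \<Rightarrow> bool list \<Rightarrow> bool" where
  "on_tape tp w \<longleftrightarrow>
     (\<forall>i. fst tp (snd tp + int i) = (if i < length w then bit_symbol (w ! i) else 0))"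

definition stored :: "nat \<Rightarrow> store \<Rightarrow> tape list \<Rightarrow> bool" where
  "stored k s ts \<longleftrightarrow> length ts = k \<and> (\<forall>r < k. on_tape (ts ! r) (s r))"

lemma read_on_tape:
  assumes "on_tape tp w"
  shows "read_tape tp = (case w of [] \<Rightarrow> 0 | b # _ \<Rightarrow> bit_symbol b)"
proof -
  obtain f h where [simp]: "tp = (f, h)" by (cases tp)
  show ?thesis
    using assms[unfolded on_tape_def, rule_format, of 0] by (auto split: list.split)
qed

lemma on_tape_pop:
  assumes "on_tape tp w"
  shows "on_tape (act_tape (read_tape tp, Right) tp) (tl w)"
proof -
  obtain f h where [simp]: "tp = (f, h)" by (cases tp)
  have "f (h + 1 + int i) = (if i < length (tl w) then bit_symbol (tl w ! i) else 0)" for i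
    using assms[unfolded on_tape_def, rule_format, of "Suc i"]
    by (cases w) (auto simp: ac_simps)
  then show ?thesis by (simp add: on_tape_def)
qed

lemma on_tape_push:
  assumes "on_tape tp w"
  shows "on_tape (act_tape (bit_symbol b, Stay) (act_tape (read_tape tp, Left) tp)) (b # w)"
proof -
  obtain f h where [simp]: "tp = (f, h)" by (cases tp)
  have "(f(h - 1 := bit_symbol b)) (h - 1 + int i)
      = (if i < length (b # w) then bit_symbol ((b # w) ! i) else 0)" for i
    using assms[unfolded on_tape_def, rule_format, of "i - 1"]
    by (cases i) (auto simp: ac_simps)
  then show ?thesis by (simp add: on_tape_def)
qed

lemma act_tape_read [simp]: "act_tape (read_tape tp, Stay) tp = tp"
  by (cases tp) auto

lemma map2_keep [simp]: "map2 act_tape (keep (map read_tape ts)) ts = ts"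
  by (rule nth_equalityI) (auto simp: keep_def)

lemma map2_keep_update:
  "r < length ts \<Longrightarrow>
   map2 act_tape ((keep (map read_tape ts))[r := a]) ts = ts[r := act_tape a (ts ! r)]"
  by (rule nth_equalityI) (auto simp: keep_def nth_list_update)

lemma stored_update:
  "stored k s ts \<Longrightarrow> on_tape tp w \<Longrightarrow> stored k (s(r := w)) (ts[r := tp])"
  by (auto simp: stored_def nth_list_update)

lemma tm_step_keep:
  "q \<noteq> tm_halt M \<Longrightarrow> tm_delta M q (map read_tape ts) = (q', keep (map read_tape ts)) \<Longrightarrow>
   tm_step M (q, ts) = (q', ts)"
  by simp

lemma tm_step_update:
  "q \<noteq> tm_halt M \<Longrightarrow> r < length ts \<Longrightarrow>
   tm_delta M q (map read_tape ts) = (q', (keep (map read_tape ts))[r := a]) \<Longrightarrow>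
   tm_step M (q, ts) = (q', ts[r := act_tape a (ts ! r)])"
  by (simp add: map2_keep_update)

lemma funpow_trans: "(f ^^ m) x = y \<Longrightarrow> (f ^^ n) y = z \<Longrightarrow> (f ^^ (m + n)) x = z"
  by (metis add.commute comp_apply funpow_add)

lemma stored_read:
  "stored k s ts \<Longrightarrow> r < k \<Longrightarrow>
   map read_tape ts ! r = (case s r of [] \<Rightarrow> 0 | b # _ \<Rightarrow> bit_symbol b)"
  using read_on_tape by (auto simp: stored_def)

text \<open>Formulated for a block of states with entry \<open>i\<close> and exit \<open>e\<close>
  inside an arbitrary machine, so that the induction can descend into subprograms. The body of a
  loop is such a block whose exit is the test of the loop.\<close>

lemma exec_simulated:
  assumes "exec P s t s'" "width P \<le> tm_tapes M" "stored (tm_tapes M) s ts"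
    "\<And>q v. i \<le> q \<Longrightarrow> q < i + psize P \<Longrightarrow> tm_delta M q v = transition P i e q v"
    "\<And>q. i \<le> q \<Longrightarrow> q < i + psize P \<Longrightarrow> q \<noteq> tm_halt M"
  shows "\<exists>ts'. (tm_step M ^^ t) (i, ts) = (e, ts') \<and> stored (tm_tapes M) s' ts'"
  using assms
proof (induction arbitrary: ts i e rule: exec.induct)
  case (exec_Skip s)
  then show ?case
    using tm_step_keep[of i M ts e] by (simp del: tm_step.simps)
next
  case (exec_Push r b s)
  let ?ts = "ts[r := act_tape (read_tape (ts ! r), Left) (ts ! r)]"
  have len: "length ts = tm_tapes M" "r < length ts"
    using exec_Push.prems by (auto simp: stored_def)
  have 1: "tm_step M (i, ts) = (Suc i, ?ts)"
    by (rule tm_step_update) (use exec_Push.prems len in auto)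
  have 2: "tm_step M (Suc i, ?ts) = (e, ?ts[r := act_tape (bit_symbol b, Stay) (?ts ! r)])"
    by (rule tm_step_update) (use exec_Push.prems len in auto)
  have "on_tape (ts ! r) (s r)"
    using exec_Push.prems len by (auto simp: stored_def)
  from on_tape_push[OF this, of b]
  have "stored (tm_tapes M) (s(r := b # s r)) (ts[r := act_tape (bit_symbol b, Stay) (?ts ! r)])"
    using stored_update exec_Push.prems(2) len by simp
  then have "stored (tm_tapes M) (s(r := b # s r)) (?ts[r := act_tape (bit_symbol b, Stay) (?ts ! r)])"
    by (simp add: fun_upd_def)
  moreover have "(tm_step M ^^ 2) (i, ts) = (e, ?ts[r := act_tape (bit_symbol b, Stay) (?ts ! r)])"
    using 1 2 by (simp only: numeral_2_eq_2 funpow.simps comp_apply id_apply)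
  ultimately show ?case by blast
next
  case (exec_Pop r s)
  have len: "length ts = tm_tapes M" "r < length ts"
    using exec_Pop.prems by (auto simp: stored_def)
  have 1: "tm_step M (i, ts) = (e, ts[r := act_tape (read_tape (ts ! r), Right) (ts ! r)])"
    by (rule tm_step_update) (use exec_Pop.prems len in auto)
  have "on_tape (ts ! r) (s r)"
    using exec_Pop.prems len by (auto simp: stored_def)
  from stored_update[OF exec_Pop.prems(2) on_tape_pop[OF this], of r]
  show ?case using 1 by (auto simp: fun_upd_def simp del: tm_step.simps)
next
  case (exec_Seq a s t s' b t' s'')
  obtain ts1 where 1: "(tm_step M ^^ t) (i, ts) = (i + psize a, ts1)" "stored (tm_tapes M) s' ts1"
    using exec_Seq.IH(1)[of ts i "i + psize a"] exec_Seq.prems by auto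
  obtain ts2 where 2: "(tm_step M ^^ t') (i + psize a, ts1) = (e, ts2)" "stored (tm_tapes M) s'' ts2"
    using exec_Seq.IH(2)[of ts1 "i + psize a" e] exec_Seq.prems 1 by auto
  show ?case using funpow_trans[OF 1(1) 2(1)] 2(2) by blast
next
  case (exec_IfTrue s r w a t s' b)
  have 1: "tm_step M (i, ts) = (Suc i, ts)"
    by (rule tm_step_keep) (use exec_IfTrue.prems exec_IfTrue.hyps stored_read[of _ s ts r] in auto)
  obtain ts2 where 2: "(tm_step M ^^ t) (Suc i, ts) = (e, ts2)" "stored (tm_tapes M) s' ts2"
    using exec_IfTrue.IH[of ts "Suc i" e] exec_IfTrue.prems by auto
  show ?case using funpow_trans[of 1 "tm_step M" "(i, ts)", OF _ 2(1)] 1 2(2) by (auto simp del: tm_step.simps)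
next
  case (exec_IfFalse s r b t s' a)
  have "map read_tape ts ! r \<noteq> 2"
    using exec_IfFalse.hyps(1) exec_IfFalse.prems stored_read[of _ s ts r] by (auto split: list.splits)
  then have 1: "tm_step M (i, ts) = (Suc i + psize a, ts)"
    by (intro tm_step_keep) (use exec_IfFalse.prems in auto)
  obtain ts2 where 2: "(tm_step M ^^ t) (Suc i + psize a, ts) = (e, ts2)" "stored (tm_tapes M) s' ts2"
    using exec_IfFalse.IH[of ts "Suc i + psize a" e] exec_IfFalse.prems by auto
  show ?case using funpow_trans[of 1 "tm_step M" "(i, ts)", OF _ 2(1)] 1 2(2) by (auto simp del: tm_step.simps)
next
  case (exec_While_Nil s r a)
  have 1: "tm_step M (i, ts) = (e, ts)"
    by (rule tm_step_keep) (use exec_While_Nil stored_read[of _ s ts r] in auto)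
  then show ?case using exec_While_Nil by (auto simp del: tm_step.simps)
next
  case (exec_While_Cons s r a t s' t' s'')
  have "map read_tape ts ! r \<noteq> 0"
    using exec_While_Cons.hyps(1) exec_While_Cons.prems stored_read[of _ s ts r]
    by (auto split: list.splits)
  then have 1: "tm_step M (i, ts) = (Suc i, ts)"
    by (intro tm_step_keep) (use exec_While_Cons.prems in auto)
  obtain ts1 where 2: "(tm_step M ^^ t) (Suc i, ts) = (i, ts1)" "stored (tm_tapes M) s' ts1"
    using exec_While_Cons.IH(1)[of ts "Suc i" i] exec_While_Cons.prems by auto
  obtain ts2 where 3: "(tm_step M ^^ t') (i, ts1) = (e, ts2)" "stored (tm_tapes M) s'' ts2"
    using exec_While_Cons.IH(2)[of ts1 i e] exec_While_Cons.prems 2 by auto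
  show ?case
    using funpow_trans[of 1 "tm_step M" "(i, ts)", OF _ funpow_trans[OF 2(1) 3(1)]] 1 3(2)
    by (auto simp del: tm_step.simps)
qed

lemma exec_halts_with:
  assumes "exec P s t s'" "s = (\<lambda>r. if r = 0 then x else [])"
  shows "halts_with (machine (Suc (width P)) P) x t (s' 0)"
proof -
  let ?k = "Suc (width P)" and ?M = "machine (Suc (width P)) P"
  have "on_tape (input_tape x) x" "on_tape blank_tape []"
    by (auto simp: on_tape_def input_tape_def blank_tape_def)
  then have st: "stored ?k s (snd (tm_init ?M x))"
    using assms(2) by (auto simp: stored_def tm_init_def machine_def nth_Cons split: nat.split)
  have "\<exists>ts'. (tm_step ?M ^^ t) (0, snd (tm_init ?M x)) = (psize P, ts') \<and> stored (tm_tapes ?M) s' ts'"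
    by (rule exec_simulated[OF assms(1)]) (use st in \<open>auto simp: machine_def\<close>)
  then obtain ts' where ts': "(tm_step ?M ^^ t) (tm_init ?M x) = (psize P, ts')" "stored ?k s' ts'"
    by (auto simp: machine_def tm_init_def)
  then have "on_tape (hd ts') (s' 0)"
    by (cases ts') (auto simp: stored_def)
  then have "tape_output (hd ts') (s' 0)"
    by (simp add: on_tape_def tape_output_def)
  then show ?thesis using ts'(1) by (simp add: halts_with_def machine_def)
qed

section \<open>Polynomial-time functions on trees\<close>

definition poly_bounded :: "(nat \<Rightarrow> nat) \<Rightarrow> bool" where
  "poly_bounded f \<longleftrightarrow> (\<exists>p. \<forall>n. f n \<le> poly p n)"

text \<open>The coefficients are natural numbers, hence nonnegative. Monotonicity turns a bound on
  an intermediate size into a bound on the time of the program that runs on it.\<close>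

lemma poly_mono_nat: "m \<le> n \<Longrightarrow> poly p m \<le> poly p n" for p :: "nat poly"
  by (induction p) (auto intro!: add_mono mult_mono)

lemma poly_bounded_const: "poly_bounded (\<lambda>n. c)"
  unfolding poly_bounded_def by (rule exI[of _ "[:c:]"]) simp

lemma poly_bounded_id: "poly_bounded (\<lambda>n. n)"
  unfolding poly_bounded_def by (rule exI[of _ "[:0, 1:]"]) simp

lemma
  assumes "poly_bounded f" "poly_bounded g"
  shows poly_bounded_add: "poly_bounded (\<lambda>n. f n + g n)"
    and poly_bounded_mult: "poly_bounded (\<lambda>n. f n * g n)"
proof -
  from assms obtain p q where "\<forall>n. f n \<le> poly p n" "\<forall>n. g n \<le> poly q n"
    by (auto simp: poly_bounded_def)
  then have "\<forall>n. f n + g n \<le> poly (p + q) n" "\<forall>n. f n * g n \<le> poly (p * q) n"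
    by (auto intro: add_mono mult_mono)
  then show "poly_bounded (\<lambda>n. f n + g n)" "poly_bounded (\<lambda>n. f n * g n)"
    unfolding poly_bounded_def by blast+
qed

lemma poly_bounded_poly:
  assumes "poly_bounded f"
  shows "poly_bounded (\<lambda>n. poly p (f n))"
proof -
  from assms obtain q where "\<forall>n. f n \<le> poly q n" by (auto simp: poly_bounded_def)
  then have "\<forall>n. poly p (f n) \<le> poly (pcompose p q) n"
    by (auto simp: poly_pcompose intro: poly_mono_nat)
  then show ?thesis unfolding poly_bounded_def by blast
qed

lemma poly_bounded_Suc: "poly_bounded f \<Longrightarrow> poly_bounded (\<lambda>n. Suc (f n))"
  using poly_bounded_add[OF poly_bounded_const[of 1]] by simp

lemmas poly_bounded_intros = poly_bounded_const poly_bounded_id poly_bounded_add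
  poly_bounded_mult poly_bounded_poly poly_bounded_Suc

text \<open>Upper bounds replace exact times, so that rough bounds can be added up along a
  program.\<close>

definition runs :: "prog \<Rightarrow> store \<Rightarrow> nat \<Rightarrow> store \<Rightarrow> bool" where
  "runs P s T s' \<longleftrightarrow> (\<exists>t \<le> T. exec P s t s')"

lemma runs_Skip: "runs Skip s 1 s"
  unfolding runs_def using exec_Skip by blast

lemma runs_Push: "runs (Push r b) s 2 (s(r := b # s r))"
  unfolding runs_def using exec_Push by blast

lemma runs_Pop: "runs (Pop r) s 1 (s(r := tl (s r)))"
  unfolding runs_def using exec_Pop by blast

lemma runs_Seq: "runs a s T s' \<Longrightarrow> runs b s' T' s'' \<Longrightarrow> runs (Seq a b) s (T + T') s''"
  unfolding runs_def using exec_Seq add_mono by blast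

lemma runs_IfTrue: "s r = True # w \<Longrightarrow> runs a s T s' \<Longrightarrow> runs (IfTop r a b) s (Suc T) s'"
  unfolding runs_def using exec_IfTrue Suc_le_mono by blast

lemma runs_IfFalse: "s r = [] \<or> \<not> hd (s r) \<Longrightarrow> runs b s T s' \<Longrightarrow> runs (IfTop r a b) s (Suc T) s'"
  unfolding runs_def using exec_IfFalse Suc_le_mono by blast

lemma runs_While_Nil: "s r = [] \<Longrightarrow> runs (While r a) s 1 s"
  unfolding runs_def using exec_While_Nil by blast

lemma runs_While_step:
  "runs a s T s' \<Longrightarrow> runs (While r a) s' T' s'' \<Longrightarrow> s r \<noteq> [] \<Longrightarrow> Suc (T + T') \<le> U \<Longrightarrow>
   runs (While r a) s U s''"
  unfolding runs_def using exec_While_Cons[of s r a] by (meson Suc_le_mono add_mono order_trans)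

lemma runs_mono: "runs P s T s' \<Longrightarrow> T \<le> T' \<Longrightarrow> runs P s T' s'"
  unfolding runs_def using order_trans by blast

lemma runs_cong: "runs P s T s' \<Longrightarrow> T \<le> T' \<Longrightarrow> s' = s'' \<Longrightarrow> runs P s T' s''"
  using runs_mono by simp

section \<open>Moving, copying and erasing stacks\<close>

definition move :: "nat \<Rightarrow> nat \<Rightarrow> prog" where
  "move r d = While r (IfTop r (Seq (Pop r) (Push d True)) (Seq (Pop r) (Push d False)))"

lemma runs_pop_push:
  "r \<noteq> d \<Longrightarrow> s r = b # w \<Longrightarrow>
   runs (Seq (Pop r) (Push d c)) s 3 (s(r := w, d := c # s d))"
  by (rule runs_cong[OF runs_Seq[OF runs_Pop runs_Push]]) auto

lemma runs_move:
  "r \<noteq> d \<Longrightarrow> runs (move r d) s (5 * length (s r) + 1) (s(r := [], d := rev (s r) @ s d))"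
proof (induction "s r" arbitrary: s)
  case Nil
  then show ?case
    unfolding move_def by (intro runs_cong[OF runs_While_Nil]) auto
next
  case (Cons b w)
  let ?s = "s(r := w, d := b # s d)"
  have "runs (IfTop r (Seq (Pop r) (Push d True)) (Seq (Pop r) (Push d False))) s 4 ?s"
    using runs_pop_push[of r d s b w b] Cons.prems Cons.hyps(2)[symmetric]
    by (cases b) (auto intro: runs_cong[OF runs_IfTrue] runs_cong[OF runs_IfFalse])
  moreover have "runs (move r d) ?s (5 * length w + 1) (s(r := [], d := rev (s r) @ s d))"
    using Cons.hyps(1)[of ?s] Cons.prems Cons.hyps(2)[symmetric]
    by (auto simp: fun_upd_twist elim!: runs_cong)
  ultimately show ?case
    unfolding move_def by (rule runs_While_step) (use Cons.hyps(2)[symmetric] in auto)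
qed

definition fork :: "nat \<Rightarrow> nat \<Rightarrow> nat \<Rightarrow> prog" where
  "fork r d e = While r (IfTop r
     (Seq (Seq (Pop r) (Push d True)) (Push e True))
     (Seq (Seq (Pop r) (Push d False)) (Push e False)))"

lemma runs_fork:
  "distinct [r, d, e] \<Longrightarrow>
   runs (fork r d e) s (7 * length (s r) + 1) (s(r := [], d := rev (s r) @ s d, e := rev (s r) @ s e))"
proof (induction "s r" arbitrary: s)
  case Nil
  then show ?case
    unfolding fork_def by (intro runs_cong[OF runs_While_Nil]) auto
next
  case (Cons b w)
  let ?s = "s(r := w, d := b # s d, e := b # s e)"
  have "runs (Seq (Seq (Pop r) (Push d b)) (Push e b)) s 5 ?s"
    using Cons.prems Cons.hyps(2)[symmetric]
    by (intro runs_cong[OF runs_Seq[OF runs_pop_push runs_Push]]) auto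
  then have "runs (IfTop r (Seq (Seq (Pop r) (Push d True)) (Push e True))
     (Seq (Seq (Pop r) (Push d False)) (Push e False))) s 6 ?s"
    using Cons.hyps(2)[symmetric]
    by (cases b) (auto intro: runs_cong[OF runs_IfTrue] runs_cong[OF runs_IfFalse])
  moreover have "runs (fork r d e) ?s (7 * length w + 1)
      (s(r := [], d := rev (s r) @ s d, e := rev (s r) @ s e))"
    using Cons.hyps(1)[of ?s] Cons.prems Cons.hyps(2)[symmetric]
    by (auto simp: fun_upd_twist elim!: runs_cong)
  ultimately show ?case
    unfolding fork_def by (rule runs_While_step) (use Cons.hyps(2)[symmetric] in auto)
qed

text \<open>\<open>move\<close> reverses the word onto the auxiliary stack, and \<open>fork\<close>
  reverses it back onto both \<open>r\<close> and \<open>d\<close>.\<close>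

definition copy :: "nat \<Rightarrow> nat \<Rightarrow> nat \<Rightarrow> prog" where
  "copy r d u = Seq (move r u) (fork u r d)"

lemma runs_copy:
  assumes "distinct [r, d, u]" "s u = []"
  shows "runs (copy r d u) s (12 * length (s r) + 2) (s(d := s r @ s d))"
  unfolding copy_def
  by (rule runs_cong[OF runs_Seq[OF runs_move runs_fork]]) (use assms in \<open>auto simp: fun_eq_iff\<close>)

definition transfer :: "nat \<Rightarrow> nat \<Rightarrow> nat \<Rightarrow> prog" where
  "transfer r d u = Seq (move r u) (move u d)"

lemma runs_transfer:
  assumes "distinct [r, d, u]" "s u = []"
  shows "runs (transfer r d u) s (10 * length (s r) + 2) (s(r := [], d := s r @ s d))"
  unfolding transfer_def
  by (rule runs_cong[OF runs_Seq[OF runs_move runs_move]]) (use assms in \<open>auto simp: fun_eq_iff\<close>)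

definition clear :: "nat \<Rightarrow> prog" where
  "clear r = While r (Pop r)"

lemma runs_clear: "runs (clear r) s (2 * length (s r) + 1) (s(r := []))"
proof (induction "s r" arbitrary: s)
  case Nil
  then show ?case
    unfolding clear_def by (intro runs_cong[OF runs_While_Nil]) auto
next
  case (Cons b w)
  have "runs (Pop r) s 1 (s(r := w))"
    using runs_Pop[of r s] Cons.hyps(2)[symmetric] by simp
  moreover have "runs (clear r) (s(r := w)) (2 * length w + 1) (s(r := []))"
    using Cons.hyps(1)[of "s(r := w)"] by simp
  ultimately show ?case
    unfolding clear_def by (rule runs_While_step) (use Cons.hyps(2)[symmetric] in auto)
qed

lemma width_simps [simp]:
  "width (move r d) = max (Suc r) (Suc d)"
  "width (fork r d e) = max (Suc r) (max (Suc d) (Suc e))"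
  "width (copy r d e) = max (Suc r) (max (Suc d) (Suc e))"
  "width (transfer r d e) = max (Suc r) (max (Suc d) (Suc e))"
  "width (clear r) = Suc r"
  by (auto simp: move_def fork_def copy_def transfer_def clear_def)

section \<open>Binary trees on stacks\<close>

datatype tree = Lf | Nd tree tree

text \<open>Trees are kept on the stacks in Polish notation.\<close>

primrec pol :: "tree \<Rightarrow> bool list" where
  "pol Lf = [False]"
| "pol (Nd a b) = True # pol a @ pol b"

primrec lft :: "tree \<Rightarrow> tree" where
  "lft Lf = Lf"
| "lft (Nd a b) = a"

primrec rgt :: "tree \<Rightarrow> tree" where
  "rgt Lf = Lf"
| "rgt (Nd a b) = b"

primrec nodes :: "tree \<Rightarrow> nat" where
  "nodes Lf = 0"
| "nodes (Nd a b) = Suc (nodes a + nodes b)"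

abbreviation tsize :: "tree \<Rightarrow> nat" where
  "tsize t \<equiv> length (pol t)"

text \<open>Each \<open>True\<close> of the Polish notation is an inner node. A stack that holds a
  tree thus serves as a loop counter, with one round for each \<open>True\<close>.\<close>

lemma length_filter_pol [simp]: "length (filter id (pol t)) = nodes t"
  by (induction t) auto

lemma nodes_le: "nodes t \<le> tsize t"
  by (induction t) auto

text \<open>The stack \<open>u\<close> holds one symbol for every subtree that is still to be read.\<close>

definition split_loop :: "nat \<Rightarrow> nat \<Rightarrow> nat \<Rightarrow> prog" where
  "split_loop r v u = While u (IfTop r
     (Seq (Seq (Pop r) (Push v True)) (Push u True))
     (Seq (Seq (Pop r) (Push v False)) (Pop u)))"

text \<open>The loop does not stop after the subtree \<open>a\<close> while others are pending on
  \<open>u\<close>. The claim therefore prepends the reading of \<open>a\<close> to an arbitrary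
  remaining run of the same loop; at a node the two induction hypotheses are chained in this
  way.\<close>

lemma runs_split_loop:
  "distinct [r, v, u] \<Longrightarrow> s r = pol a @ w \<Longrightarrow> s u = x # us \<Longrightarrow>
   runs (split_loop r v u) (s(r := w, v := rev (pol a) @ s v, u := us)) T s' \<Longrightarrow>
   runs (split_loop r v u) s (7 * tsize a + T) s'"
proof (induction a arbitrary: s w x us T)
  case Lf
  let ?s = "s(r := w, v := False # s v, u := us)"
  have "runs (Seq (Seq (Pop r) (Push v False)) (Pop u)) s 4 ?s"
    by (rule runs_cong[OF runs_Seq[OF runs_pop_push runs_Pop]]) (use Lf.prems in auto)
  then have "runs (IfTop r (Seq (Seq (Pop r) (Push v True)) (Push u True))
     (Seq (Seq (Pop r) (Push v False)) (Pop u))) s 5 ?s"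
    using Lf.prems by (intro runs_cong[OF runs_IfFalse]) auto
  from this Lf.prems(4)[unfolded split_loop_def pol.simps rev.simps append.simps] show ?case
    unfolding split_loop_def by (rule runs_While_step) (use Lf.prems in auto)
next
  case (Nd a b)
  let ?s = "s(r := pol a @ pol b @ w, v := True # s v, u := True # x # us)"
  have "runs (Seq (Seq (Pop r) (Push v True)) (Push u True)) s 5 ?s"
    using Nd.prems by (intro runs_cong[OF runs_Seq[OF runs_pop_push runs_Push]]) auto
  then have 1: "runs (IfTop r (Seq (Seq (Pop r) (Push v True)) (Push u True))
     (Seq (Seq (Pop r) (Push v False)) (Pop u))) s 6 ?s"
    using Nd.prems by (intro runs_cong[OF runs_IfTrue]) auto
  let ?s2 = "?s(r := pol b @ w, v := rev (pol a) @ ?s v, u := x # us)"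
  have eq: "?s2(r := w, v := rev (pol b) @ ?s2 v, u := us)
      = s(r := w, v := rev (pol (Nd a b)) @ s v, u := us)"
    using Nd.prems(1) by (auto simp: fun_eq_iff)
  have "runs (split_loop r v u) (?s2(r := w, v := rev (pol b) @ ?s2 v, u := us)) T s'"
    unfolding eq by (rule Nd.prems(4))
  then have "runs (split_loop r v u) ?s2 (7 * tsize b + T) s'"
    by (rule Nd.IH(2)[of ?s2 w x us, OF Nd.prems(1), rotated 2]) (use Nd.prems(1) in auto)
  then have 2: "runs (split_loop r v u) ?s (7 * tsize a + (7 * tsize b + T)) s'"
    by (rule Nd.IH(1)[of ?s "pol b @ w" True "x # us", OF Nd.prems(1), rotated 2])
       (use Nd.prems(1) in auto)
  from 1 2[unfolded split_loop_def] show ?case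
    unfolding split_loop_def by (rule runs_While_step) (use Nd.prems in auto)
qed

definition split_off :: "nat \<Rightarrow> nat \<Rightarrow> nat \<Rightarrow> prog" where
  "split_off r v u = Seq (Push u True) (split_loop r v u)"

lemma runs_split_off:
  assumes "distinct [r, v, u]" "s r = pol a @ w" "s u = []"
  shows "runs (split_off r v u) s (7 * tsize a + 3) (s(r := w, v := rev (pol a) @ s v))"
proof -
  let ?s = "s(r := w, v := rev (pol a) @ s v)"
  have "runs (split_loop r v u) ?s 1 ?s"
    unfolding split_loop_def by (rule runs_While_Nil) (use assms in auto)
  then have "runs (split_loop r v u) (s(u := [True])) (7 * tsize a + 1) ?s"
    by (intro runs_split_loop) (use assms in \<open>auto simp: fun_upd_twist fun_upd_idem\<close>)
  then show ?thesis
    unfolding split_off_def using assms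
    by (intro runs_cong[OF runs_Seq[OF runs_Push]]) auto
qed

lemma width_split_off [simp]: "width (split_off r v u) = max (Suc r) (max (Suc v) (Suc u))"
  by (auto simp: split_off_def split_loop_def)

section \<open>Closure properties of polynomial-time tree functions\<close>

definition clean :: "nat \<Rightarrow> store \<Rightarrow> bool" where
  "clean k s \<longleftrightarrow> (\<forall>r. 0 < r \<longrightarrow> r < k \<longrightarrow> s r = [])"

text \<open>One polynomial bounds both the time and the size of the result. All stacks except 0 end
  as they began: those below \<open>k\<close> are empty, those from \<open>k\<close> on have
  arbitrary contents. Larger programs keep intermediate results in the latter.\<close>

definition implements :: "prog \<Rightarrow> nat \<Rightarrow> nat poly \<Rightarrow> (tree \<Rightarrow> tree) \<Rightarrow> bool" where
  "implements P k p F \<longleftrightarrow> 0 < k \<and> width P \<le> k \<and> (\<forall>t. tsize (F t) \<le> poly p (tsize t)) \<and>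
     (\<forall>t s. s 0 = pol t \<longrightarrow> clean k s \<longrightarrow> runs P s (poly p (tsize t)) (s(0 := pol (F t))))"

definition FP :: "(tree \<Rightarrow> tree) \<Rightarrow> bool" where
  "FP F \<longleftrightarrow> (\<exists>P k p. implements P k p F)"

lemma implementsD:
  assumes "implements P k p F"
  shows "0 < k" "width P \<le> k" "tsize (F t) \<le> poly p (tsize t)"
    "s 0 = pol t \<Longrightarrow> clean k s \<Longrightarrow> runs P s (poly p (tsize t)) (s(0 := pol (F t)))"
  using assms by (auto simp: implements_def)

lemma FP_I:
  assumes "0 < k" "width P \<le> k" "poly_bounded B" "poly_bounded C"
    "\<And>t. tsize (F t) \<le> C (tsize t)"
    "\<And>t s. s 0 = pol t \<Longrightarrow> clean k s \<Longrightarrow> runs P s (B (tsize t)) (s(0 := pol (F t)))"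
  shows "FP F"
proof -
  from assms obtain p q where pq: "\<forall>n. B n \<le> poly p n" "\<forall>n. C n \<le> poly q n"
    by (auto simp: poly_bounded_def)
  have "tsize (F t) \<le> poly (p + q) (tsize t)" for t
    using assms(5)[of t] pq(2) le_trans trans_le_add2 by (metis poly_add)
  moreover have "runs P s (poly (p + q) (tsize t)) (s(0 := pol (F t)))"
    if "s 0 = pol t" "clean k s" for t s
    by (rule runs_mono[OF assms(6)[OF that]]) (use pq(1) in \<open>simp add: trans_le_add1\<close>)
  ultimately show ?thesis
    unfolding FP_def implements_def using assms(1,2) by blast
qed

lemma FP_size:
  assumes "FP F"
  obtains p where "\<And>t. tsize (F t) \<le> poly p (tsize t)"
  using assms implementsD(3) unfolding FP_def by metis

lemma FP_id: "FP (\<lambda>t. t)"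
  by (rule FP_I[of 1 Skip "\<lambda>_. 1" "\<lambda>n. n"])
     (auto intro!: runs_cong[OF runs_Skip] poly_bounded_intros)

lemma FP_comp:
  assumes "FP F" "FP G"
  shows "FP (\<lambda>t. F (G t))"
proof -
  obtain P k p where "implements P k p F" using assms(1) by (auto simp: FP_def)
  note P = implementsD[OF this]
  obtain Q j q where "implements Q j q G" using assms(2) by (auto simp: FP_def)
  note Q = implementsD[OF this]
  show ?thesis
  proof (rule FP_I)
    show "0 < max k j" "width (Seq Q P) \<le> max k j" using P Q by auto
    show "poly_bounded (\<lambda>n. poly q n + poly p (poly q n))" "poly_bounded (\<lambda>n. poly p (poly q n))"
      by (intro poly_bounded_intros)+
    show "tsize (F (G t)) \<le> poly p (poly q (tsize t))" for t
      using P(3) Q(3) poly_mono_nat order_trans by blast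
    show "runs (Seq Q P) s (poly q (tsize t) + poly p (poly q (tsize t))) (s(0 := pol (F (G t))))"
      if "s 0 = pol t" "clean (max k j) s" for t s
    proof (rule runs_Seq)
      show "runs Q s (poly q (tsize t)) (s(0 := pol (G t)))"
        using that by (intro Q(4)) (auto simp: clean_def)
      show "runs P (s(0 := pol (G t))) (poly p (poly q (tsize t))) (s(0 := pol (F (G t))))"
        by (rule runs_cong[OF P(4)[of _ "G t"]])
           (use that Q(3) in \<open>auto simp: clean_def intro: poly_mono_nat\<close>)
    qed
  qed
qed

lemma FP_Lf: "FP (\<lambda>_. Lf)"
proof (rule FP_I)
  show "0 < Suc 0" "width (Seq (clear 0) (Push 0 False)) \<le> Suc 0" by auto
  show "poly_bounded (\<lambda>n. 2 * n + 3)" "poly_bounded (\<lambda>n. 1)" by (intro poly_bounded_intros)+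
  show "runs (Seq (clear 0) (Push 0 False)) s (2 * tsize t + 3) (s(0 := pol Lf))"
    if "s 0 = pol t" for t s
    by (rule runs_cong[OF runs_Seq[OF runs_clear runs_Push]]) (use that in auto)
qed auto

text \<open>Common part of \<open>lft\<close> and \<open>rgt\<close>: once the root symbol is popped
  and the left subtree split off, the left subtree lies reversed on stack 1 and the right one
  remains on stack 0. \<open>Q\<close> keeps one of them.\<close>

lemma FP_subtree:
  assumes "width Q \<le> 3" "F Lf = Lf" "\<And>a b. tsize (F (Nd a b)) \<le> tsize a + tsize b"
    "\<And>a b s. clean 3 s \<Longrightarrow> runs Q (s(0 := pol b, 1 := rev (pol a))) (7 * (tsize a + tsize b) + 2)
       (s(0 := pol (F (Nd a b))))"
  shows "FP F"
proof (rule FP_I)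
  let ?P = "IfTop 0 (Seq (Pop 0) (Seq (split_off 0 1 2) Q)) Skip"
  show "0 < (3::nat)" "width ?P \<le> 3" using assms(1) by auto
  show "poly_bounded (\<lambda>n. 14 * n + 10)" "poly_bounded (\<lambda>n. n)" by (intro poly_bounded_intros)+
  show "tsize (F t) \<le> tsize t" for t
    using assms(2,3) by (cases t) (auto intro: le_SucI)
  show "runs ?P s (14 * tsize t + 10) (s(0 := pol (F t)))"
    if "s 0 = pol t" "clean 3 s" for t s
  proof (cases t)
    case Lf
    with that show ?thesis
      by (intro runs_cong[OF runs_IfFalse[OF _ runs_Skip]]) (auto simp: assms(2))
  next
    case (Nd a b)
    have s: "s 1 = []" "s 2 = []" "s (Suc 0) = []" using that by (auto simp: clean_def)
    let ?s = "s(0 := pol a @ pol b)"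
    have 1: "runs (split_off 0 1 2) ?s (7 * tsize a + 3) (s(0 := pol b, 1 := rev (pol a)))"
      by (rule runs_cong[OF runs_split_off[of _ _ _ _ a "pol b"]]) (use s in auto)
    have "runs (Pop 0) s 1 ?s"
      by (rule runs_cong[OF runs_Pop]) (use that Nd in auto)
    from runs_Seq[OF this runs_Seq[OF 1 assms(4)[OF that(2)]]] show ?thesis
      using Nd that by (intro runs_cong[OF runs_IfTrue]) auto
  qed
qed

lemma FP_rgt: "FP rgt"
proof (rule FP_subtree[of "clear 1"])
  show "runs (clear 1) (s(0 := pol b, 1 := rev (pol a))) (7 * (tsize a + tsize b) + 2)
      (s(0 := pol (rgt (Nd a b))))" if "clean 3 s" for a b s
    by (rule runs_cong[OF runs_clear]) (use that in \<open>auto simp: fun_eq_iff clean_def\<close>)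
qed auto

lemma FP_lft: "FP lft"
proof (rule FP_subtree[of "Seq (clear 0) (move 1 0)"])
  show "runs (Seq (clear 0) (move 1 0)) (s(0 := pol b, 1 := rev (pol a)))
      (7 * (tsize a + tsize b) + 2) (s(0 := pol (lft (Nd a b))))" if "clean 3 s" for a b s
    by (rule runs_cong[OF runs_Seq[OF runs_clear runs_move]])
       (use that in \<open>auto simp: fun_eq_iff clean_def\<close>)
qed auto

text \<open>Stack \<open>K\<close> keeps a copy of the input for \<open>G\<close>, stack
  \<open>K + 1\<close> the reversed result of \<open>F\<close>. Moving the latter on top of the
  result of \<open>G\<close> and pushing the root symbol gives the Polish notation of the
  node.\<close>

lemma FP_Nd:
  assumes "FP F" "FP G"
  shows "FP (\<lambda>t. Nd (F t) (G t))"
proof -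
  obtain P k p where "implements P k p F" using assms(1) by (auto simp: FP_def)
  note P = implementsD[OF this]
  obtain Q j q where "implements Q j q G" using assms(2) by (auto simp: FP_def)
  note Q = implementsD[OF this]
  define K where "K = max k j"
  have K: "0 < K" "k \<le> K" "j \<le> K" using P(1) by (auto simp: K_def)
  define prog where "prog = Seq (copy 0 K (K + 1)) (Seq P (Seq (move 0 (K + 1))
    (Seq (transfer K 0 (K + 2)) (Seq Q (Seq (move (K + 1) 0) (Push 0 True))))))"
  let ?B = "\<lambda>n. (12 * n + 2) + (poly p n + ((5 * poly p n + 1) + ((10 * n + 2) +
      (poly q n + ((5 * poly p n + 1) + 2)))))"
  show ?thesis
  proof (rule FP_I)
    show "0 < K + 3" "width prog \<le> K + 3" using P(2) Q(2) K by (auto simp: prog_def)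
    show "poly_bounded ?B" "poly_bounded (\<lambda>n. poly p n + poly q n + 1)"
      by (intro poly_bounded_intros)+
    show "tsize (Nd (F t) (G t)) \<le> poly p (tsize t) + poly q (tsize t) + 1" for t
      using P(3)[of t] Q(3)[of t] by simp
    show "runs prog s (?B (tsize t)) (s(0 := pol (Nd (F t) (G t))))"
      if s0: "s 0 = pol t" and cl: "clean (K + 3) s" for t s
    proof -
      have sK: "s K = []" "s (Suc K) = []" "s (Suc (Suc K)) = []" using cl K by (auto simp: clean_def)
      have 1: "runs (copy 0 K (K + 1)) s (12 * tsize t + 2) (s(K := pol t))"
        by (rule runs_cong[OF runs_copy]) (use sK s0 K in auto)
      have 2: "runs P (s(K := pol t)) (poly p (tsize t)) (s(K := pol t, 0 := pol (F t)))"
        by (rule P(4)) (use s0 K cl in \<open>auto simp: clean_def\<close>)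
      have 3: "runs (move 0 (K + 1)) (s(K := pol t, 0 := pol (F t))) (5 * poly p (tsize t) + 1)
          (s(K := pol t, 0 := [], K + 1 := rev (pol (F t))))"
        by (rule runs_cong[OF runs_move]) (use sK K P(3)[of t] in auto)
      have 4: "runs (transfer K 0 (K + 2)) (s(K := pol t, 0 := [], K + 1 := rev (pol (F t))))
          (10 * tsize t + 2) (s(0 := pol t, K + 1 := rev (pol (F t))))"
        by (rule runs_cong[OF runs_transfer]) (use sK K in \<open>auto simp: fun_eq_iff\<close>)
      have 5: "runs Q (s(0 := pol t, K + 1 := rev (pol (F t)))) (poly q (tsize t))
          (s(0 := pol (G t), K + 1 := rev (pol (F t))))"
        by (rule runs_cong[OF Q(4)[of _ t]]) (use K cl in \<open>auto simp: clean_def fun_upd_twist\<close>)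
      have 6: "runs (move (K + 1) 0) (s(0 := pol (G t), K + 1 := rev (pol (F t))))
          (5 * poly p (tsize t) + 1) (s(0 := pol (F t) @ pol (G t)))"
        by (rule runs_cong[OF runs_move]) (use sK P(3)[of t] in \<open>auto simp: fun_eq_iff\<close>)
      have 7: "runs (Push 0 True) (s(0 := pol (F t) @ pol (G t))) 2 (s(0 := pol (Nd (F t) (G t))))"
        by (rule runs_cong[OF runs_Push]) auto
      show ?thesis
        unfolding prog_def
        by (intro runs_Seq[OF 1] runs_Seq[OF 2] runs_Seq[OF 3] runs_Seq[OF 4] runs_Seq[OF 5]
            runs_Seq[OF 6] 7)
    qed
  qed
qed

text \<open>The first symbol of the Polish notation tells a leaf from a node, so a single test
  decides; \<open>reset\<close> then erases the value of \<open>C\<close> and brings back the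
  input.\<close>

lemma FP_If:
  assumes "FP C" "FP F" "FP G"
  shows "FP (\<lambda>t. if C t = Lf then F t else G t)"
proof -
  obtain R l c where "implements R l c C" using assms(1) by (auto simp: FP_def)
  note R = implementsD[OF this]
  obtain P k p where "implements P k p F" using assms(2) by (auto simp: FP_def)
  note P = implementsD[OF this]
  obtain Q j q where "implements Q j q G" using assms(3) by (auto simp: FP_def)
  note Q = implementsD[OF this]
  define K where "K = max l (max k j)"
  have K: "0 < K" "l \<le> K" "k \<le> K" "j \<le> K" using P(1) by (auto simp: K_def)
  define reset where "reset = Seq (clear 0) (transfer K 0 (K + 1))"
  define prog where
    "prog = Seq (copy 0 K (K + 1)) (Seq R (IfTop 0 (Seq reset Q) (Seq reset P)))"
  let ?r = "\<lambda>n. (2 * poly c n + 1) + (10 * n + 2)"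
  let ?B = "\<lambda>n. (12 * n + 2) + (poly c n + (1 + (?r n + (poly p n + poly q n))))"
  show ?thesis
  proof (rule FP_I)
    show "0 < K + 2" "width prog \<le> K + 2" using P(2) Q(2) R(2) K by (auto simp: prog_def reset_def)
    show "poly_bounded ?B" "poly_bounded (\<lambda>n. poly p n + poly q n)"
      by (intro poly_bounded_intros)+
    show "tsize (if C t = Lf then F t else G t) \<le> poly p (tsize t) + poly q (tsize t)" for t
      using P(3)[of t] Q(3)[of t] by simp
    show "runs prog s (?B (tsize t)) (s(0 := pol (if C t = Lf then F t else G t)))"
      if s0: "s 0 = pol t" and cl: "clean (K + 2) s" for t s
    proof -
      have sK: "s K = []" "s (Suc K) = []" using cl K by (auto simp: clean_def)
      have 1: "runs (copy 0 K (K + 1)) s (12 * tsize t + 2) (s(K := pol t))"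
        by (rule runs_cong[OF runs_copy]) (use sK s0 K in auto)
      have 2: "runs R (s(K := pol t)) (poly c (tsize t)) (s(K := pol t, 0 := pol (C t)))"
        by (rule R(4)) (use s0 K cl in \<open>auto simp: clean_def\<close>)
      have 3: "runs reset (s(K := pol t, 0 := pol (C t))) (?r (tsize t)) s"
        unfolding reset_def
      proof (rule runs_Seq)
        show "runs (clear 0) (s(K := pol t, 0 := pol (C t))) (2 * poly c (tsize t) + 1)
            (s(K := pol t, 0 := []))"
          by (rule runs_cong[OF runs_clear]) (use R(3)[of t] in auto)
        show "runs (transfer K 0 (K + 1)) (s(K := pol t, 0 := [])) (10 * tsize t + 2) s"
          by (rule runs_cong[OF runs_transfer]) (use sK s0 K in \<open>auto simp: fun_eq_iff\<close>)
      qed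
      have 4: "runs P s (poly p (tsize t) + poly q (tsize t)) (s(0 := pol (F t)))"
        by (rule runs_cong[OF P(4)[of s t]]) (use K cl s0 in \<open>auto simp: clean_def\<close>)
      have 5: "runs Q s (poly p (tsize t) + poly q (tsize t)) (s(0 := pol (G t)))"
        by (rule runs_cong[OF Q(4)[of s t]]) (use K cl s0 in \<open>auto simp: clean_def\<close>)
      have 6: "runs (IfTop 0 (Seq reset Q) (Seq reset P)) (s(K := pol t, 0 := pol (C t)))
          (1 + (?r (tsize t) + (poly p (tsize t) + poly q (tsize t))))
          (s(0 := pol (if C t = Lf then F t else G t)))"
      proof (cases "C t")
        case Lf
        then show ?thesis
          by (intro runs_cong[OF runs_IfFalse[OF _ runs_Seq[OF 3 4]]]) auto
      next
        case (Nd a b)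
        then show ?thesis
          by (intro runs_cong[OF runs_IfTrue[OF _ runs_Seq[OF 3 5]]]) auto
      qed
      show ?thesis
        unfolding prog_def by (intro runs_Seq[OF 1] runs_Seq[OF 2] 6)
    qed
  qed
qed

lemma runs_counted_loop:
  assumes "0 < r" "s 0 = pol t" "clean r s"
    "\<And>i s'. i < length (filter id (s r)) \<Longrightarrow> s' 0 = pol ((F ^^ i) t) \<Longrightarrow> clean r s' \<Longrightarrow>
       runs P s' b (s'(0 := pol ((F ^^ Suc i) t)))"
  shows "runs (While r (IfTop r (Seq (Pop r) P) (Pop r))) s ((b + 3) * length (s r) + 1)
     (s(0 := pol ((F ^^ length (filter id (s r))) t), r := []))"
  using assms
proof (induction "s r" arbitrary: s t)
  case Nil
  then show ?case by (intro runs_cong[OF runs_While_Nil]) (auto simp: fun_eq_iff)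
next
  case (Cons x w)
  note sr = Cons.hyps(2)[symmetric]
  let ?P = "IfTop r (Seq (Pop r) P) (Pop r)" and ?t = "if x then F t else t"
  let ?s = "s(r := w, 0 := pol ?t)"
  have "runs ?P s (b + 2) ?s"
  proof (cases x)
    case True
    have "runs P (s(r := w)) b ?s"
      by (rule runs_cong[OF Cons.prems(4)[of 0]])
         (use Cons.prems sr True in \<open>auto simp: clean_def\<close>)
    then have "runs (Seq (Pop r) P) s (1 + b) ?s"
      by (intro runs_Seq[OF runs_cong[OF runs_Pop]]) (use sr in auto)
    then show ?thesis
      by (intro runs_cong[OF runs_IfTrue]) (use sr True in auto)
  next
    case False
    then show ?thesis
      by (intro runs_cong[OF runs_IfFalse[OF _ runs_Pop]]) (use sr Cons.prems in auto)
  qed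
  moreover have "runs (While r ?P) ?s ((b + 3) * length (?s r) + 1)
    (?s(0 := pol ((F ^^ length (filter id (?s r))) ?t), r := []))"
  proof (rule Cons.hyps(1))
    show "w = ?s r" "0 < r" "?s 0 = pol ?t" "clean r ?s"
      using Cons.prems by (auto simp: clean_def)
    show "runs P s' b (s'(0 := pol ((F ^^ Suc i) ?t)))"
      if "i < length (filter id (?s r))" "s' 0 = pol ((F ^^ i) ?t)" "clean r s'" for i s'
      using Cons.prems(4)[of "if x then Suc i else i" s'] that sr Cons.prems(1)
      by (cases x) (simp_all add: funpow_swap1)
  qed
  then have "runs (While r ?P) ?s ((b + 3) * length w + 1)
      (s(0 := pol ((F ^^ length (filter id (s r))) t), r := []))"
    by (rule runs_cong) (use sr Cons.prems(1) in \<open>auto simp: fun_eq_iff funpow_swap1\<close>)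
  ultimately show ?case by (rule runs_While_step) (use sr in auto)
qed

text \<open>Iteration can blow up a tree exponentially even if a single round is polynomial, hence
  the bound \<open>b\<close> on all intermediate results; through it, the cost of each round is
  bounded as well. The reversed Polish notation of \<open>N t\<close> on stack \<open>K + 1\<close>
  is the counter: reversal preserves the number of \<open>True\<close> symbols.\<close>

lemma FP_funpow:
  assumes "FP F" "FP N" "FP I" "poly_bounded b"
    "\<And>t i. i \<le> nodes (N t) \<Longrightarrow> tsize ((F ^^ i) (I t)) \<le> b (tsize t)"
  shows "FP (\<lambda>t. (F ^^ nodes (N t)) (I t))"
proof -
  obtain P k p where "implements P k p F" using assms(1) by (auto simp: FP_def)
  note P = implementsD[OF this]
  obtain Q j q where "implements Q j q N" using assms(2) by (auto simp: FP_def)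
  note Q = implementsD[OF this]
  obtain R l c where "implements R l c I" using assms(3) by (auto simp: FP_def)
  note R = implementsD[OF this]
  define K where "K = max l (max k j)"
  have K: "0 < K" "l \<le> K" "k \<le> K" "j \<le> K" using P(1) by (auto simp: K_def)
  define prog where "prog = Seq (copy 0 K (K + 1)) (Seq Q (Seq (move 0 (K + 1))
    (Seq (transfer K 0 (K + 2))
    (Seq R (While (K + 1) (IfTop (K + 1) (Seq (Pop (K + 1)) P) (Pop (K + 1))))))))"
  let ?B = "\<lambda>n. (12 * n + 2) + (poly q n + ((5 * poly q n + 1) + ((10 * n + 2) +
      (poly c n + ((poly p (b n) + 3) * poly q n + 1)))))"
  show ?thesis
  proof (rule FP_I)
    show "0 < K + 3" "width prog \<le> K + 3" using P(2) Q(2) R(2) K by (auto simp: prog_def)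
    show "poly_bounded ?B"
      by (intro poly_bounded_intros assms(4))
    show "poly_bounded b" by fact
    show "tsize ((F ^^ nodes (N t)) (I t)) \<le> b (tsize t)" for t
      using assms(5) by simp
    show "runs prog s (?B (tsize t)) (s(0 := pol ((F ^^ nodes (N t)) (I t))))"
      if s0: "s 0 = pol t" and cl: "clean (K + 3) s" for t s
    proof -
      have sK: "s K = []" "s (Suc K) = []" "s (Suc (Suc K)) = []" using cl K by (auto simp: clean_def)
      have 1: "runs (copy 0 K (K + 1)) s (12 * tsize t + 2) (s(K := pol t))"
        by (rule runs_cong[OF runs_copy]) (use sK s0 K in auto)
      have 2: "runs Q (s(K := pol t)) (poly q (tsize t)) (s(K := pol t, 0 := pol (N t)))"
        by (rule Q(4)) (use s0 K cl in \<open>auto simp: clean_def\<close>)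
      have 3: "runs (move 0 (K + 1)) (s(K := pol t, 0 := pol (N t))) (5 * poly q (tsize t) + 1)
          (s(K := pol t, 0 := [], K + 1 := rev (pol (N t))))"
        by (rule runs_cong[OF runs_move]) (use sK K Q(3)[of t] in auto)
      have 4: "runs (transfer K 0 (K + 2)) (s(K := pol t, 0 := [], K + 1 := rev (pol (N t))))
          (10 * tsize t + 2) (s(K + 1 := rev (pol (N t))))"
        by (rule runs_cong[OF runs_transfer]) (use sK K s0 in \<open>auto simp: fun_eq_iff\<close>)
      let ?s = "s(0 := pol (I t), K + 1 := rev (pol (N t)))"
      have 5: "runs R (s(K + 1 := rev (pol (N t)))) (poly c (tsize t)) ?s"
        by (rule runs_cong[OF R(4)[of _ t]]) (use K cl s0 in \<open>auto simp: clean_def fun_upd_twist\<close>)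
      have cnt: "length (filter id (?s (K + 1))) = nodes (N t)"
        using length_filter_pol[of "N t"] by (simp flip: rev_filter)
      have "runs (While (K + 1) (IfTop (K + 1) (Seq (Pop (K + 1)) P) (Pop (K + 1)))) ?s
          ((poly p (b (tsize t)) + 3) * length (?s (K + 1)) + 1)
          (?s(0 := pol ((F ^^ length (filter id (?s (K + 1)))) (I t)), K + 1 := []))"
      proof (rule runs_counted_loop[of "K + 1" ?s "I t" F P "poly p (b (tsize t))"])
        show "0 < K + 1" "?s 0 = pol (I t)" "clean (K + 1) ?s"
          using s0 cl by (auto simp: clean_def)
        fix i s' assume i: "i < length (filter id (?s (K + 1)))"
          and s': "s' 0 = pol ((F ^^ i) (I t))" "clean (K + 1) s'"
        have "tsize ((F ^^ i) (I t)) \<le> b (tsize t)"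
          using assms(5)[of i t] i cnt by simp
        then show "runs P s' (poly p (b (tsize t))) (s'(0 := pol ((F ^^ Suc i) (I t))))"
          by (intro runs_cong[OF P(4)[of s' "(F ^^ i) (I t)"]])
             (use s' K in \<open>auto simp: clean_def intro: poly_mono_nat\<close>)
      qed
      then have 6: "runs (While (K + 1) (IfTop (K + 1) (Seq (Pop (K + 1)) P) (Pop (K + 1)))) ?s
          ((poly p (b (tsize t)) + 3) * poly q (tsize t) + 1)
          (s(0 := pol ((F ^^ nodes (N t)) (I t))))"
        by (rule runs_cong)
           (use Q(3)[of t] sK cnt in \<open>auto simp: fun_eq_iff simp del: mult_Suc_right intro: mult_le_mono2\<close>)
      show ?thesis
        unfolding prog_def
        by (intro runs_Seq[OF 1] runs_Seq[OF 2] runs_Seq[OF 3] runs_Seq[OF 4] runs_Seq[OF 5] 6)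
    qed
  qed
qed

section \<open>Translation between words and trees\<close>

primrec bit_tree :: "bool \<Rightarrow> tree" where
  "bit_tree False = Lf"
| "bit_tree True = Nd Lf Lf"

primrec word_tree :: "bool list \<Rightarrow> tree" where
  "word_tree [] = Lf"
| "word_tree (b # w) = Nd (bit_tree b) (word_tree w)"

text \<open>Prepending a bit to a list puts 1100 (for \<open>True\<close>) or 10 (for
  \<open>False\<close>) in front of its Polish notation: the symbol of the new node followed by the
  tree of the bit. The list grows from its end, so \<open>to_tree\<close> reverses the word
  first.\<close>

definition to_tree_body :: prog where
  "to_tree_body = (IfTop 1
     (Seq (Pop 1) (Seq (Push 0 False) (Seq (Push 0 False) (Seq (Push 0 True) (Push 0 True)))))
     (Seq (Pop 1) (Seq (Push 0 False) (Push 0 True))))"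

definition to_tree :: prog where
  "to_tree = Seq (move 0 1) (Seq (Push 0 False) (While 1 to_tree_body))"

lemma runs_to_tree_loop:
  "s 0 = pol (word_tree w) \<Longrightarrow>
   runs (While 1 to_tree_body) s (11 * length (s 1) + 1) (s(0 := pol (word_tree (rev (s 1) @ w)), 1 := []))"
proof (induction "s 1" arbitrary: s w)
  case Nil
  then show ?case by (intro runs_cong[OF runs_While_Nil]) auto
next
  case (Cons b v)
  note s1 = Cons.hyps(2)[symmetric]
  let ?s = "s(0 := pol (word_tree (b # w)), 1 := v)"
  have "runs to_tree_body s 10 ?s"
  proof (cases b)
    case True
    show ?thesis
      unfolding to_tree_body_def
      by (rule runs_cong[OF runs_IfTrue[OF _
            runs_Seq[OF runs_Pop runs_Seq[OF runs_Push runs_Seq[OF runs_Push runs_Seq[OF runs_Push runs_Push]]]]]])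
         (use s1 True Cons.prems in \<open>auto simp: fun_eq_iff\<close>)
  next
    case False
    show ?thesis
      unfolding to_tree_body_def
      by (rule runs_cong[OF runs_IfFalse[OF _ runs_Seq[OF runs_Pop runs_Seq[OF runs_Push runs_Push]]]])
         (use s1 False Cons.prems in \<open>auto simp: fun_eq_iff\<close>)
  qed
  moreover have "runs (While 1 to_tree_body) ?s (11 * length v + 1) (s(0 := pol (word_tree (rev (s 1) @ w)), 1 := []))"
    by (rule runs_cong[OF Cons.hyps(1)[of ?s "b # w"]]) (use s1 in \<open>auto simp: fun_eq_iff\<close>)
  ultimately show ?case
    by (rule runs_While_step) (use s1 in auto)
qed

lemma runs_to_tree:
  assumes "clean 2 s"
  shows "runs to_tree s (16 * length (s 0) + 4) (s(0 := pol (word_tree (s 0))))"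
proof -
  have s1: "s 1 = []" "s (Suc 0) = []" using assms by (auto simp: clean_def)
  have "runs to_tree s ((5 * length (s 0) + 1) + (2 + (11 * length (rev (s 0)) + 1)))
    (s(0 := [False], 1 := rev (s 0), 0 := pol (word_tree (s 0)), 1 := []))"
    unfolding to_tree_def
  proof (intro runs_Seq)
    show "runs (move 0 1) s (5 * length (s 0) + 1) (s(0 := [], 1 := rev (s 0)))"
      by (rule runs_cong[OF runs_move]) (use s1 in auto)
    show "runs (Push 0 False) (s(0 := [], 1 := rev (s 0))) 2 (s(0 := [False], 1 := rev (s 0)))"
      by (rule runs_cong[OF runs_Push]) (auto simp: fun_upd_twist)
  qed (rule runs_cong[OF runs_to_tree_loop[of _ "[]"]]; simp)
  then show ?thesis
    by (rule runs_cong) (use s1 in \<open>auto simp: fun_eq_iff\<close>)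
qed

definition from_tree_body :: prog where
  "from_tree_body = (IfTop 0
     (Seq (Pop 0) (IfTop 0
        (Seq (Pop 0) (Seq (Pop 0) (Seq (Pop 0) (Push 1 True))))
        (Seq (Pop 0) (Push 1 False))))
     (Pop 0))"

definition from_tree :: prog where
  "from_tree = Seq (While 0 from_tree_body) (move 1 0)"

lemma runs_from_tree_loop:
  "s 0 = pol (word_tree w) \<Longrightarrow>
   runs (While 0 from_tree_body) s (9 * length w + 4) (s(0 := [], 1 := rev w @ s 1))"
proof (induction w arbitrary: s)
  case Nil
  have "runs from_tree_body s (Suc 1) (s(0 := []))"
    unfolding from_tree_body_def by (rule runs_cong[OF runs_IfFalse[OF _ runs_Pop]]) (use Nil in auto)
  moreover have "runs (While 0 from_tree_body) (s(0 := [])) 1 (s(0 := [], 1 := rev [] @ s 1))"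
    by (rule runs_cong[OF runs_While_Nil]) auto
  ultimately show ?case
    by (rule runs_While_step) (use Nil in auto)
next
  case (Cons b w)
  let ?s = "s(0 := pol (word_tree w), 1 := b # s 1)"
  have "runs from_tree_body s 8 ?s"
  proof (cases b)
    case True
    show ?thesis
      unfolding from_tree_body_def
      by (rule runs_cong[OF runs_IfTrue[OF _ runs_Seq[OF runs_Pop runs_IfTrue[OF _
            runs_Seq[OF runs_Pop runs_Seq[OF runs_Pop runs_Seq[OF runs_Pop runs_Push]]]]]]])
         (use True Cons.prems in \<open>auto simp: fun_eq_iff\<close>)
  next
    case False
    show ?thesis
      unfolding from_tree_body_def
      by (rule runs_cong[OF runs_IfTrue[OF _ runs_Seq[OF runs_Pop runs_IfFalse[OF _
            runs_Seq[OF runs_Pop runs_Push]]]]])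
         (use False Cons.prems in \<open>auto simp: fun_eq_iff\<close>)
  qed
  moreover have "runs (While 0 from_tree_body) ?s (9 * length w + 4) (s(0 := [], 1 := rev (b # w) @ s 1))"
    by (rule runs_cong[OF Cons.IH[of ?s]]) (auto simp: fun_eq_iff)
  ultimately show ?case
    by (rule runs_While_step) (use Cons.prems in auto)
qed

lemma runs_from_tree:
  assumes "clean 2 s" "s 0 = pol (word_tree w)"
  shows "runs from_tree s (14 * length w + 5) (s(0 := w))"
proof -
  have s1: "s 1 = []" "s (Suc 0) = []" using assms by (auto simp: clean_def)
  have "runs from_tree s ((9 * length w + 4) + (5 * length w + 1)) (s(0 := w))"
    unfolding from_tree_def
  proof (rule runs_Seq)
    show "runs (move 1 0) (s(0 := [], 1 := rev w @ s 1)) (5 * length w + 1) (s(0 := w))"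
      by (rule runs_cong[OF runs_move]) (use s1 in \<open>auto simp: fun_eq_iff\<close>)
  qed (rule runs_from_tree_loop, fact)
  then show ?thesis by (rule runs_cong) auto
qed

lemma width_to_tree [simp]: "width to_tree = 2" and width_from_tree [simp]: "width from_tree = 2"
  by (auto simp: to_tree_def to_tree_body_def from_tree_def from_tree_body_def)

lemma tsize_word_tree: "length w < tsize (word_tree w)" "tsize (word_tree w) \<le> 4 * length w + 1"
proof -
  have "tsize (bit_tree b) \<le> 3" for b by (cases b) auto
  then have step: "tsize (word_tree (b # v)) \<le> 4 + tsize (word_tree v)" for b v
    using add_le_mono1 by fastforce
  show "tsize (word_tree w) \<le> 4 * length w + 1"
  proof (induction w)
    case (Cons b w)
    then show ?case using step[of b w] by simp
  qed simp
  show "length w < tsize (word_tree w)" by (induction w) auto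
qed

text \<open>The Polish notation is itself a word on stack 0, so the conversion of words into trees
  applies to it unchanged. The notation thus becomes available as data, and equality of arbitrary
  data is later decided on these words.\<close>

lemma FP_pol: "FP (\<lambda>t. word_tree (pol t))"
proof (rule FP_I)
  show "0 < (2::nat)" "width to_tree \<le> 2" by auto
  show "poly_bounded (\<lambda>n. 16 * n + 4)" "poly_bounded (\<lambda>n. 4 * n + 1)" by (intro poly_bounded_intros)+
  show "tsize (word_tree (pol t)) \<le> 4 * tsize t + 1" for t by (rule tsize_word_tree(2))
  show "runs to_tree s (16 * tsize t + 4) (s(0 := pol (word_tree (pol t))))"
    if "s 0 = pol t" "clean 2 s" for s t
    using runs_to_tree[OF that(2)] that(1) by simp
qed

lemma FP_imp_polytime_computable:
  assumes "FP F" "\<And>x. F (word_tree x) = word_tree (f x)"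
  shows "polytime_computable f"
proof -
  obtain P k p where "implements P k p F" using assms(1) by (auto simp: FP_def)
  note P = implementsD[OF this]
  define R where "R = Seq to_tree (Seq P from_tree)"
  let ?B = "\<lambda>n. (16 * n + 4) + (poly p (4 * n + 1) + (14 * poly p (4 * n + 1) + 5))"
  have "poly_bounded ?B"
    by (intro poly_bounded_intros)
  then obtain q where q: "\<And>n. ?B n \<le> poly q n" unfolding poly_bounded_def by blast
  have "\<exists>t \<le> poly q (length x). halts_with (machine (Suc (width R)) R) x t (f x)" for x
  proof -
    let ?s = "\<lambda>r::nat. if r = 0 then x else []"
    have "runs R ?s (?B (length x)) (?s(0 := f x))"
      unfolding R_def
    proof (intro runs_Seq)
      show "runs to_tree ?s (16 * length x + 4) (?s(0 := pol (word_tree x)))"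
        by (rule runs_cong[OF runs_to_tree]) (auto simp: clean_def)
      show "runs P (?s(0 := pol (word_tree x))) (poly p (4 * length x + 1))
          (?s(0 := pol (word_tree (f x))))"
        by (rule runs_cong[OF P(4)[of _ "word_tree x"]])
           (use tsize_word_tree(2)[of x] in \<open>auto simp: clean_def assms(2) intro: poly_mono_nat\<close>)
      have "tsize (word_tree (f x)) \<le> poly p (4 * length x + 1)"
        using P(3)[of "word_tree x"] poly_mono_nat[OF tsize_word_tree(2)[of x], of p]
        by (simp add: assms(2))
      then have "length (f x) \<le> poly p (4 * length x + 1)"
        using tsize_word_tree(1)[of "f x"] by simp
      then show "runs from_tree (?s(0 := pol (word_tree (f x)))) (14 * poly p (4 * length x + 1) + 5)
          (?s(0 := f x))"
        by (intro runs_cong[OF runs_from_tree]) (auto simp: clean_def)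
    qed
    then obtain t where t: "t \<le> ?B (length x)" "exec R ?s t (?s(0 := f x))"
      unfolding runs_def by blast
    from exec_halts_with[OF t(2), of x] have "halts_with (machine (Suc (width R)) R) x t (f x)"
      by simp
    with t(1) q[of "length x"] show ?thesis using order_trans by blast
  qed
  moreover have "wf_tm (machine (Suc (width R)) R)" by (rule wf_machine) auto
  ultimately show ?thesis unfolding polytime_computable_def by blast
qed

section \<open>Polynomial-time functions on encoded data\<close>

primrec spine :: "tree \<Rightarrow> tree list" where
  "spine Lf = []"
| "spine (Nd a b) = a # spine b"

lemma length_spine_le: "length (spine t) \<le> nodes t"
  by (induction t) auto

lemma tsize_spine_member: "a \<in> set (spine t) \<Longrightarrow> tsize a \<le> tsize t"
  by (induction t) auto

lemma spine_inject: "spine s = spine t \<longleftrightarrow> s = t"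
proof
  show "spine s = spine t \<Longrightarrow> s = t"
  proof (induction s arbitrary: t)
    case Lf
    then show ?case by (cases t) auto
  next
    case (Nd a b)
    then show ?case by (cases t) auto
  qed
qed simp

lemma FP_const: "FP (\<lambda>_. c)"
  by (induction c) (auto intro: FP_Lf FP_Nd)

text \<open>The state of the loop is \<open>Nd t (Nd s l)\<close>: the input, the accumulator and the rest of the
  list. The loop runs once for every node of the list and idles when the list is empty.\<close>

definition fold_step :: "(tree \<Rightarrow> tree) \<Rightarrow> tree \<Rightarrow> tree" where
  "fold_step H z = (if rgt (rgt z) = Lf then z
     else Nd (lft z) (Nd (H (Nd (lft z) (Nd (lft (rgt z)) (lft (rgt (rgt z)))))) (rgt (rgt (rgt z)))))"

lemma fold_step_funpow_done: "(fold_step H ^^ i) (Nd t (Nd s Lf)) = Nd t (Nd s Lf)"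
  by (induction i) (auto simp: fold_step_def)

text \<open>After any number of rounds the accumulator is the fold of a prefix. All \<open>i\<close>
  are covered, not only the last, since the size of every stage has to be bounded.\<close>

lemma fold_step_funpow:
  "\<exists>j l'. j \<le> length (spine l) \<and> tsize l' \<le> tsize l \<and> (length (spine l) \<le> i \<longrightarrow> j = length (spine l)) \<and>
     (fold_step H ^^ i) (Nd t (Nd s l))
     = Nd t (Nd (foldl (\<lambda>s a. H (Nd t (Nd s a))) s (take j (spine l))) l')"
proof (induction i arbitrary: s l)
  case 0
  then show ?case by (intro exI[of _ 0] exI[of _ l]) auto
next
  case (Suc i)
  show ?case
  proof (cases l)
    case Lf
    then show ?thesis
      using fold_step_funpow_done[of "Suc i" H t s] by (intro exI[of _ 0] exI[of _ Lf]) auto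
  next
    case (Nd a b)
    obtain j l' where *: "j \<le> length (spine b)" "tsize l' \<le> tsize b"
      "length (spine b) \<le> i \<longrightarrow> j = length (spine b)"
      "(fold_step H ^^ i) (Nd t (Nd (H (Nd t (Nd s a))) b))
       = Nd t (Nd (foldl (\<lambda>s a. H (Nd t (Nd s a))) (H (Nd t (Nd s a))) (take j (spine b))) l')"
      using Suc.IH[of b "H (Nd t (Nd s a))"] by blast
    have "(fold_step H ^^ Suc i) (Nd t (Nd s l)) = (fold_step H ^^ i) (Nd t (Nd (H (Nd t (Nd s a))) b))"
      using Nd by (simp add: funpow_Suc_right fold_step_def del: funpow.simps)
    with * Nd show ?thesis
      by (intro exI[of _ "Suc j"] exI[of _ l']) auto
  qed
qed

lemma foldl_size:
  assumes "\<And>s a. ok s \<Longrightarrow> a \<in> set l \<Longrightarrow> ok (f s a) \<and> (size' (f s a) :: nat) \<le> size' s + b"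
    "ok s"
  shows "ok (foldl f s l) \<and> size' (foldl f s l) \<le> size' s + length l * b"
  using assms
proof (induction l arbitrary: s)
  case (Cons a l)
  have "ok (f s a)" "size' (f s a) \<le> size' s + b" using Cons.prems by auto
  moreover have "ok (foldl f (f s a) l) \<and> size' (foldl f (f s a) l) \<le> size' (f s a) + length l * b"
    by (rule Cons.IH) (use Cons.prems calculation in auto)
  ultimately show ?case by auto
qed auto

text \<open>If an element adds at most \<open>b\<close>, which depends on the input but not on the
  accumulator, then every stage is polynomial because the number of elements is. The invariant
  \<open>ok\<close> restricts the growth condition to accumulators that can arise.\<close>

lemma FP_foldl:
  assumes L: "FP L" and G: "FP G" and H: "FP H" and b: "poly_bounded b"
    and ok: "\<And>t. ok (G t)"
    and step: "\<And>t s a. ok s \<Longrightarrow> a \<in> set (spine (L t)) \<Longrightarrow>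
       ok (H (Nd t (Nd s a))) \<and> tsize (H (Nd t (Nd s a))) \<le> tsize s + b (tsize t)"
  shows "FP (\<lambda>t. foldl (\<lambda>s a. H (Nd t (Nd s a))) (G t) (spine (L t)))"
proof -
  obtain p where p: "\<And>t. tsize (L t) \<le> poly p (tsize t)" using FP_size[OF L] by blast
  obtain q where q: "\<And>t. tsize (G t) \<le> poly q (tsize t)" using FP_size[OF G] by blast
  define I where "I t = Nd t (Nd (G t) (L t))" for t
  let ?B = "\<lambda>n. 2 + n + (poly q n + poly p n * b n) + poly p n"
  have "FP (fold_step H)"
    unfolding fold_step_def
    by (intro FP_If FP_Nd FP_comp[OF FP_lft] FP_comp[OF FP_rgt] FP_comp[OF H] FP_id FP_lft FP_rgt)
  moreover have "FP I" unfolding I_def by (intro FP_Nd FP_id L G)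
  moreover have "poly_bounded ?B" by (intro poly_bounded_intros b)
  moreover have "tsize ((fold_step H ^^ i) (I t)) \<le> ?B (tsize t)" if "i \<le> nodes (L t)" for t i
  proof -
    let ?f = "\<lambda>s a. H (Nd t (Nd s a))"
    obtain j l' where *: "j \<le> length (spine (L t))" "tsize l' \<le> tsize (L t)"
      "(fold_step H ^^ i) (I t) = Nd t (Nd (foldl ?f (G t) (take j (spine (L t)))) l')"
      using fold_step_funpow[of "L t" i H t "G t"] unfolding I_def by blast
    have "tsize (foldl ?f (G t) (take j (spine (L t))))
        \<le> tsize (G t) + length (take j (spine (L t))) * b (tsize t)"
      using foldl_size[of ok "take j (spine (L t))" ?f tsize "b (tsize t)" "G t"] ok step in_set_takeD by metis
    also have "\<dots> \<le> poly q (tsize t) + poly p (tsize t) * b (tsize t)"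
      using q[of t] p[of t] *(1) length_spine_le[of "L t"] nodes_le[of "L t"]
      by (intro add_mono mult_mono) auto
    finally show ?thesis using *(2,3) p[of t] by simp
  qed
  ultimately have "FP (\<lambda>t. lft (rgt ((fold_step H ^^ nodes (L t)) (I t))))"
    by (intro FP_comp[OF FP_lft] FP_comp[OF FP_rgt] FP_funpow[OF _ L])
  moreover have "lft (rgt ((fold_step H ^^ nodes (L t)) (I t)))
      = foldl (\<lambda>s a. H (Nd t (Nd s a))) (G t) (spine (L t))" for t
    using fold_step_funpow[of "L t" "nodes (L t)" H t "G t"] length_spine_le[of "L t"]
    unfolding I_def by auto
  ultimately show ?thesis by simp
qed

lemma spine_foldl_Nd: "spine (foldl (\<lambda>s a. Nd (f a) s) r xs) = rev (map f xs) @ spine r"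
  by (induction xs arbitrary: r) auto

text \<open>A fold that prepends reverses the list; a second fold reverses it back.\<close>

lemma FP_spine_map:
  assumes "FP f"
  shows "\<exists>F. FP F \<and> (\<forall>t. spine (F t) = map f (spine t))"
proof -
  obtain p where p: "\<And>t. tsize (f t) \<le> poly p (tsize t)" using FP_size[OF assms] by blast
  have "FP (\<lambda>t. foldl (\<lambda>s a. (\<lambda>z. Nd (f (rgt (rgt z))) (lft (rgt z))) (Nd t (Nd s a))) Lf (spine t))"
  proof (rule FP_foldl[where ok = "\<lambda>_. True" and b = "\<lambda>n. 1 + poly p n"])
    show "FP (\<lambda>z. Nd (f (rgt (rgt z))) (lft (rgt z)))"
      by (intro FP_Nd FP_comp[OF assms] FP_comp[OF FP_rgt] FP_comp[OF FP_lft] FP_rgt)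
    show "True \<and> tsize (Nd (f (rgt (rgt (Nd t (Nd s a))))) (lft (rgt (Nd t (Nd s a)))))
        \<le> tsize s + (1 + poly p (tsize t))" if "a \<in> set (spine t)" for t s a
      using p[of a] poly_mono_nat[OF tsize_spine_member[OF that], of p] by simp
  qed (intro FP_id FP_Lf poly_bounded_intros TrueI)+
  then have 1: "FP (\<lambda>t. foldl (\<lambda>s a. Nd (f a) s) Lf (spine t))" by simp
  have "FP (\<lambda>t. foldl (\<lambda>s a. (\<lambda>z. Nd (rgt (rgt z)) (lft (rgt z))) (Nd t (Nd s a))) Lf (spine t))"
  proof (rule FP_foldl[where ok = "\<lambda>_. True" and b = "\<lambda>n. 1 + n"])
    show "FP (\<lambda>z. Nd (rgt (rgt z)) (lft (rgt z)))"
      by (intro FP_Nd FP_comp[OF FP_rgt] FP_comp[OF FP_lft] FP_rgt)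
    show "True \<and> tsize (Nd (rgt (rgt (Nd t (Nd s a)))) (lft (rgt (Nd t (Nd s a)))))
        \<le> tsize s + (1 + tsize t)" if "a \<in> set (spine t)" for t s a
      using tsize_spine_member[OF that] by simp
  qed (intro FP_id FP_Lf poly_bounded_intros TrueI)+
  then have 2: "FP (\<lambda>t. foldl (\<lambda>s a. Nd a s) Lf (spine t))" by simp
  show ?thesis
    by (rule exI, rule conjI, rule FP_comp[OF 2 1])
       (use spine_foldl_Nd[of f Lf] spine_foldl_Nd[of "\<lambda>a. a" Lf] in simp)
qed

text \<open>\<open>dec\<close> is total, and replacing an arbitrary tree by the code of what it
  decodes to must be polynomial-time. A program that is correct on codes alone then becomes correct
  on all trees by normalising its input first, as in \<open>PF_I\<close>.\<close>

class enc =
  fixes enc :: "'a \<Rightarrow> tree" and dec :: "tree \<Rightarrow> 'a"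
  assumes dec_enc [simp]: "dec (enc x) = x"
    and FP_norm: "FP (\<lambda>t. enc (dec t))"

lemma enc_inject [simp]: "enc x = enc y \<longleftrightarrow> x = y"
  using dec_enc by metis

instantiation tree :: enc
begin
definition "enc (t::tree) = t"
definition "dec (t::tree) = t"
instance by standard (auto simp: enc_tree_def dec_tree_def FP_id)
end

instantiation bool :: enc
begin
definition "enc b = bit_tree b"
definition "dec t = (t \<noteq> Lf)"
instance
proof
  show "dec (enc b) = b" for b :: bool by (cases b) (auto simp: enc_bool_def dec_bool_def)
  have "FP (\<lambda>t. if t = Lf then Lf else Nd Lf Lf)" by (intro FP_If FP_id FP_Lf FP_Nd)
  moreover have "(\<lambda>t. if t = Lf then Lf else Nd Lf Lf) = (\<lambda>t. enc (dec t :: bool))"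
    by (auto simp: enc_bool_def dec_bool_def fun_eq_iff)
  ultimately show "FP (\<lambda>t. enc (dec t :: bool))" by simp
qed
end

text \<open>Numbers are unary, so polynomial in the size of the code means polynomial in the value.
  Lengths, products and index ranges can then be computed freely, whereas no program computes the
  value of a binary word.\<close>

instantiation nat :: enc
begin
definition "enc n = (Nd Lf ^^ n) Lf"
definition "dec t = length (spine t)"
instance
proof
  have [simp]: "spine ((Nd Lf ^^ n) Lf) = replicate n Lf" for n by (induction n) auto
  show "dec (enc n) = n" for n :: nat by (auto simp: enc_nat_def dec_nat_def)
  obtain F where F: "FP F" "\<And>t. spine (F t) = map (\<lambda>_. Lf) (spine t)"
    using FP_spine_map[OF FP_Lf] by blast
  have "F t = enc (dec t :: nat)" for t
    by (rule iffD1[OF spine_inject]) (simp add: F(2) enc_nat_def dec_nat_def map_replicate_const)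
  then have "F = (\<lambda>t. enc (dec t :: nat))" by (rule ext)
  with F(1) show "FP (\<lambda>t. enc (dec t :: nat))" by simp
qed
end

instantiation prod :: (enc, enc) enc
begin
definition "enc x = Nd (enc (fst x)) (enc (snd x))"
definition "dec t = (dec (lft t), dec (rgt t))"
instance
  by standard (auto simp: enc_prod_def dec_prod_def intro!: FP_Nd FP_comp[OF FP_norm] FP_lft FP_rgt)
end

instantiation list :: (enc) enc
begin
definition "enc xs = foldr (\<lambda>a t. Nd (enc a) t) xs Lf"
definition "dec t = map dec (spine t)"
instance
proof
  have [simp]: "spine (enc xs) = map enc xs" for xs :: "'a list"
    by (induction xs) (auto simp: enc_list_def)
  show "dec (enc xs) = xs" for xs :: "'a list" by (simp add: dec_list_def comp_def)
  obtain F where F: "FP F" "\<And>t. spine (F t) = map (\<lambda>t. enc (dec t :: 'a)) (spine t)"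
    using FP_spine_map[OF FP_norm] by blast
  have "F t = enc (dec t :: 'a list)" for t
    by (rule iffD1[OF spine_inject]) (simp add: F(2) dec_list_def)
  then have "F = (\<lambda>t. enc (dec t :: 'a list))" by (rule ext)
  with F(1) show "FP (\<lambda>t. enc (dec t :: 'a list))" by simp
qed
end

lemma enc_simps [simp]:
  "enc (a, b) = Nd (enc a) (enc b)"
  "enc [] = Lf"
  "enc (x # xs) = Nd (enc x) (enc xs)"
  "enc (0::nat) = Lf"
  "enc (Suc n) = Nd Lf (enc n)"
  "enc False = Lf"
  "enc True = Nd Lf Lf"
  "enc (t::tree) = t"
  by (auto simp: enc_prod_def enc_list_def enc_nat_def enc_bool_def enc_tree_def)

lemma dec_prod [simp]: "dec t = (dec (lft t), dec (rgt t))"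
  by (simp add: dec_prod_def)

lemma spine_enc [simp]: "spine (enc xs) = map enc xs"
  by (induction xs) auto

lemma word_tree_eq_enc: "word_tree w = enc w"
proof (induction w)
  case (Cons b w)
  then show ?case by (cases b) auto
qed auto

lemma tsize_member: "a \<in> set l \<Longrightarrow> tsize (enc a) \<le> tsize (enc l)"
  using tsize_spine_member[of "enc a" "enc l"] by simp

lemma tsize_bool: "tsize (enc (b::bool)) \<le> 3"
  by (cases b) auto

lemma tsize_nat [simp]: "tsize (enc (n::nat)) = 2 * n + 1"
  by (induction n) auto

lemma tsize_append: "tsize (enc (xs @ ys)) + 1 = tsize (enc xs) + tsize (enc ys)"
  by (induction xs) auto

definition PF :: "('a::enc \<Rightarrow> 'b::enc) \<Rightarrow> bool" where
  "PF f \<longleftrightarrow> FP (\<lambda>t. enc (f (dec t)))"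

lemma PF_I:
  assumes "FP F" "\<And>x. F (enc x) = enc (f x)"
  shows "PF f"
  using FP_comp[OF assms(1) FP_norm[where 'a = 'a]] unfolding PF_def by (simp add: assms(2))

lemma PF_size:
  assumes "PF f"
  obtains p where "\<And>x. tsize (enc (f x)) \<le> poly p (tsize (enc x))"
proof -
  obtain p where "\<And>t. tsize (enc (f (dec t))) \<le> poly p (tsize t)"
    using FP_size assms[unfolded PF_def] by blast
  then have "tsize (enc (f x)) \<le> poly p (tsize (enc x))" for x
    using dec_enc[of x] by metis
  then show ?thesis by (rule that)
qed

lemma polytime_computable_PF: "PF f \<Longrightarrow> polytime_computable f"
  by (rule FP_imp_polytime_computable[of "\<lambda>t. enc (f (dec t))"]) (auto simp: PF_def word_tree_eq_enc)

section \<open>Calculus of polynomial-time functions on data\<close>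

named_theorems PF_intros

lemma PF_comp: "PF f \<Longrightarrow> PF g \<Longrightarrow> PF (\<lambda>x. f (g x))"
  unfolding PF_def using FP_comp[of "\<lambda>t. enc (f (dec t))" "\<lambda>t. enc (g (dec t))"] by simp

lemma PF_id [PF_intros]: "PF (\<lambda>x. x)"
  by (rule PF_I[OF FP_id]) simp

lemma PF_const [PF_intros]: "PF (\<lambda>_. c)"
  by (rule PF_I[OF FP_const]) simp

lemma PF_Pair [PF_intros]: "PF f \<Longrightarrow> PF g \<Longrightarrow> PF (\<lambda>x. (f x, g x))"
  unfolding PF_def by (simp add: FP_Nd)

lemma PF_fst [PF_intros]: "PF f \<Longrightarrow> PF (\<lambda>x. fst (f x))"
  by (rule PF_comp[of fst]) (auto intro!: PF_I[OF FP_lft])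

lemma PF_snd [PF_intros]: "PF f \<Longrightarrow> PF (\<lambda>x. snd (f x))"
  by (rule PF_comp[of snd]) (auto intro!: PF_I[OF FP_rgt])

lemma PF_case_prod [PF_intros]:
  "PF f \<Longrightarrow> PF (\<lambda>x. h x (fst (f x)) (snd (f x))) \<Longrightarrow> PF (\<lambda>x. case f x of (a, b) \<Rightarrow> h x a b)"
  by (simp add: case_prod_beta)

lemma PF_Let [PF_intros]:
  assumes "PF f" "PF (\<lambda>p. g (fst p) (snd p))"
  shows "PF (\<lambda>x. let y = f x in g x y)"
  using PF_comp[OF assms(2), of "\<lambda>x. (x, f x)"] assms(1) by (simp add: PF_Pair PF_id)

lemma PF_If [PF_intros]:
  assumes "PF b" "PF f" "PF g"
  shows "PF (\<lambda>x. if b x then f x else g x)"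
proof -
  have eq: "enc c = Lf \<longleftrightarrow> \<not> c" for c by (cases c) auto
  show ?thesis
    using FP_If[OF assms(1,3,2)[unfolded PF_def]] unfolding PF_def eq
    by (rule back_subst[of FP]) auto
qed

lemma PF_bool2:
  fixes h :: "bool \<Rightarrow> bool \<Rightarrow> bool"
  assumes "PF f" "PF g"
  shows "PF (\<lambda>x. h (f x) (g x))"
proof -
  have "PF (\<lambda>x. if f x then if g x then h True True else h True False
      else if g x then h False True else h False False)"
    by (intro PF_If PF_const assms)
  moreover have "(if a then if b then h True True else h True False
      else if b then h False True else h False False) = h a b" for a b
    by (cases a; cases b) auto
  ultimately show ?thesis by (simp only:)
qed

lemma PF_Not [PF_intros]: "PF f \<Longrightarrow> PF (\<lambda>x. \<not> f x)"
  by (rule PF_bool2[where h = "\<lambda>a _. \<not> a" and g = f])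

lemma PF_conj [PF_intros]: "PF f \<Longrightarrow> PF g \<Longrightarrow> PF (\<lambda>x. f x \<and> g x)"
  by (rule PF_bool2)

lemma PF_disj [PF_intros]: "PF f \<Longrightarrow> PF g \<Longrightarrow> PF (\<lambda>x. f x \<or> g x)"
  by (rule PF_bool2)

lemma PF_Cons [PF_intros]: "PF f \<Longrightarrow> PF g \<Longrightarrow> PF (\<lambda>x. f x # g x)"
  unfolding PF_def by (simp add: FP_Nd)

lemma PF_null: "PF f \<Longrightarrow> PF (\<lambda>x. f x = [])"
proof (rule PF_comp[of "\<lambda>x. x = []"])
  have "FP (\<lambda>t. if t = Lf then Nd Lf Lf else Lf)" by (intro FP_If FP_id FP_const)
  moreover have "(if enc l = Lf then Nd Lf Lf else Lf) = enc (l = [])" for l by (cases l) auto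
  ultimately show "PF (\<lambda>l. l = [])" by (rule PF_I)
qed

lemma PF_hd [PF_intros]:
  fixes f :: "'a::enc \<Rightarrow> 'b::enc list"
  shows "PF f \<Longrightarrow> PF (\<lambda>x. hd (f x))"
proof (rule PF_comp[of hd])
  have "FP (\<lambda>t. if t = Lf then enc (hd [] :: 'b) else lft t)" by (intro FP_If FP_id FP_const FP_lft)
  moreover have "(if enc l = Lf then enc (hd [] :: 'b) else lft (enc l)) = enc (hd l)" for l :: "'b list"
    by (cases l) auto
  ultimately show "PF (hd :: 'b list \<Rightarrow> 'b)" by (rule PF_I)
qed

lemma PF_tl [PF_intros]:
  fixes f :: "'a::enc \<Rightarrow> 'b::enc list"
  shows "PF f \<Longrightarrow> PF (\<lambda>x. tl (f x))"
proof (rule PF_comp[of tl])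
  have "rgt (enc l) = enc (tl l)" for l :: "'b list" by (cases l) auto
  then show "PF (tl :: 'b list \<Rightarrow> 'b list)" by (rule PF_I[OF FP_rgt])
qed

lemma PF_foldl:
  fixes l :: "'a::enc \<Rightarrow> 'c::enc list" and g :: "'a \<Rightarrow> 'b::enc"
  assumes l: "PF l" and g: "PF g"
    and h: "PF (\<lambda>p. h (fst p) (fst (snd p)) (snd (snd p)))"
    and b: "poly_bounded b"
    and step: "\<And>x s a. a \<in> set (l x) \<Longrightarrow> tsize (enc (h x s a)) \<le> tsize (enc s) + b (tsize (enc x))"
  shows "PF (\<lambda>x. foldl (h x) (g x) (l x))"
proof -
  define N :: "tree \<Rightarrow> tree" where "N t = enc (dec t :: 'a)" for t
  define H :: "tree \<Rightarrow> tree" where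
    "H t = enc (h (dec (lft t)) (dec (lft (rgt t))) (dec (rgt (rgt t))))" for t
  obtain p where p: "\<And>t. tsize (N t) \<le> poly p (tsize t)"
    using FP_size[OF FP_norm[where 'a = 'a]] unfolding N_def by blast
  obtain p' where p': "\<And>n. b n \<le> poly p' n" using b unfolding poly_bounded_def by blast
  have "FP (\<lambda>t. foldl (\<lambda>s a. H (Nd t (Nd s a))) (enc (g (dec t))) (spine (enc (l (dec t)))))"
  proof (rule FP_foldl[where ok = "\<lambda>s. \<exists>v. s = enc (v :: 'b)"])
    show "FP (\<lambda>t. enc (l (dec t)))" "FP (\<lambda>t. enc (g (dec t)))" using l g unfolding PF_def by auto
    show "FP H" using h unfolding PF_def H_def by simp
    show "poly_bounded (\<lambda>n. poly p' (poly p n))" by (intro poly_bounded_intros)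
    fix t s a
    assume "\<exists>v. s = enc (v :: 'b)" "a \<in> set (spine (enc (l (dec t))))"
    then obtain v a' where s: "s = enc (v :: 'b)" and a: "a = enc a'" "a' \<in> set (l (dec t))" by auto
    \<comment> \<open>The tree \<open>t\<close> need not be a code. Growth is bounded in terms of
      its normal form \<open>N t\<close>, whose size is polynomial in that of
      \<open>t\<close>.\<close>
    have "b (tsize (N t)) \<le> poly p' (poly p (tsize t))"
      using p' p poly_mono_nat order_trans by blast
    then show "(\<exists>v. H (Nd t (Nd s a)) = enc (v :: 'b)) \<and>
        tsize (H (Nd t (Nd s a))) \<le> tsize s + poly p' (poly p (tsize t))"
      using step[OF a(2), of v] a s by (auto simp: H_def N_def)
  qed auto
  moreover have "foldl (\<lambda>s a. H (Nd (enc x) (Nd s a))) (enc v) (map enc l) = enc (foldl (h x) v l)"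
    for x v l by (induction l arbitrary: v) (auto simp: H_def)
  ultimately show ?thesis
    by (elim PF_I) simp
qed

lemma PF_rev [PF_intros]: "PF f \<Longrightarrow> PF (\<lambda>x. rev (f x))"
proof (rule PF_comp[of rev])
  have "PF (\<lambda>l::'b list. foldl (\<lambda>s a. a # s) [] l)"
    by (rule PF_foldl[where b = "\<lambda>n. 1 + n"])
       (use tsize_member in \<open>auto intro!: PF_intros poly_bounded_intros\<close>)
  moreover have "foldl (\<lambda>s a. a # s) r l = rev l @ r" for l r :: "'b list"
    by (induction l arbitrary: r) auto
  ultimately show "PF (rev :: 'b list \<Rightarrow> 'b list)" by (simp add: fun_eq_iff)
qed

lemma PF_map [PF_intros]:
  fixes l :: "'a::enc \<Rightarrow> 'b::enc list" and h :: "'a \<Rightarrow> 'b \<Rightarrow> 'c::enc"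
  assumes h: "PF (\<lambda>p. h (fst p) (snd p))" and l: "PF l"
  shows "PF (\<lambda>x. map (h x) (l x))"
proof -
  obtain p where p: "\<And>x. tsize (enc (l x)) \<le> poly p (tsize (enc x))" using PF_size[OF l] by blast
  obtain q where q: "\<And>z. tsize (enc (h (fst z) (snd z))) \<le> poly q (tsize (enc z))"
    using PF_size[OF h] by blast
  have "PF (\<lambda>x. foldl (\<lambda>s a. h x a # s) [] (l x))"
  proof (rule PF_foldl[where b = "\<lambda>n. 1 + poly q (1 + n + poly p n)"])
    show "PF (\<lambda>p. h (fst p) (snd (snd p)) # fst (snd p))"
      by (intro PF_Cons PF_comp[OF h, of "\<lambda>p. (fst p, snd (snd p))", simplified] PF_intros)
    fix x a and s :: "'c list"
    assume "a \<in> set (l x)"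
    then have "tsize (enc (x, a)) \<le> 1 + tsize (enc x) + poly p (tsize (enc x))"
      using tsize_member[of a "l x"] p[of x] by simp
    then show "tsize (enc (h x a # s)) \<le> tsize (enc s) + (1 + poly q (1 + tsize (enc x) + poly p (tsize (enc x))))"
      using q[of "(x, a)"] poly_mono_nat[of "tsize (enc (x, a))" _ q] by fastforce
  qed (intro l PF_intros poly_bounded_intros)+
  then have "PF (\<lambda>x. rev (foldl (\<lambda>s a. h x a # s) [] (l x)))" by (rule PF_rev)
  moreover have "foldl (\<lambda>s a. h x a # s) r l = rev (map (h x) l) @ r" for x l r
    by (induction l arbitrary: r) auto
  ultimately show ?thesis by simp
qed

lemma PF_append [PF_intros]:
  assumes f: "PF f" and g: "PF g"
  shows "PF (\<lambda>x. f x @ g x)"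
proof -
  obtain p where p: "\<And>x. tsize (enc (f x)) \<le> poly p (tsize (enc x))" using PF_size[OF f] by blast
  have "PF (\<lambda>x. foldl (\<lambda>s a. a # s) (g x) (rev (f x)))"
  proof (rule PF_foldl[where b = "\<lambda>n. 1 + poly p n"])
    fix x a and s :: "'b list"
    assume "a \<in> set (rev (f x))"
    then show "tsize (enc (a # s)) \<le> tsize (enc s) + (1 + poly p (tsize (enc x)))"
      using tsize_member[of a "f x"] p[of x] by simp
  qed (intro f g PF_intros poly_bounded_intros)+
  moreover have "foldl (\<lambda>s a. a # s) r l = rev l @ r" for l r :: "'b list"
    by (induction l arbitrary: r) auto
  ultimately show ?thesis by simp
qed

lemma PF_concat [PF_intros]:
  assumes f: "PF f"
  shows "PF (\<lambda>x. concat (f x))"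
proof -
  obtain p where p: "\<And>x. tsize (enc (f x)) \<le> poly p (tsize (enc x))" using PF_size[OF f] by blast
  have "PF (\<lambda>x. foldl (\<lambda>s a. s @ a) [] (f x))"
  proof (rule PF_foldl[where b = "\<lambda>n. poly p n"])
    fix x and a s :: "'b list"
    assume "a \<in> set (f x)"
    then show "tsize (enc (s @ a)) \<le> tsize (enc s) + poly p (tsize (enc x))"
      using tsize_member[of a "f x"] p[of x] tsize_append[of s a] by simp
  qed (intro f PF_intros poly_bounded_intros)+
  moreover have "foldl (\<lambda>s a. s @ a) r l = r @ concat l" for l and r :: "'b list"
    by (induction l arbitrary: r) auto
  ultimately show ?thesis by simp
qed

lemma PF_filter [PF_intros]:
  assumes h: "PF (\<lambda>p. h (fst p) (snd p))" and l: "PF l"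
  shows "PF (\<lambda>x. filter (h x) (l x))"
proof -
  have "PF (\<lambda>x. concat (map (\<lambda>a. if h x a then [a] else []) (l x)))"
    by (intro PF_intros h l)
  moreover have "concat (map (\<lambda>a. if h x a then [a] else []) l) = filter (h x) l" for x l
    by (induction l) auto
  ultimately show ?thesis by simp
qed

lemma PF_ball [PF_intros]:
  assumes h: "PF (\<lambda>p. h (fst p) (snd p))" and l: "PF l"
  shows "PF (\<lambda>x. \<forall>a \<in> set (l x). h x a)"
proof -
  have "PF (\<lambda>x. filter (\<lambda>a. \<not> h x a) (l x) = [])" by (intro PF_null PF_intros h l)
  then show ?thesis by (simp add: filter_empty_conv)
qed

lemma PF_bex [PF_intros]:
  assumes h: "PF (\<lambda>p. h (fst p) (snd p))" and l: "PF l"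
  shows "PF (\<lambda>x. \<exists>a \<in> set (l x). h x a)"
proof -
  have "PF (\<lambda>x. \<not> (\<forall>a \<in> set (l x). \<not> h x a))" by (intro PF_intros h l)
  then show ?thesis by simp
qed

lemma PF_Suc [PF_intros]: "PF f \<Longrightarrow> PF (\<lambda>x. Suc (f x))"
  unfolding PF_def by (simp add: FP_Nd FP_Lf)

lemma PF_length [PF_intros]: "PF f \<Longrightarrow> PF (\<lambda>x. length (f x))"
proof (rule PF_comp[of length])
  have "PF (\<lambda>l::'b list. foldl (\<lambda>s a. Suc s) 0 l)"
    by (rule PF_foldl[where b = "\<lambda>n. 2"])
       (auto intro!: PF_intros poly_bounded_intros)
  moreover have "foldl (\<lambda>s a. Suc s) n l = n + length l" for l :: "'b list" and n
    by (induction l arbitrary: n) auto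
  ultimately show "PF (length :: 'b list \<Rightarrow> nat)" by (simp add: fun_eq_iff)
qed

text \<open>A number and the list of as many leaves have the same code. Counting loops can therefore
  be written as folds over such lists.\<close>

lemma PF_replicate_Lf: "PF f \<Longrightarrow> PF (\<lambda>x. replicate (f x) Lf)"
proof (rule PF_comp[of "\<lambda>n. replicate n Lf"])
  have "enc n = enc (replicate n Lf)" for n by (induction n) auto
  then show "PF (\<lambda>n. replicate n Lf)" by (rule PF_I[OF FP_id])
qed

lemma PF_replicate [PF_intros]: "PF f \<Longrightarrow> PF g \<Longrightarrow> PF (\<lambda>x. replicate (f x) (g x))"
  using PF_map[of "\<lambda>x _. g x" "\<lambda>x. replicate (f x) Lf", OF PF_comp[OF _ PF_fst[OF PF_id]] PF_replicate_Lf]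
  by (simp add: map_replicate_const)

lemma PF_add [PF_intros]:
  assumes "PF f" "PF g"
  shows "PF (\<lambda>x. f x + g x :: nat)"
proof -
  have "PF (\<lambda>x. length (replicate (f x) Lf @ replicate (g x) Lf))"
    by (intro PF_intros assms)
  then show ?thesis by simp
qed

lemma PF_mult [PF_intros]:
  assumes "PF f" "PF g"
  shows "PF (\<lambda>x. f x * g x :: nat)"
proof -
  have "PF (\<lambda>x. length (concat (replicate (f x) (replicate (g x) Lf))))"
    by (intro PF_intros assms)
  then show ?thesis by (simp add: length_concat sum_list_replicate)
qed

lemma PF_pred: "PF f \<Longrightarrow> PF (\<lambda>x. f x - Suc 0)"
proof (rule PF_comp[of "\<lambda>n. n - Suc 0"])
  have "rgt (enc n) = enc (n - Suc 0)" for n by (cases n) auto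
  then show "PF (\<lambda>n. n - Suc 0)" by (rule PF_I[OF FP_rgt])
qed

lemma PF_diff [PF_intros]:
  assumes "PF f" "PF g"
  shows "PF (\<lambda>x. f x - g x :: nat)"
proof -
  have "PF (\<lambda>x. foldl (\<lambda>s a. s - Suc 0) (f x) (replicate (g x) Lf))"
    by (rule PF_foldl[where b = "\<lambda>_. 0"]) (auto intro!: PF_intros assms poly_bounded_intros PF_pred)
  moreover have "foldl (\<lambda>s a. s - Suc 0) n (replicate m Lf) = n - m" for n m
    by (induction m arbitrary: n) auto
  ultimately show ?thesis by simp
qed

lemma PF_eq_0: "PF f \<Longrightarrow> PF (\<lambda>x. f x = (0::nat))"
  using PF_null[OF PF_replicate_Lf, of f] by simp

lemma PF_le [PF_intros]: "PF f \<Longrightarrow> PF g \<Longrightarrow> PF (\<lambda>x. f x \<le> (g x :: nat))"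
  using PF_eq_0[OF PF_diff[of f g]] by simp

lemma PF_less [PF_intros]: "PF f \<Longrightarrow> PF g \<Longrightarrow> PF (\<lambda>x. f x < (g x :: nat))"
  using PF_Not[OF PF_le[of g f]] by (simp add: not_le)

lemma PF_upt_0: "PF f \<Longrightarrow> PF (\<lambda>x. [0..<f x])"
proof (rule PF_comp[of "\<lambda>n. [0..<n]"])
  \<comment> \<open>The guard holds throughout the actual fold. It is there because the growth bound
    must hold for every accumulator \<open>s\<close>, whose length is not bounded in
    general.\<close>
  have "PF (\<lambda>n. foldl (\<lambda>s a. s @ [if length s < n then length s else 0]) [] (replicate n Lf))"
  proof (rule PF_foldl[where b = "\<lambda>n. 2 + n"])
    show "tsize (enc (s @ [if length s < n then length s else 0])) \<le> tsize (enc s) + (2 + tsize (enc n))"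
      for n s
      using tsize_append[of s "[if length s < n then length s else 0]"] by (auto split: if_splits)
  qed (intro PF_intros poly_bounded_intros)+
  moreover have "foldl (\<lambda>s a. s @ [if length s < n then length s else 0]) [] (replicate m Lf) = [0..<m]"
    if "m \<le> n" for m n
    using that
  proof (induction m)
    case (Suc m)
    have "replicate (Suc m) Lf = replicate m Lf @ [Lf]" by (simp add: replicate_append_same)
    with Suc show ?case by (simp del: replicate.simps)
  qed simp
  ultimately show "PF (\<lambda>n. [0..<n])" by simp
qed

lemma PF_upt [PF_intros]:
  assumes "PF f" "PF g"
  shows "PF (\<lambda>x. [f x..<g x])"
proof -
  have "PF (\<lambda>x. filter (\<lambda>k. f x \<le> k) [0..<g x])"
    by (intro PF_intros PF_upt_0 PF_comp[OF assms(1)] assms)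
  moreover have "filter (\<lambda>k. m \<le> k) [0..<n] = [m..<n]" for m n
    by (induction n) auto
  ultimately show ?thesis by simp
qed

lemma PF_drop [PF_intros]:
  assumes "PF f" "PF g"
  shows "PF (\<lambda>x. drop (f x) (g x))"
proof -
  have "PF (\<lambda>x. foldl (\<lambda>s a. tl s) (g x) (replicate (f x) Lf))"
  proof (rule PF_foldl[where b = "\<lambda>_. 0"])
    show "tsize (enc (tl s)) \<le> tsize (enc s) + 0" for s :: "'b list" by (cases s) auto
  qed (intro PF_intros assms poly_bounded_intros)+
  moreover have "foldl (\<lambda>s a. tl s) l (replicate n Lf) = drop n l" for l :: "'b list" and n
    by (induction n arbitrary: l) (auto simp: drop_Suc)
  ultimately show ?thesis by simp
qed

lemma PF_zip [PF_intros]: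
  assumes "PF f" "PF g"
  shows "PF (\<lambda>x. zip (f x) (g x))"
proof -
  have "PF (\<lambda>x. map (\<lambda>i. (hd (drop i (f x)), hd (drop i (g x))))
      (filter (\<lambda>i. i < length (g x)) [0..<length (f x)]))"
    by (intro PF_intros assms PF_comp[OF assms(1)] PF_comp[OF assms(2)])
  moreover have "map (\<lambda>i. (hd (drop i u), hd (drop i v))) (filter (\<lambda>i. i < length v) [0..<length u]) = zip u v"
    for u :: "'b list" and v :: "'c list"
  proof -
    have "filter (\<lambda>i. i < n) [0..<m] = [0..<min m n]" for m n :: nat
      by (induction m) auto
    then show ?thesis by (intro nth_equalityI) (auto simp: hd_drop_conv_nth)
  qed
  ultimately show ?thesis by simp
qed

lemma PF_pol: "PF pol"
  by (rule PF_I[OF FP_pol]) (simp add: word_tree_eq_enc)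

lemma PF_eq_word:
  assumes "PF f" "PF g"
  shows "PF (\<lambda>x. f x = (g x :: bool list))"
proof -
  have "PF (\<lambda>x. length (f x) \<le> length (g x) \<and> length (g x) \<le> length (f x) \<and>
      (\<forall>p \<in> set (zip (f x) (g x)). fst p = snd p))"
    by (intro PF_intros PF_bool2[where h = "(=)"] assms)
  moreover have "u = v \<longleftrightarrow> length u \<le> length v \<and> length v \<le> length u \<and>
      (\<forall>p \<in> set (zip u v). fst p = snd p)" for u v :: "bool list"
    using list_eq_iff_zip_eq[of u v] by (auto simp: split_beta)
  ultimately show ?thesis by (simp only:)
qed

text \<open>Polish notation is self-delimiting: no tree has a proper prefix of its notation as the
  notation of another tree. In particular \<open>pol\<close> is injective.\<close>

lemma pol_append_inject: "pol s @ v = pol t @ w \<longleftrightarrow> s = t \<and> v = w"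
proof (induction s arbitrary: t v w)
  case Lf
  then show ?case by (cases t) auto
next
  case (Nd a b)
  then show ?case by (cases t) auto
qed

lemma PF_eq [PF_intros]:
  assumes "PF f" "PF g"
  shows "PF (\<lambda>x. f x = g x)"
proof -
  have e: "PF (enc :: 'b \<Rightarrow> tree)" by (rule PF_I[OF FP_id]) simp
  have "PF (\<lambda>x. pol (enc (f x)) = pol (enc (g x)))"
    by (intro PF_eq_word PF_comp[OF PF_pol] PF_comp[OF e] assms)
  moreover have "pol (enc a) = pol (enc b) \<longleftrightarrow> a = b" for a b :: 'b
    using pol_append_inject[of "enc a" "[]" "enc b" "[]"] by simp
  ultimately show ?thesis by simp
qed

lemma PF_member [PF_intros]: "PF f \<Longrightarrow> PF g \<Longrightarrow> PF (\<lambda>x. f x \<in> set (g x))"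
  using PF_bex[of "\<lambda>x a. a = f x" g, OF PF_eq[OF PF_snd[OF PF_id] PF_comp[OF _ PF_fst[OF PF_id]]]]
  by simp

lemma PF_div [PF_intros]:
  assumes "PF f" "PF g"
  shows "PF (\<lambda>x. f x div g x :: nat)"
proof -
  have "PF (\<lambda>x. if g x = 0 then 0 else length (filter (\<lambda>i. i * g x \<le> f x) [1..<Suc (f x)]))"
    by (intro PF_intros PF_comp[OF assms(1)] PF_comp[OF assms(2)] assms)
  moreover have "(if n = 0 then 0 else length (filter (\<lambda>i. i * n \<le> m) [1..<Suc m])) = m div n" for m n :: nat
  proof (cases "n = 0")
    case False
    have le: "i \<le> m" if "i * n \<le> m" for i
      using that False by (metis dual_order.trans mult.right_neutral mult_le_mono2 not_less_eq_eq One_nat_def le_zero_eq)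
    have "length (filter (\<lambda>i. i * n \<le> m) [1..<Suc m]) = card {i. i \<in> {1..<Suc m} \<and> i * n \<le> m}"
      by (subst distinct_card[symmetric]) (auto intro: arg_cong[of _ _ card])
    also have "{i. i \<in> {1..<Suc m} \<and> i * n \<le> m} = {1..m div n}"
      using False le by (auto simp: less_eq_div_iff_mult_less_eq less_Suc_eq_le)
    finally show ?thesis using False by simp
  qed simp
  ultimately show ?thesis by simp
qed

lemma PF_mod [PF_intros]:
  assumes "PF f" "PF g"
  shows "PF (\<lambda>x. f x mod g x :: nat)"
proof -
  have "PF (\<lambda>x. f x - (f x div g x) * g x)" by (intro PF_intros assms)
  then show ?thesis by (simp add: minus_div_mult_eq_mod)
qed

lemma PF_poly [PF_intros]:
  fixes p :: "nat poly"
  assumes "PF f"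
  shows "PF (\<lambda>x. poly p (f x))"
proof (induction p)
  case 0
  then show ?case by (simp add: PF_const)
next
  case (pCons a p)
  have "PF (\<lambda>x. a + f x * poly p (f x))" by (intro PF_add PF_mult PF_const pCons.IH assms)
  then show ?case by simp
qed

definition halve_step :: "nat \<times> bool list \<Rightarrow> nat \<times> bool list" where
  "halve_step s = (if fst s = 0 then s else (fst s div 2, (fst s mod 2 = 1) # snd s))"

text \<open>The list is a clock. At least \<open>n\<close> rounds of halving certainly reach 0, and
  the remaining ones idle.\<close>

lemma halve_step_foldl:
  "n \<le> length l \<Longrightarrow> snd (foldl (\<lambda>s _. halve_step s) (n, w) l) = rev (binary n) @ w"
proof (induction l arbitrary: n w)
  case Nil
  then show ?case by (simp add: binary.simps)
next
  case (Cons a l)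
  show ?case
  proof (cases "n = 0")
    case True
    have "foldl (\<lambda>s _. halve_step s) (0, w) l = (0, w)" for l :: "'a list"
      by (induction l) (auto simp: halve_step_def)
    then show ?thesis using True by (simp add: halve_step_def binary.simps)
  next
    case False
    then show ?thesis
      using Cons.IH[of "n div 2" "(n mod 2 = 1) # w"] Cons.prems
      by (subst binary.simps) (auto simp: halve_step_def odd_iff_mod_2_eq_one)
  qed
qed

lemma PF_binary [PF_intros]: "PF f \<Longrightarrow> PF (\<lambda>x. binary (f x))"
proof (rule PF_comp[of binary])
  have "PF (\<lambda>n. rev (snd (foldl (\<lambda>s _. halve_step s) (n, []) (replicate n Lf))))"
  proof (intro PF_rev PF_snd PF_foldl[where b = "\<lambda>_. 4"])
    show "PF (\<lambda>p. halve_step (fst (snd p)))" unfolding halve_step_def by (intro PF_intros)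
    show "tsize (enc (halve_step s)) \<le> tsize (enc s) + 4" for s
      using tsize_bool[of "fst s mod 2 = 1"] by (cases s) (auto simp: halve_step_def)
  qed (intro PF_intros poly_bounded_intros)+
  then show "PF binary" by (simp add: halve_step_foldl)
qed

lemma PF_unary [PF_intros]: "PF f \<Longrightarrow> PF (\<lambda>x. unary (f x))"
  unfolding unary_def by (intro PF_intros)

lemma PF_delimited [PF_intros]: "PF f \<Longrightarrow> PF (\<lambda>x. delimited (f x))"
  unfolding delimited_def by (intro PF_intros)

section \<open>From formulas to grids\<close>

lemma coloring_iff:
  "coloring N M c \<psi> \<longleftrightarrow>
     (\<forall>a < N. \<forall>b < M. \<psi> (Suc a, Suc b) \<in> {1..c}) \<and>
     (\<forall>a a' b b'. a < a' \<longrightarrow> a' < N \<longrightarrow> b < b' \<longrightarrow> b' < M \<longrightarrow>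
        \<not> (\<psi> (Suc a, Suc b) = \<psi> (Suc a', Suc b) \<and> \<psi> (Suc a, Suc b) = \<psi> (Suc a', Suc b') \<and>
           \<psi> (Suc a, Suc b) = \<psi> (Suc a, Suc b')))"
  (is "_ \<longleftrightarrow> ?cells \<and> ?rects")
proof -
  have "(\<forall>z \<in> grid N M. \<psi> z \<in> {1..c}) \<longleftrightarrow> ?cells"
  proof (intro iffI ballI allI impI)
    fix z assume *: "?cells" "z \<in> grid N M"
    then obtain a b where "z = (a, b)" "1 \<le> a" "a \<le> N" "1 \<le> b" "b \<le> M" by (auto simp: grid_def)
    then show "\<psi> z \<in> {1..c}" using *(1)[rule_format, of "a - 1" "b - 1"] by auto
  qed (auto simp: grid_def)
  moreover have "(\<forall>R \<in> rectangles N M. \<not> (\<exists>k. \<forall>z \<in> R. \<psi> z = k)) \<longleftrightarrow> ?rects"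
  proof (intro iffI ballI allI impI notI)
    fix a a' b b'
    assume *: "\<forall>R \<in> rectangles N M. \<not> (\<exists>k. \<forall>z \<in> R. \<psi> z = k)" "a < a'" "a' < N" "b < b'" "b' < M"
      and eq: "\<psi> (Suc a, Suc b) = \<psi> (Suc a', Suc b) \<and> \<psi> (Suc a, Suc b) = \<psi> (Suc a', Suc b') \<and>
           \<psi> (Suc a, Suc b) = \<psi> (Suc a, Suc b')"
    let ?R = "{(Suc a, Suc b), (Suc a + (a' - a), Suc b), (Suc a + (a' - a), Suc b + (b' - b)), (Suc a, Suc b + (b' - b))}"
    have "?R \<subseteq> grid N M" using *(2-) by (auto simp: grid_def)
    moreover have "\<exists>p q c1 c2. 0 < p \<and> 0 < q \<and> 0 < c1 \<and> 0 < c2 \<and>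
        ?R = {(p, q), (p + c1, q), (p + c1, q + c2), (p, q + c2)}"
      by (rule exI[of _ "Suc a"], rule exI[of _ "Suc b"], rule exI[of _ "a' - a"],
          rule exI[of _ "b' - b"]) (use *(2-) in simp)
    ultimately have "?R \<in> rectangles N M" unfolding rectangles_def by blast
    moreover have "\<forall>z \<in> ?R. \<psi> z = \<psi> (Suc a, Suc b)" using eq *(2-) by auto
    ultimately show False using *(1) by blast
  next
    fix R assume *: "?rects" "R \<in> rectangles N M" and mono: "\<exists>k. \<forall>z \<in> R. \<psi> z = k"
    from *(2) obtain a b c1 c2 where R: "R \<subseteq> grid N M" "0 < a" "0 < b" "0 < c1" "0 < c2"
      "R = {(a, b), (a + c1, b), (a + c1, b + c2), (a, b + c2)}"
      unfolding rectangles_def by blast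
    from mono obtain k where k: "\<forall>z \<in> R. \<psi> z = k" by blast
    obtain a0 b0 where "a = Suc a0" "b = Suc b0" using R(2,3) by (metis gr0_implies_Suc)
    then show False
      using *(1)[rule_format, of a0 "a0 + c1" b0 "b0 + c2"] R k by (auto simp: grid_def)
  qed
  ultimately show ?thesis unfolding coloring_def by simp
qed

section \<open>The grid of a formula\<close>

type_synonym 'v cnf = "(bool \<times> 'v) list list"

definition satisfiable :: "'v cnf \<Rightarrow> bool" where
  "satisfiable \<phi> \<longleftrightarrow> (\<exists>\<alpha>. \<forall>C \<in> set \<phi>. \<exists>(b, v) \<in> set C. \<alpha> v = b)"

text \<open>Colours and positions are counted from 0. Row 0 has one free cell for each clause, followed
  by one cell of each colour. The free cell of a clause takes the colour of the variable of a true
  literal. Row \<open>Suc k\<close> forbids colour \<open>k\<close> to the clauses in which \<open>k\<close> does not occur as a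
  variable; the row \<open>Suc (K + i)\<close> forbids that two clauses both select the variable \<open>v\<close> when it
  occurs positively in the one and negatively in the other. All other cells in the clause columns
  get a colour of their own, and the colour columns are filled such that no further rectangles arise.\<close>

definition clause :: "'v cnf \<Rightarrow> nat \<Rightarrow> (bool \<times> 'v) list" where
  "clause \<phi> c = hd (drop c \<phi>)"

definition occurs :: "'v cnf \<Rightarrow> nat \<Rightarrow> 'v \<Rightarrow> bool" where
  "occurs \<phi> c v \<longleftrightarrow> (True, v) \<in> set (clause \<phi> c) \<or> (False, v) \<in> set (clause \<phi> c)"

text \<open>One row for every triple of a variable and two clauses, numbered
  \<open>(v * m + j) * m + j'\<close>. Triples without a conflict get a row of own colours, so that
  the triple can be read off the row number by division.\<close>

definition n_conflicts :: "nat \<Rightarrow> nat cnf \<Rightarrow> nat" where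
  "n_conflicts V \<phi> = V * length \<phi> * length \<phi>"

text \<open>The sum counts the variables, the cells \<open>k * m + c\<close> that the rows of
  variables may leave unblocked, and the cells \<open>i * m + c\<close> of the conflict rows.
  Doubling it and adding 1 makes the number odd, as \<open>mod_reflect_fixed\<close>
  requires.\<close>

definition n_colours :: "nat \<Rightarrow> nat cnf \<Rightarrow> nat" where
  "n_colours V \<phi> = 2 * (V + V * length \<phi> + n_conflicts V \<phi> * length \<phi>) + 1"

definition conflict_at :: "nat cnf \<Rightarrow> nat \<Rightarrow> nat \<Rightarrow> nat \<Rightarrow> bool" where
  "conflict_at \<phi> v j j' \<longleftrightarrow> (True, v) \<in> set (clause \<phi> j) \<and> (False, v) \<in> set (clause \<phi> j')"

definition conflict_colour :: "nat \<Rightarrow> nat cnf \<Rightarrow> nat \<Rightarrow> nat \<Rightarrow> nat" where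
  "conflict_colour V \<phi> i c =
     (let m = length \<phi>; v = i div (m * m); j = i div m mod m; j' = i mod m
      in if conflict_at \<phi> v j j' \<and> (c = j \<or> c = j') then v else V + V * m + (i * m + c))"

text \<open>An own colour \<open>x\<close> could be selected too, so row \<open>Suc x\<close> with
  \<open>V \<le> x\<close> carries \<open>x\<close> in all clause columns. If an unblocked cell in
  row \<open>Suc k\<close> has colour \<open>x\<close>, these two rows agree in its column and must
  not both have \<open>x\<close> in column \<open>m + x\<close>. Hence row \<open>Suc k\<close>
  continues with the reflection of \<open>e\<close> to \<open>2 * k - e\<close> modulo
  \<open>K\<close> if \<open>k < V\<close>, which fixes \<open>k\<close> alone, and with the
  identity otherwise. Conflict rows continue with the shift by \<open>1 + i\<close>, which has no
  fixed point.\<close>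

definition cell_colour :: "nat \<Rightarrow> nat cnf \<Rightarrow> nat \<Rightarrow> nat \<Rightarrow> nat" where
  "cell_colour V \<phi> r c =
     (let m = length \<phi>; K = n_colours V \<phi> in
      if r = 0 then c - m
      else if r \<le> K then
        (if c < m then (if r - 1 < V \<and> occurs \<phi> c (r - 1) then V + ((r - 1) * m + c) else r - 1)
         else if r - 1 < V then (2 * (r - 1) + (K - (c - m))) mod K else c - m)
      else
        (if c < m then conflict_colour V \<phi> (r - 1 - K) c
         else (c - m + (1 + (r - 1 - K))) mod K))"

lemma mod_add_left_inject:
  fixes e e' s K :: nat
  assumes "(s + e) mod K = (s + e') mod K" "e < K" "e' < K"
  shows "e = e'"
proof -
  have "(int s + int e) mod int K = (int s + int e') mod int K"
    using assms(1) by (metis of_nat_add of_nat_mod)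
  then have "int K dvd int e - int e'" by (simp add: mod_eq_dvd_iff)
  then show ?thesis
    using assms(2,3) zdvd_imp_le[of "int K" "int e - int e'"] zdvd_imp_le[of "int K" "int e' - int e"]
      dvd_diff_commute[of "int K" "int e" "int e'"]
    by linarith
qed

text \<open>A fixed point satisfies \<open>2 * e = 2 * k\<close> modulo \<open>K\<close>, and 2 is
  invertible because \<open>K\<close> is odd.\<close>

lemma mod_reflect_fixed:
  fixes e k K :: nat
  assumes "(2 * k + (K - e)) mod K = e" "e < K" "k < K" "odd K"
  shows "e = k"
proof -
  have "(2 * k + (K - e) + e) mod K = (e + e) mod K"
    using assms(1) by (metis mod_add_left_eq)
  then have "(k + k) mod K = (e + e) mod K" using assms(2) by (simp add: mult_2)
  then have "int K dvd (int k + int k) - (int e + int e)"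
    by (metis mod_eq_dvd_iff of_nat_add of_nat_mod)
  then have "int K dvd 2 * (int k - int e)" by (simp add: algebra_simps)
  moreover have "coprime (int K) 2" using assms(4) by simp
  ultimately have "int K dvd int k - int e" using coprime_dvd_mult_right_iff by blast
  then show ?thesis
    using assms(2,3) zdvd_imp_le[of "int K" "int e - int k"] zdvd_imp_le[of "int K" "int k - int e"]
      dvd_diff_commute[of "int K" "int e" "int k"]
    by linarith
qed

lemma div_mod_unique:
  fixes c c' m i i' :: nat
  shows "i * m + c = i' * m + c' \<Longrightarrow> c < m \<Longrightarrow> c' < m \<Longrightarrow> i = i' \<and> c = c'"
  by (metis add.commute add_right_imp_eq div_less div_mult_self1 less_nat_zero_code plus_nat.add_0)

text \<open>If two different clauses \<open>j\<close> and \<open>j'\<close> could both contain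
  \<open>v\<close> with both signs, then \<open>(v, j, j')\<close> and \<open>(v, j', j)\<close>
  would both be conflicts, and their rows would form a rectangle of colour \<open>v\<close> whatever
  the free cells are. This is what \<open>no_taut\<close> excludes.\<close>

locale grid_reduction =
  fixes V :: nat and \<phi> :: "nat cnf"
  assumes var_less: "\<And>C b v. C \<in> set \<phi> \<Longrightarrow> (b, v) \<in> set C \<Longrightarrow> v < V"
    and no_taut: "\<And>C v. C \<in> set \<phi> \<Longrightarrow> (True, v) \<in> set C \<Longrightarrow> (False, v) \<notin> set C"
begin

abbreviation (input) "m \<equiv> length \<phi>"
abbreviation (input) "K \<equiv> n_colours V \<phi>"
abbreviation (input) "L \<equiv> n_conflicts V \<phi>"

lemma clause_in: "c < m \<Longrightarrow> clause \<phi> c \<in> set \<phi>"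
  by (simp add: clause_def hd_drop_conv_nth)

lemma occurs_less: "occurs \<phi> c v \<Longrightarrow> c < m \<Longrightarrow> v < V"
  using clause_in var_less unfolding occurs_def by blast

lemma odd_K: "odd K" and K_pos: "0 < K"
  by (auto simp: n_colours_def)

text \<open>Consequently the shifts \<open>1 + i\<close> of the conflict rows are nonzero and
  pairwise distinct modulo \<open>K\<close>.\<close>

lemma Suc_L_less: "i < L \<Longrightarrow> Suc i < K"
proof -
  assume i: "i < L"
  then have "0 < m" by (cases m) (auto simp: n_conflicts_def)
  then have "i < L * m" using i by (cases m) auto
  then show ?thesis by (simp add: n_colours_def)
qed

lemma V_less_K: "v < V \<Longrightarrow> v < K"
  by (auto simp: n_colours_def)

lemma row_hole_less:
  assumes "k < V" "c < m"
  shows "k * m + c < V * m"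
proof -
  have "k * m + c < Suc k * m" using assms by simp
  also have "\<dots> \<le> V * m" using assms by (intro mult_le_mono1) auto
  finally show ?thesis .
qed

lemma conflict_index:
  assumes "v < V" "j < m" "j' < m"
  shows "(v * m + j) * m + j' < L"
    "((v * m + j) * m + j') div (m * m) = v"
    "((v * m + j) * m + j') div m mod m = j"
    "((v * m + j) * m + j') mod m = j'"
proof -
  have m: "0 < m" using assms by auto
  have "(v * m + j) * m + j' < Suc (v * m + j) * m" using assms by simp
  also have "\<dots> \<le> V * m * m" using row_hole_less[OF assms(1,2)] by (intro mult_le_mono1) auto
  finally show "(v * m + j) * m + j' < L" by (simp add: n_conflicts_def)
  have d: "((v * m + j) * m + j') div m = v * m + j" using assms m by simp
  show "((v * m + j) * m + j') div (m * m) = v"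
    using assms m by (simp add: div_mult2_eq d)
  show "((v * m + j) * m + j') div m mod m = j" using assms m by (simp add: d)
  show "((v * m + j) * m + j') mod m = j'" using assms m by simp
qed

lemma conflict_index_inverse:
  assumes "i < L"
  shows "i = (i div (m * m) * m + i div m mod m) * m + i mod m" "i div (m * m) < V"
    "i div m mod m < m" "i mod m < m"
proof -
  have m: "0 < m" using assms by (cases m) (auto simp: n_conflicts_def)
  have "i div (m * m) = i div m div m" by (simp add: div_mult2_eq)
  then show "i = (i div (m * m) * m + i div m mod m) * m + i mod m" by simp
  show "i div (m * m) < V"
    using assms by (simp add: n_conflicts_def less_mult_imp_div_less mult.assoc)
qed (use assms in \<open>(cases m; auto simp: n_conflicts_def)+\<close>)

lemma cell_colour_top: "cell_colour V \<phi> 0 (m + e) = e"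
  by (simp add: cell_colour_def Let_def)

lemma cell_colour_block:
  "k < K \<Longrightarrow> c < m \<Longrightarrow>
   cell_colour V \<phi> (Suc k) c = (if k < V \<and> occurs \<phi> c k then V + (k * m + c) else k)"
  by (simp add: cell_colour_def Let_def)

lemma cell_colour_block_right:
  "k < K \<Longrightarrow> e < K \<Longrightarrow>
   cell_colour V \<phi> (Suc k) (m + e) = (if k < V then (2 * k + (K - e)) mod K else e)"
  by (simp add: cell_colour_def Let_def)

lemma cell_colour_conflict:
  "c < m \<Longrightarrow> cell_colour V \<phi> (Suc (K + i)) c = conflict_colour V \<phi> i c"
  by (simp add: cell_colour_def Let_def)

lemma cell_colour_conflict_right:
  "cell_colour V \<phi> (Suc (K + i)) (m + e) = (e + (1 + i)) mod K"
  by (simp add: cell_colour_def Let_def)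

text \<open>Together with the cell of colour \<open>k\<close> in row 0 of the same column, this cell
  completes the rectangle that forbids \<open>k\<close> to the blocked clauses. Both the identity
  and the reflection fix \<open>k\<close>.\<close>

lemma cell_colour_block_right_self: "k < K \<Longrightarrow> cell_colour V \<phi> (Suc k) (m + k) = k"
  by (simp add: cell_colour_block_right mult_2)

lemma conflict_colour_cases:
  assumes "i < L" "c < m"
  obtains (own) "conflict_colour V \<phi> i c = V + V * m + (i * m + c)"
  | (var) v j j' where "i = (v * m + j) * m + j'" "v < V" "j < m" "j' < m" "conflict_at \<phi> v j j'"
     "c = j \<or> c = j'" "conflict_colour V \<phi> i c = v"
  using conflict_index_inverse[OF assms(1)] that
  unfolding conflict_colour_def Let_def by (metis (full_types))

lemma conflict_at_occurs: "conflict_at \<phi> v j j' \<Longrightarrow> c = j \<or> c = j' \<Longrightarrow> occurs \<phi> c v"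
  by (auto simp: conflict_at_def occurs_def)

lemma conflict_at_neq: "conflict_at \<phi> v j j' \<Longrightarrow> j < m \<Longrightarrow> j' < m \<Longrightarrow> j \<noteq> j'"
  using no_taut clause_in unfolding conflict_at_def by blast

lemma cell_colour_less:
  assumes "r < Suc (K + L)" "c < m + K" "r = 0 \<longrightarrow> m \<le> c"
  shows "cell_colour V \<phi> r c < K"
proof -
  consider (top) e where "r = 0" "c = m + e" "e < K"
    | (bl) k where "r = Suc k" "k < K" "c < m"
    | (br) k e where "r = Suc k" "k < K" "c = m + e" "e < K"
    | (cl) i where "r = Suc (K + i)" "i < L" "c < m"
    | (cr) i e where "r = Suc (K + i)" "i < L" "c = m + e" "e < K"
  proof (cases "r = 0")
    case True
    then show ?thesis using that(1)[of "c - m"] assms by auto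
  next
    case False
    then show ?thesis
      using that(2)[of "r - 1"] that(3)[of "r - 1" "c - m"] that(4)[of "r - 1 - K"]
        that(5)[of "r - 1 - K" "c - m"] assms
      by (cases "r - 1 < K"; cases "c < m") auto
  qed
  then show ?thesis
  proof cases
    case bl
    then show ?thesis
      using row_hole_less[of k c] by (auto simp: cell_colour_block n_colours_def)
  next
    case cl
    then have "i * m + c < Suc i * m" by simp
    also have "\<dots> \<le> L * m" using cl by (intro mult_le_mono1) auto
    finally have "conflict_colour V \<phi> i c < K"
      by (cases rule: conflict_colour_cases[OF cl(2,3)]) (auto simp: n_colours_def)
    then show ?thesis using cl by (simp add: cell_colour_conflict)
  qed (use K_pos in \<open>auto simp: cell_colour_top cell_colour_block_right cell_colour_conflict_right\<close>)
qed

definition "fill z r c = (if r = 0 \<and> c < m then z c else cell_colour V \<phi> r c)"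

text \<open>Variables are chosen rather than literals: as no clause is tautological, the clause
  determines the sign of a chosen variable.\<close>

definition "selection z \<longleftrightarrow> (\<forall>c < m. occurs \<phi> c (z c)) \<and>
  (\<forall>v j j'. j < m \<longrightarrow> j' < m \<longrightarrow> conflict_at \<phi> v j j' \<longrightarrow> \<not> (z j = v \<and> z j' = v))"

text \<open>Identity, reflection and shift are injective modulo \<open>K\<close>. Hence no rectangle
  has both its columns among the colour columns.\<close>

lemma fill_right_inject:
  assumes "r < Suc (K + L)" "e < K" "e' < K" "fill z r (m + e) = fill z r (m + e')"
  shows "e = e'"
proof (cases "r = 0")
  case True
  then show ?thesis using assms by (simp add: fill_def cell_colour_top)
next
  case False
  show ?thesis
  proof (cases "r - 1 < K")
    case True
    define k where "k = r - 1"
    have k: "r = Suc k" "k < K" using False True by (auto simp: k_def)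
    show ?thesis
    proof (cases "k < V")
      case True
      then have "(2 * k + (K - e)) mod K = (2 * k + (K - e')) mod K"
        using assms k by (simp add: fill_def cell_colour_block_right)
      then have "(2 * k + e + e' + (K - e)) mod K = (2 * k + e + e' + (K - e')) mod K"
        by (metis (no_types, lifting) ab_semigroup_add_class.add_ac(1) add.commute mod_add_right_eq)
      then have "(2 * k + e' + K) mod K = (2 * k + e + K) mod K"
        using assms(2,3) by (simp add: algebra_simps)
      then have "(2 * k + e') mod K = (2 * k + e) mod K" by simp
      then show ?thesis using mod_add_left_inject assms(2,3) by metis
    next
      case False
      then show ?thesis using assms k by (simp add: fill_def cell_colour_block_right)
    qed
  next
    case outer: False
    define i where "i = r - 1 - K"
    have i: "r = Suc (K + i)" using False outer by (auto simp: i_def)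
    then have "(e + (1 + i)) mod K = (e' + (1 + i)) mod K"
      using assms unfolding i by (simp only: fill_def cell_colour_conflict_right) simp
    then show ?thesis using mod_add_left_inject[of "1 + i" e K e'] assms(2,3) by (simp add: add.commute)
  qed
qed

text \<open>Within a row, own colours of different clause columns differ from each other and from
  the blocked colour or conflicting variable of the row. A repetition is thus due to the selection,
  to blocking or to a conflict.\<close>

lemma fill_left_pair:
  assumes "selection z" "r < Suc (K + L)" "c < m" "c' < m" "c \<noteq> c'" "fill z r c = x" "fill z r c' = x"
  shows "(r = 0 \<and> z c = x \<and> z c' = x) \<or> (r = Suc x \<and> \<not> occurs \<phi> c x) \<or>
    (\<exists>j j'. r = Suc (K + ((x * m + j) * m + j')) \<and> j < m \<and> j' < m \<and> conflict_at \<phi> x j j' \<and> {c, c'} = {j, j'})"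
proof -
  consider "r = 0" | k where "r = Suc k" "k < K" | i where "r = Suc (K + i)" "i < L"
    using assms(2) by (metis add_less_cancel_left le_add_diff_inverse less_Suc_eq_0_disj not_less)
  then show ?thesis
  proof cases
    case 1
    then show ?thesis using assms by (simp add: fill_def)
  next
    case (2 k)
    then have "cell_colour V \<phi> (Suc k) c = x" "cell_colour V \<phi> (Suc k) c' = x"
      using assms by (auto simp: fill_def)
    then show ?thesis
      using 2 assms occurs_less[of c k] by (auto simp: cell_colour_block split: if_splits)
  next
    case (3 i)
    then have *: "conflict_colour V \<phi> i c = x" "conflict_colour V \<phi> i c' = x"
      using assms by (auto simp: fill_def cell_colour_conflict)
    from 3(2) assms(3) show ?thesis
    proof (cases rule: conflict_colour_cases)
      case own
      show ?thesis
        by (cases rule: conflict_colour_cases[OF 3(2) assms(4)]) (use own * assms(5) in auto)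
    next
      case (var v j j')
      from 3(2) assms(4) show ?thesis
      proof (cases rule: conflict_colour_cases)
        case own
        then show ?thesis using var * by auto
      next
        case (var v2 j2 j2')
        with \<open>v < V\<close> \<open>j < m\<close> \<open>j' < m\<close> \<open>i = (v * m + j) * m + j'\<close>
        have "v2 = v" "j2 = j" "j2' = j'" using conflict_index by metis+
        then show ?thesis using var assms(5) * 3(1) \<open>c = j \<or> c = j'\<close> by auto
      qed
    qed
  qed
qed

text \<open>The sources of a repeated colour exclude each other: selected and conflicting variables
  occur in their clauses, blocked ones do not; a selection avoids conflicts; and two conflict rows
  with the same variable and the same two clauses would make a clause tautological.\<close>

lemma fill_no_left_rectangle:
  assumes z: "selection z" and r: "r < r'" "r' < Suc (K + L)" and c: "c < c'" "c' < m"
    and x: "fill z r c = x" "fill z r c' = x" "fill z r' c = x" "fill z r' c' = x"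
  shows False
proof -
  have cm: "c < m" "c \<noteq> c'" using c by auto
  note A = fill_left_pair[OF z less_trans[OF r] cm(1) c(2) cm(2) x(1,2)]
  note B = fill_left_pair[OF z r(2) cm(1) c(2) cm(2) x(3,4)]
  have occ: "occurs \<phi> c x" if "conflict_at \<phi> x j j'" "{c, c'} = {j, j'}" for j j'
    using conflict_at_occurs[OF that(1), of c] that(2) by auto
  have zocc: "occurs \<phi> c x" if "z c = x"
    using z that cm(1) unfolding selection_def by auto
  have zc: False if "z c = x" "z c' = x" "j < m" "j' < m" "conflict_at \<phi> x j j'" "{c, c'} = {j, j'}" for j j'
    using z that unfolding selection_def doubleton_eq_iff by metis
  have uniq: False if "conflict_at \<phi> x j j'" "{c, c'} = {j, j'}" "j < m" "j' < m"
      "conflict_at \<phi> x i i'" "{c, c'} = {i, i'}" "j \<noteq> i \<or> j' \<noteq> i'" for i i' j j'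
  proof -
    \<comment> \<open>The ordered pairs differ but have the same elements, so one is the other
      reversed.\<close>
    have "j = i' \<and> j' = i" using that(2,6,7) by (auto simp: doubleton_eq_iff)
    then show False
      using that(1,3,5) no_taut[OF clause_in] unfolding conflict_at_def by blast
  qed
  from B show False
  proof (elim disjE exE conjE)
    assume "r' = 0"
    with r(1) show False by simp
  next
    assume "r' = Suc x" "\<not> occurs \<phi> c x"
    with A r occ zocc show False by auto
  next
    fix j j' assume *: "r' = Suc (K + ((x * m + j) * m + j'))" "j < m" "j' < m"
      "conflict_at \<phi> x j j'" "{c, c'} = {j, j'}"
    from A show False
      using occ[OF *(4,5)] zc[OF _ _ *(2-5)] uniq[OF *(4,5,2,3)] *(1) r(1) by (metis less_irrefl)
  qed
qed

text \<open>Many pairs of rows already disagree in the clause column: the variable selected there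
  occurs in the clause, a blocked one does not, and the own colours of the two kinds of rows lie in
  disjoint ranges. What remains is the blocking row of an own colour, or a conflict row paired with
  row 0; these cases contradict the fixed points of reflections and shifts. Two conflict rows have
  different shifts.\<close>

lemma fill_no_mixed_rectangle:
  assumes z: "selection z" and r: "r < r'" "r' < Suc (K + L)" and c: "c < m" and e: "e < K"
    and x: "fill z r c = x" "fill z r (m + e) = x" "fill z r' c = x" "fill z r' (m + e) = x"
  shows False
proof -
  have shifted: False if "i < L" "(e + (1 + i)) mod K = e" for i
    using mod_add_left_inject[of e "1 + i" K 0] that Suc_L_less[OF that(1)] e K_pos by simp
  have block: "(k = x \<and> \<not> occurs \<phi> c k \<and> (V \<le> x \<longrightarrow> e = x)) \<or>
      (k < V \<and> x = V + (k * m + c) \<and> (2 * k + (K - e)) mod K = x)"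
    if "k < K" "fill z (Suc k) c = x" "fill z (Suc k) (m + e) = x" for k
    using that c e occurs_less[of c k]
    by (auto simp: fill_def cell_colour_block cell_colour_block_right split: if_splits)
  have conflict: "(occurs \<phi> c x \<and> x < V) \<or> V + V * m \<le> x"
    if "i < L" "fill z (Suc (K + i)) c = x" for i
    by (cases rule: conflict_colour_cases[OF that(1) c])
       (use that(2) c conflict_at_occurs in \<open>auto simp: fill_def cell_colour_conflict\<close>)
  consider k where "r' = Suc k" "k < K" | i where "r' = Suc (K + i)" "i < L"
    using r by (metis add_less_cancel_left le_add_diff_inverse less_Suc_eq_0_disj not_less less_nat_zero_code)
  then show False
  proof cases
    case (1 k)
    note B = block[OF 1(2)] x[unfolded 1]
    show False
    proof (cases "r = 0")
      case True
      then have "z c = x" "e = x" using x c by (auto simp: fill_def cell_colour_top)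
      moreover from this have "occurs \<phi> c x" "x < V"
        using z c occurs_less unfolding selection_def by auto
      ultimately show False using B by auto
    next
      case False
      then obtain k2 where k2: "r = Suc k2" "k2 < k" "k2 < K" using r 1 by (cases r) auto
      have 2: "(k2 = x \<and> \<not> occurs \<phi> c k2 \<and> (V \<le> x \<longrightarrow> e = x)) \<or>
          (k2 < V \<and> x = V + (k2 * m + c) \<and> (2 * k2 + (K - e)) mod K = x)"
        using block[OF k2(3)] x k2 by auto
      have 1: "(k = x \<and> \<not> occurs \<phi> c k \<and> (V \<le> x \<longrightarrow> e = x)) \<or>
          (k < V \<and> x = V + (k * m + c) \<and> (2 * k + (K - e)) mod K = x)"
        using B by auto
      \<comment> \<open>The reflection fixes only \<open>k'\<close>, so \<open>x = k'\<close> would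
        lie below \<open>V\<close>.\<close>
      have refl: False if "k' < V" "V \<le> x" "e = x" "(2 * k' + (K - e)) mod K = x" for k'
        using mod_reflect_fixed[of k' K e] that V_less_K[of k'] e odd_K by auto
      from 1 2 k2(2) show False
        using refl[of k] refl[of k2] div_mod_unique[of k m c k2 c] c by auto
    qed
  next
    case (2 i)
    have xe: "(e + (1 + i)) mod K = x" using x 2 by (simp add: fill_def cell_colour_conflict_right)
    have C: "(occurs \<phi> c x \<and> x < V) \<or> V + V * m \<le> x" using conflict[OF 2(2)] x 2 by auto
    consider "r = 0" | k where "r = Suc k" "k < K" | i' where "r = Suc (K + i')" "i' < i"
      using r 2 by (metis add_less_cancel_left le_add_diff_inverse less_Suc_eq_0_disj not_less Suc_less_eq)
    then show False
    proof cases
      case 1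
      then have "e = x" using x by (simp add: fill_def cell_colour_top)
      then show False using shifted[OF 2(2)] xe by simp
    next
      case (2 k)
      then show False
        using block[of k] x C row_hole_less[of k c] c shifted[OF \<open>i < L\<close>] xe by auto
    next
      case (3 i')
      then have "(e + (1 + i')) mod K = (e + (1 + i)) mod K"
        using x xe by (simp add: fill_def cell_colour_conflict_right)
      then have "1 + i' = 1 + i"
        by (rule mod_add_left_inject) (use 3(2) Suc_L_less[OF 2(2)] in simp_all)
      then show False using 3 by simp
    qed
  qed
qed

lemma fill_no_rectangle:
  assumes "selection z" "r < r'" "r' < Suc (K + L)" "c < c'" "c' < m + K"
    "fill z r c = x" "fill z r c' = x" "fill z r' c = x" "fill z r' c' = x"
  shows False
proof (cases "c' < m")
  case True
  then show False using fill_no_left_rectangle assms by blast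
next
  case False
  then obtain e' where e': "c' = m + e'" "e' < K" using assms(5) by (metis add_less_cancel_left le_Suc_ex not_less)
  show False
  proof (cases "c < m")
    case True
    then show False using fill_no_mixed_rectangle[OF assms(1-3) True e'(2)] assms(6-) e' by auto
  next
    case False
    then obtain e where e: "c = m + e" "e < K" using assms(4,5) by (metis add_less_cancel_left le_Suc_ex less_trans not_less)
    then show False
      using fill_right_inject[of r e e' z] e' assms by auto
  qed
qed

text \<open>A violated condition yields a rectangle between row 0 and the blocking or conflict row
  that was made for it.\<close>

lemma selection_if_no_rectangle:
  assumes colours: "\<And>c. c < m \<Longrightarrow> z c < K"
    and rect: "\<And>r r' c c'. r < r' \<Longrightarrow> r' < Suc (K + L) \<Longrightarrow> c < c' \<Longrightarrow> c' < m + K \<Longrightarrow>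
      \<not> (fill z r c = fill z r' c \<and> fill z r c = fill z r' c' \<and> fill z r c = fill z r c')"
  shows "selection z"
proof -
  have "occurs \<phi> c (z c)" if c: "c < m" for c
  proof (rule ccontr)
    assume "\<not> occurs \<phi> c (z c)"
    then show False
      using rect[of 0 "Suc (z c)" c "m + z c"] c colours[OF c]
      by (auto simp: fill_def cell_colour_top cell_colour_block cell_colour_block_right_self)
  qed
  moreover have False if v: "z j = v" "z j' = v" "j < m" "j' < m" "conflict_at \<phi> v j j'" for v j j'
  proof -
    define i where "i = (v * m + j) * m + j'"
    have "v < V" using conflict_at_occurs[OF v(5), of j] occurs_less v(3) by auto
    note i = conflict_index[OF this v(3,4), folded i_def]
    have cc: "conflict_colour V \<phi> i j = v" "conflict_colour V \<phi> i j' = v"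
      using i v(5) by (auto simp: conflict_colour_def Let_def)
    have eq: "fill z 0 j = v" "fill z 0 j' = v" "fill z (Suc (K + i)) j = v" "fill z (Suc (K + i)) j' = v"
      using v cc by (auto simp: fill_def cell_colour_conflict)
    have "j \<noteq> j'" using conflict_at_neq v by blast
    then show False
      using rect[of 0 "Suc (K + i)" j j'] rect[of 0 "Suc (K + i)" j' j] eq i(1) v(3,4)
      by (cases "j < j'") auto
  qed
  ultimately show ?thesis unfolding selection_def by blast
qed

lemma satisfiable_iff_selection: "satisfiable \<phi> \<longleftrightarrow> (\<exists>z. selection z)"
proof
  assume "satisfiable \<phi>"
  then obtain \<alpha> where \<alpha>: "\<forall>C \<in> set \<phi>. \<exists>(b, v) \<in> set C. \<alpha> v = b" unfolding satisfiable_def by blast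
  then have "\<forall>c. \<exists>v. c < m \<longrightarrow> (\<alpha> v, v) \<in> set (clause \<phi> c)" using clause_in by fastforce
  then obtain z where z: "\<And>c. c < m \<Longrightarrow> (\<alpha> (z c), z c) \<in> set (clause \<phi> c)" by metis
  have "selection z"
    unfolding selection_def
  proof (intro conjI allI impI notI)
    show "occurs \<phi> c (z c)" if "c < m" for c
      using z[OF that] unfolding occurs_def by (cases "\<alpha> (z c)") auto
    show False if "j < m" "j' < m" "conflict_at \<phi> v j j'" "z j = v \<and> z j' = v" for v j j'
      using z[of j] z[of j'] that no_taut[OF clause_in] unfolding conflict_at_def
      by (cases "\<alpha> v") auto
  qed
  then show "\<exists>z. selection z" by blast
next
  assume "\<exists>z. selection z"
  then obtain z where z: "selection z" by blast
  \<comment> \<open>Variables that no clause chooses positively become false. Where \<open>v\<close>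
    is chosen negatively the literal is true, since no other clause chooses \<open>v\<close>
    positively.\<close>
  define \<alpha> where "\<alpha> v \<longleftrightarrow> (\<exists>j < m. z j = v \<and> (True, v) \<in> set (clause \<phi> j))" for v
  have "\<exists>(b, v) \<in> set C. \<alpha> v = b" if C: "C \<in> set \<phi>" for C
  proof -
    obtain c where "c < m" "\<phi> ! c = C"
      using C by (auto simp: in_set_conv_nth)
    then have c: "c < m" "C = clause \<phi> c" by (auto simp: clause_def hd_drop_conv_nth)
    have "(\<alpha> (z c), z c) \<in> set C"
    proof (cases "(True, z c) \<in> set C")
      case True
      then have "\<alpha> (z c)" using c unfolding \<alpha>_def by blast
      then show ?thesis using True by simp
    next
      case False
      then have F: "(False, z c) \<in> set C" using z c unfolding selection_def occurs_def by auto
      have "\<not> \<alpha> (z c)"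
        using z c F unfolding \<alpha>_def selection_def conflict_at_def by blast
      then show ?thesis using F by simp
    qed
    then show ?thesis by blast
  qed
  then show "satisfiable \<phi>" unfolding satisfiable_def by blast
qed

end

section \<open>The grid as an instance\<close>

definition grid_rows :: "nat \<Rightarrow> nat cnf \<Rightarrow> nat" where
  "grid_rows V \<phi> = Suc (n_colours V \<phi> + n_conflicts V \<phi>)"

definition grid_cols :: "nat \<Rightarrow> nat cnf \<Rightarrow> nat" where
  "grid_cols V \<phi> = length \<phi> + n_colours V \<phi>"

definition grid_table :: "nat \<Rightarrow> nat cnf \<Rightarrow> ((nat \<times> nat) \<times> nat) list" where
  "grid_table V \<phi> = map (\<lambda>z. ((Suc (fst z), Suc (snd z)), Suc (cell_colour V \<phi> (fst z) (snd z))))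
     (filter (\<lambda>z. \<not> (fst z = 0 \<and> snd z < length \<phi>))
       (List.product [0..<grid_rows V \<phi>] [0..<grid_cols V \<phi>]))"

lemma distinct_grid_table: "distinct (map fst (grid_table V \<phi>))"
  unfolding grid_table_def map_map comp_def fst_conv
  by (intro distinct_map[THEN iffD2] conjI distinct_filter distinct_product distinct_upt)
     (auto simp: inj_on_def)

lemma map_of_grid_table:
  "map_of (grid_table V \<phi>) z = Some k \<longleftrightarrow>
   (\<exists>r c. z = (Suc r, Suc c) \<and> r < grid_rows V \<phi> \<and> c < grid_cols V \<phi> \<and> \<not> (r = 0 \<and> c < length \<phi>) \<and>
      k = Suc (cell_colour V \<phi> r c))"
  unfolding map_of_eq_Some_iff[OF distinct_grid_table] by (auto simp: grid_table_def image_iff)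

theorem satisfiable_iff_extendable:
  assumes var_less: "\<And>C b v. C \<in> set \<phi> \<Longrightarrow> (b, v) \<in> set C \<Longrightarrow> v < V"
    and no_taut: "\<And>C v. C \<in> set \<phi> \<Longrightarrow> (True, v) \<in> set C \<Longrightarrow> (False, v) \<notin> set C"
  shows "satisfiable \<phi> \<longleftrightarrow>
    (grid_rows V \<phi>, grid_cols V \<phi>, n_colours V \<phi>, map_of (grid_table V \<phi>)) \<in> GCE"
proof -
  interpret grid_reduction V \<phi> by standard (fact assms)+
  let ?R = "grid_rows V \<phi>" and ?C = "grid_cols V \<phi>" and ?K = "n_colours V \<phi>" and ?T = "grid_table V \<phi>"
  have less: "cell_colour V \<phi> r c < ?K" if "r < ?R" "c < ?C" "\<not> (r = 0 \<and> c < length \<phi>)" for r c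
    by (rule cell_colour_less) (use that in \<open>auto simp: grid_rows_def grid_cols_def\<close>)
  have pm: "partial_mapping ?R ?C ?K (map_of ?T)"
    unfolding partial_mapping_def grid_def dom_def ran_def
    using less by (auto simp: map_of_grid_table Suc_le_eq)
  show ?thesis
  proof
    assume "satisfiable \<phi>"
    then obtain z where z: "selection z" using satisfiable_iff_selection by auto
    define \<psi> where "\<psi> y = Suc (fill z (fst y - 1) (snd y - 1))" for y
    have zl: "z c < ?K" if "c < length \<phi>" for c
      using z that occurs_less V_less_K unfolding selection_def by blast
    have "coloring ?R ?C ?K \<psi>"
      unfolding coloring_iff
    proof (intro conjI allI impI)
      show "\<psi> (Suc a, Suc b) \<in> {1..?K}" if "a < ?R" "b < ?C" for a b
        using less[OF that] zl[of b] by (auto simp: \<psi>_def fill_def Suc_le_eq)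
      show "\<not> (\<psi> (Suc a, Suc b) = \<psi> (Suc a', Suc b) \<and> \<psi> (Suc a, Suc b) = \<psi> (Suc a', Suc b') \<and>
           \<psi> (Suc a, Suc b) = \<psi> (Suc a, Suc b'))"
        if "a < a'" "a' < ?R" "b < b'" "b' < ?C" for a a' b b'
        using fill_no_rectangle[OF z, of a a' b b' "fill z a b"] that
        by (auto simp: \<psi>_def grid_rows_def grid_cols_def)
    qed
    moreover have "map_of ?T y = Some (\<psi> y)" if "y \<in> dom (map_of ?T)" for y
      using that unfolding dom_def by (auto simp: map_of_grid_table \<psi>_def fill_def)
    ultimately have "extendable ?R ?C ?K (map_of ?T)" unfolding extendable_def by blast
    with pm show "(?R, ?C, ?K, map_of ?T) \<in> GCE" by (simp add: GCE_def)
  next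
    assume "(?R, ?C, ?K, map_of ?T) \<in> GCE"
    then obtain \<psi> where col: "coloring ?R ?C ?K \<psi>" and ext: "\<And>y. y \<in> dom (map_of ?T) \<Longrightarrow> map_of ?T y = Some (\<psi> y)"
      by (auto simp: GCE_def extendable_def)
    define z where "z c = \<psi> (Suc 0, Suc c) - 1" for c
    have cells: "\<psi> (Suc r, Suc c) \<in> {1..?K}" if "r < ?R" "c < ?C" for r c
      using col that unfolding coloring_iff by blast
    have fill: "\<psi> (Suc r, Suc c) = Suc (fill z r c)" if "r < ?R" "c < ?C" for r c
    proof (cases "r = 0 \<and> c < length \<phi>")
      case True
      then show ?thesis using cells[OF that] by (auto simp: fill_def z_def)
    next
      case False
      then have "map_of ?T (Suc r, Suc c) = Some (Suc (cell_colour V \<phi> r c))"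
        using that by (simp add: map_of_grid_table)
      moreover from this have "map_of ?T (Suc r, Suc c) = Some (\<psi> (Suc r, Suc c))"
        by (intro ext) auto
      ultimately show ?thesis using False by (auto simp: fill_def)
    qed
    have "selection z"
    proof (rule selection_if_no_rectangle)
      show "z c < ?K" if "c < length \<phi>" for c
        using cells[of 0 c] that by (auto simp: z_def grid_rows_def grid_cols_def)
      fix r r' c c'
      assume *: "r < r'" "r' < Suc (?K + n_conflicts V \<phi>)" "c < c'" "c' < length \<phi> + ?K"
      then have "r' < ?R" "c' < ?C" "r < ?R" "c < ?C" by (auto simp: grid_rows_def grid_cols_def)
      then show "\<not> (fill z r c = fill z r' c \<and> fill z r c = fill z r' c' \<and>
          fill z r c = fill z r c')"
        using col * unfolding coloring_iff by (auto simp: fill)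
    qed
    then show "satisfiable \<phi>" using satisfiable_iff_selection by auto
  qed
qed

section \<open>From Turing machines to formulas\<close>

definition holds :: "('v \<Rightarrow> bool) \<Rightarrow> 'v cnf \<Rightarrow> bool" where
  "holds \<alpha> \<phi> \<longleftrightarrow> (\<forall>C \<in> set \<phi>. \<exists>l \<in> set C. \<alpha> (snd l) = fst l)"

lemma satisfiable_iff_holds: "satisfiable \<phi> \<longleftrightarrow> (\<exists>\<alpha>. holds \<alpha> \<phi>)"
  unfolding satisfiable_def holds_def by (simp add: case_prod_beta Bex_def)

definition rule :: "'v list \<Rightarrow> 'v \<Rightarrow> (bool \<times> 'v) list" where
  "rule bs a = (True, a) # map (Pair False) bs"

lemma holds_simps [simp]:
  "holds \<alpha> []"
  "holds \<alpha> (rule bs a # \<phi>) \<longleftrightarrow> ((\<forall>b \<in> set bs. \<alpha> b) \<longrightarrow> \<alpha> a) \<and> holds \<alpha> \<phi>"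
  "holds \<alpha> (\<phi> @ \<psi>) \<longleftrightarrow> holds \<alpha> \<phi> \<and> holds \<alpha> \<psi>"
  "holds \<alpha> (concat (map f l)) \<longleftrightarrow> (\<forall>x \<in> set l. holds \<alpha> (f x))"
  "holds \<alpha> (map (\<lambda>x. rule (g x) (h x)) l) \<longleftrightarrow> (\<forall>x \<in> set l. (\<forall>b \<in> set (g x). \<alpha> b) \<longrightarrow> \<alpha> (h x))"
  by (auto simp: holds_def rule_def)

text \<open>Variables for the state, the head positions, the cell contents and the symbols read. Position
  \<open>p \<le> 2 * T\<close> stands for cell \<open>p - T\<close> of the tape, as no head moves further than \<open>T\<close> in \<open>T\<close> steps.\<close>

definition St :: "nat \<Rightarrow> nat \<Rightarrow> nat list" where "St t q = [0, t, q]"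
definition Hd :: "nat \<Rightarrow> nat \<Rightarrow> nat \<Rightarrow> nat list" where "Hd t i p = [1, t, i, p]"
definition Ce :: "nat \<Rightarrow> nat \<Rightarrow> nat \<Rightarrow> nat \<Rightarrow> nat list" where "Ce t i p s = [2, t, i, p, s]"
definition Rd :: "nat \<Rightarrow> nat \<Rightarrow> nat \<Rightarrow> nat list" where "Rd t i s = [3, t, i, s]"

primrec dir_code :: "direction \<Rightarrow> nat" where
  "dir_code Left = 0"
| "dir_code Stay = 1"
| "dir_code Right = 2"

text \<open>A halted machine idles, as in \<open>tm_step\<close>, so that every run can be followed
  up to the same time \<open>T\<close>.\<close>

definition delta' :: "tm \<Rightarrow> nat \<Rightarrow> nat list \<Rightarrow> nat \<times> (nat \<times> direction) list" where
  "delta' M q v = (if q = tm_halt M then (q, keep v) else tm_delta M q v)"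

definition transitions :: "tm \<Rightarrow> (nat \<times> nat list \<times> nat \<times> (nat \<times> nat) list) list" where
  "transitions M = concat (map (\<lambda>q. map (\<lambda>v. (q, v, fst (delta' M q v),
       map (\<lambda>a. (fst a, dir_code (snd a))) (snd (delta' M q v))))
     (List.n_lists (tm_tapes M) [0..<tm_symbols M])) [0..<tm_states M])"

text \<open>The certificate may be shorter than \<open>P\<close>. Each of the \<open>P\<close> cells
  behind \<open>w\<close> is guessed to be a bit or blank, and blanks propagate to the right, so the
  guess amounts to a word followed by blanks.\<close>

definition init_cnf :: "tm \<Rightarrow> bool list \<Rightarrow> nat \<Rightarrow> nat \<Rightarrow> nat list cnf" where
  "init_cnf M w P T =
     [rule [] (St 0 (tm_start M))] @
     map (\<lambda>i. rule [] (Hd 0 i T)) [0..<tm_tapes M] @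
     map (\<lambda>j. rule [] (Ce 0 0 (T + j) (bit_symbol (hd (drop j w))))) [0..<length w] @
     map (\<lambda>j. [(True, Ce 0 0 (T + j) 0), (True, Ce 0 0 (T + j) 1), (True, Ce 0 0 (T + j) 2)])
       [length w..<length w + P] @
     map (\<lambda>j. rule [Ce 0 0 (T + j) 0] (Ce 0 0 (T + Suc j) 0)) [length w..<length w + P] @
     map (\<lambda>p. rule [] (Ce 0 0 p 0)) ([0..<T] @ [T + (length w + P)..<Suc (2 * T)]) @
     concat (map (\<lambda>i. map (\<lambda>p. rule [] (Ce 0 i p 0)) [0..<Suc (2 * T)]) [1..<tm_tapes M])"

text \<open>A transition depends on the symbols under all heads. The facts \<open>Rd\<close>
  separate the tapes; without them a clause would be needed for every combination of head
  positions.\<close>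

definition read_cnf :: "tm \<Rightarrow> nat \<Rightarrow> nat list cnf" where
  "read_cnf M T = concat (map (\<lambda>t. concat (map (\<lambda>i. concat (map (\<lambda>p. map (\<lambda>s.
     rule [Hd t i p, Ce t i p s] (Rd t i s))
     [0..<tm_symbols M]) [0..<Suc (2 * T)])) [0..<tm_tapes M])) [0..<Suc T])"

text \<open>That the head is not on cell \<open>p\<close> is expressed positively, by its being on
  some \<open>p' \<noteq> p\<close>. A negated fact in the body would become a second positive
  literal, and the clause would not be definite.\<close>

definition frame_cnf :: "tm \<Rightarrow> nat \<Rightarrow> nat list cnf" where
  "frame_cnf M T = concat (map (\<lambda>t. concat (map (\<lambda>i. concat (map (\<lambda>p. concat (map (\<lambda>p'. map (\<lambda>s.
     rule [Hd t i p', Ce t i p s] (Ce (Suc t) i p s))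
     [0..<tm_symbols M]) (filter (\<lambda>p'. p' \<noteq> p) [0..<Suc (2 * T)])))
     [0..<Suc (2 * T)])) [0..<tm_tapes M])) [0..<T])"

definition body :: "tm \<Rightarrow> nat \<Rightarrow> nat \<Rightarrow> nat list \<Rightarrow> nat list list" where
  "body M t q v = St t q # map (\<lambda>i. Rd t i (hd (drop i v))) [0..<tm_tapes M]"

definition step_cnf :: "tm \<Rightarrow> nat \<Rightarrow> nat list cnf" where
  "step_cnf M T = concat (map (\<lambda>t. concat (map (\<lambda>(q, v, q', as).
     rule (body M t q v) (St (Suc t) q') #
     concat (map (\<lambda>i. concat (map (\<lambda>p.
       [rule (Hd t i p # body M t q v) (Ce (Suc t) i p (fst (hd (drop i as)))),
        rule (Hd t i p # body M t q v) (Hd (Suc t) i (p + snd (hd (drop i as)) - 1))])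
     [0..<Suc (2 * T)])) [0..<tm_tapes M])) (transitions M))) [0..<T])"

text \<open>Symbol 1 stands for the bit 0, which a rejecting verifier leaves under its first head.
  The last clause is the only one without a positive literal.\<close>

definition tm_cnf :: "tm \<Rightarrow> bool list \<Rightarrow> nat \<Rightarrow> nat \<Rightarrow> nat list cnf" where
  "tm_cnf M w P T =
     init_cnf M w P T @ read_cnf M T @ frame_cnf M T @ step_cnf M T @ [[(False, Rd T 0 1)]]"

section \<open>Runs and the facts about them\<close>

definition run :: "tm \<Rightarrow> bool list \<Rightarrow> nat \<Rightarrow> config" where
  "run M z t = (tm_step M ^^ t) (tm_init M z)"

definition actions :: "tm \<Rightarrow> config \<Rightarrow> nat \<times> (nat \<times> direction) list" where
  "actions M c = delta' M (fst c) (map read_tape (snd c))"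

lemma tm_step_eq: "tm_step M c = (fst (actions M c), map2 act_tape (snd (actions M c)) (snd c))"
  by (cases c) (auto simp: actions_def delta'_def split: prod.splits)

lemma run_Suc: "run M z (Suc t) = tm_step M (run M z t)"
  by (simp add: run_def)

text \<open>A head moves at most one cell per step. Up to time \<open>T\<close> all heads therefore
  remain in the window of \<open>2 * T + 1\<close> cells that the variables describe.\<close>

definition config_ok :: "tm \<Rightarrow> nat \<Rightarrow> config \<Rightarrow> bool" where
  "config_ok M t c \<longleftrightarrow> fst c < tm_states M \<and> length (snd c) = tm_tapes M \<and>
     (\<forall>i < tm_tapes M. (\<forall>p. fst (snd c ! i) p < tm_symbols M) \<and> \<bar>snd (snd c ! i)\<bar> \<le> int t)"

lemma read_tape_eq: "read_tape tp = fst tp (snd tp)"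
  by (cases tp) simp

lemma act_tape_eq: "act_tape a tp = ((fst tp)(snd tp := fst a), shift (snd a) (snd tp))"
  by (cases tp; cases a) simp

lemma actions_ok:
  assumes "wf_tm M" "config_ok M t c"
  shows "fst (actions M c) < tm_states M" "length (snd (actions M c)) = tm_tapes M"
    "\<And>i. i < tm_tapes M \<Longrightarrow> fst (snd (actions M c) ! i) < tm_symbols M"
    "map read_tape (snd c) \<in> set (List.n_lists (tm_tapes M) [0..<tm_symbols M])"
proof -
  have v: "length (map read_tape (snd c)) = tm_tapes M" "\<forall>s \<in> set (map read_tape (snd c)). s < tm_symbols M"
    using assms(2) by (simp_all add: config_ok_def read_tape_eq all_set_conv_all_nth)
  then show "map read_tape (snd c) \<in> set (List.n_lists (tm_tapes M) [0..<tm_symbols M])"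
    by (auto simp: set_n_lists)
  have q: "fst c < tm_states M" using assms(2) by (simp add: config_ok_def)
  have *: "fst (actions M c) < tm_states M \<and> length (snd (actions M c)) = tm_tapes M \<and>
      (\<forall>a \<in> set (snd (actions M c)). fst a < tm_symbols M)"
  proof (cases "fst c = tm_halt M")
    case True
    then show ?thesis using v q by (auto simp: actions_def delta'_def keep_def)
  next
    case False
    have "fst (tm_delta M (fst c) (map read_tape (snd c))) < tm_states M \<and>
        length (snd (tm_delta M (fst c) (map read_tape (snd c)))) = tm_tapes M \<and>
        (\<forall>a \<in> set (snd (tm_delta M (fst c) (map read_tape (snd c)))). fst a < tm_symbols M)"
      using assms(1) v q unfolding wf_tm_def by blast
    then show ?thesis using False by (simp add: actions_def delta'_def)
  qed
  then show "fst (actions M c) < tm_states M" "length (snd (actions M c)) = tm_tapes M"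
    "\<And>i. i < tm_tapes M \<Longrightarrow> fst (snd (actions M c) ! i) < tm_symbols M"
    by auto
qed

lemma config_ok_step:
  assumes "wf_tm M" "config_ok M t c"
  shows "config_ok M (Suc t) (tm_step M c)"
proof -
  have sh: "\<bar>shift d h\<bar> \<le> \<bar>h\<bar> + 1" for d h by (cases d) auto
  show ?thesis
    using actions_ok[OF assms] assms(2) order_trans[OF sh]
    by (auto simp: config_ok_def tm_step_eq act_tape_eq)
qed

lemma config_ok_run: "wf_tm M \<Longrightarrow> config_ok M t (run M z t)"
proof (induction t)
  case 0
  have "bit_symbol b < tm_symbols M" "0 < tm_symbols M" for b
    using 0 bit_symbol_less(1)[of b] unfolding wf_tm_def by linarith+
  with 0 show ?case
    by (auto simp: run_def config_ok_def tm_init_def wf_tm_def input_tape_def blank_tape_def nth_Cons split: nat.split)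
qed (auto simp: run_Suc config_ok_step)

definition truth :: "(nat \<Rightarrow> config) \<Rightarrow> nat \<Rightarrow> nat list \<Rightarrow> bool" where
  "truth R T a = (let c = R (a ! 1); tp = snd c ! (a ! 2) in
     if a ! 0 = 0 then fst c = a ! 2
     else if a ! 0 = 1 then int (a ! 3) - int T = snd tp
     else if a ! 0 = 2 then fst tp (int (a ! 3) - int T) = a ! 4
     else read_tape tp = a ! 3)"

lemma truth_simps [simp]:
  "truth R T (St t q) \<longleftrightarrow> fst (R t) = q"
  "truth R T (Hd t i p) \<longleftrightarrow> int p - int T = snd (snd (R t) ! i)"
  "truth R T (Ce t i p s) \<longleftrightarrow> fst (snd (R t) ! i) (int p - int T) = s"
  "truth R T (Rd t i s) \<longleftrightarrow> read_tape (snd (R t) ! i) = s"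
  by (simp_all add: truth_def St_def Hd_def Ce_def Rd_def Let_def)

lemma transitions_iff:
  "(q, v, q', as) \<in> set (transitions M) \<longleftrightarrow>
    q < tm_states M \<and> v \<in> set (List.n_lists (tm_tapes M) [0..<tm_symbols M]) \<and>
    q' = fst (delta' M q v) \<and> as = map (\<lambda>a. (fst a, dir_code (snd a))) (snd (delta' M q v))"
  by (auto simp: transitions_def)

lemma holds_body:
  "(\<forall>b \<in> set (body M t q v). \<alpha> b) \<longleftrightarrow> \<alpha> (St t q) \<and> (\<forall>i < tm_tapes M. \<alpha> (Rd t i (hd (drop i v))))"
  by (auto simp: body_def)

lemma ball_upt:
  "(\<forall>x \<in> set [0..<n]. P x) \<longleftrightarrow> (\<forall>x < n. P x)"
  "(\<forall>x \<in> set (filter Q [0..<n]). P x) \<longleftrightarrow> (\<forall>x < n. Q x \<longrightarrow> P x)"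
  by auto

definition closed_under ::
  "(nat list \<Rightarrow> bool) \<Rightarrow> tm \<Rightarrow> nat \<Rightarrow> nat \<Rightarrow> nat \<times> nat list \<times> nat \<times> (nat \<times> nat) list \<Rightarrow> bool" where
  "closed_under \<alpha> M T t = (\<lambda>(q, v, q', as).
     ((\<forall>b \<in> set (body M t q v). \<alpha> b) \<longrightarrow> \<alpha> (St (Suc t) q')) \<and>
     (\<forall>i < tm_tapes M. \<forall>p \<le> 2 * T.
       (\<alpha> (Hd t i p) \<and> (\<forall>b \<in> set (body M t q v). \<alpha> b) \<longrightarrow>
          \<alpha> (Ce (Suc t) i p (fst (hd (drop i as))))) \<and>
       (\<alpha> (Hd t i p) \<and> (\<forall>b \<in> set (body M t q v). \<alpha> b) \<longrightarrow>
          \<alpha> (Hd (Suc t) i (p + snd (hd (drop i as)) - 1)))))"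

lemma holds_step_cnf:
  "holds \<alpha> (step_cnf M T) \<longleftrightarrow> (\<forall>t < T. \<forall>a \<in> set (transitions M). closed_under \<alpha> M T t a)"
  unfolding step_cnf_def closed_under_def
  by (simp add: case_prod_beta less_Suc_eq_le ball_upt del: upt_Suc set_upt)

lemma holds_frame_cnf:
  "holds \<alpha> (frame_cnf M T) \<longleftrightarrow> (\<forall>t < T. \<forall>i < tm_tapes M. \<forall>p \<le> 2 * T. \<forall>p' \<le> 2 * T. p' \<noteq> p \<longrightarrow>
     (\<forall>s < tm_symbols M. \<alpha> (Hd t i p') \<and> \<alpha> (Ce t i p s) \<longrightarrow> \<alpha> (Ce (Suc t) i p s)))"
  unfolding frame_cnf_def by (simp add: less_Suc_eq_le ball_upt del: upt_Suc set_upt set_filter)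

lemma holds_read_cnf:
  "holds \<alpha> (read_cnf M T) \<longleftrightarrow> (\<forall>t \<le> T. \<forall>i < tm_tapes M. \<forall>p \<le> 2 * T. \<forall>s < tm_symbols M.
     \<alpha> (Hd t i p) \<and> \<alpha> (Ce t i p s) \<longrightarrow> \<alpha> (Rd t i s))"
  unfolding read_cnf_def by (simp add: less_Suc_eq_le ball_upt del: upt_Suc set_upt)

lemma holds_init_cnf:
  "holds \<alpha> (init_cnf M w P T) \<longleftrightarrow>
     \<alpha> (St 0 (tm_start M)) \<and> (\<forall>i < tm_tapes M. \<alpha> (Hd 0 i T)) \<and>
     (\<forall>j < length w. \<alpha> (Ce 0 0 (T + j) (bit_symbol (w ! j)))) \<and>
     (\<forall>j \<in> {length w..<length w + P}. (\<exists>s \<in> {0, 1, 2}. \<alpha> (Ce 0 0 (T + j) s)) \<and>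
        (\<alpha> (Ce 0 0 (T + j) 0) \<longrightarrow> \<alpha> (Ce 0 0 (T + Suc j) 0))) \<and>
     (\<forall>p < T. \<alpha> (Ce 0 0 p 0)) \<and> (\<forall>p \<in> {T + (length w + P)..2 * T}. \<alpha> (Ce 0 0 p 0)) \<and>
     (\<forall>i \<in> {1..<tm_tapes M}. \<forall>p \<le> 2 * T. \<alpha> (Ce 0 i p 0))"
proof -
  have guess: "holds \<alpha> (map (\<lambda>j. [(True, f j), (True, g j), (True, h j)]) l) \<longleftrightarrow>
      (\<forall>j \<in> set l. \<alpha> (f j) \<or> \<alpha> (g j) \<or> \<alpha> (h j))" for f g h l
    by (auto simp: holds_def)
  show ?thesis
    unfolding init_cnf_def holds_simps guess
    by (auto simp: less_Suc_eq_le hd_drop_conv_nth simp del: upt_Suc)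
qed

lemma length_read: "config_ok M t c \<Longrightarrow> i < tm_tapes M \<Longrightarrow> hd (drop i (map read_tape (snd c))) = read_tape (snd c ! i)"
  by (simp add: config_ok_def hd_drop_conv_nth)

text \<open>The bound on \<open>h\<close> and \<open>t < T\<close> give \<open>1 \<le> p\<close>, so
  the subtraction of 1 is not cut off at 0.\<close>

lemma shift_code:
  assumes "int p - int T = h" "\<bar>h\<bar> \<le> int t" "t < T"
  shows "int (p + dir_code d - 1) - int T = shift d h"
  using assms by (cases d) auto

lemma run_tape_Suc:
  assumes "wf_tm M" "i < tm_tapes M"
  shows "snd (run M z (Suc t)) ! i = act_tape (snd (actions M (run M z t)) ! i) (snd (run M z t) ! i)"
  using actions_ok(2)[OF assms(1) config_ok_run[OF assms(1), where t = t and z = z]] config_ok_run[OF assms(1), where t = t and z = z] assms(2)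
  by (simp add: run_Suc tm_step_eq config_ok_def)

lemma bit_symbol_nonzero [simp]: "bit_symbol b \<noteq> 0"
  by (cases b) auto

text \<open>A run has one state and one symbol under each head at each time. A step clause whose
  body is true of the run hence concerns the very transition that the machine performs, and its head
  is true by the definition of a step.\<close>

lemma holds_truth:
  assumes wf: "wf_tm M" and T: "length w + P \<le> T" and y: "length y \<le> P"
    and acc: "read_tape (snd (run M (w @ y) T) ! 0) \<noteq> 1"
  shows "holds (truth (run M (w @ y)) T) (tm_cnf M w P T)"
proof -
  define R where "R = run M (w @ y)"
  let ?\<alpha> = "truth R T"
  have k: "0 < tm_tapes M" using wf by (simp add: wf_tm_def)
  note ok = config_ok_run[OF wf, where z = "w @ y", folded R_def]
  have R0: "R 0 = tm_init M (w @ y)" by (simp add: R_def run_def)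
  have t0: "snd (R 0) ! 0 = input_tape (w @ y)" by (simp add: R0 tm_init_def)
  have ti: "snd (R 0) ! i = blank_tape" if "0 < i" "i < tm_tapes M" for i
    using that by (cases i) (auto simp: R0 tm_init_def)
  have cell: "fst (snd (R 0) ! 0) (int p - int T) =
      (if T \<le> p \<and> p < T + length (w @ y) then bit_symbol ((w @ y) ! (p - T)) else 0)" for p
    by (auto simp: t0 input_tape_def nat_diff_distrib)
  have cell': "fst (snd (R 0) ! 0) (int j) = (if j < length (w @ y) then bit_symbol ((w @ y) ! j) else 0)" for j
    using cell[of "T + j"] by simp
  have "holds ?\<alpha> (init_cnf M w P T)"
    unfolding holds_init_cnf
  proof (intro conjI ballI allI impI)
    show "?\<alpha> (Hd 0 i T)" if "i < tm_tapes M" for i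
      using that ti[of i] t0 by (cases "i = 0") (auto simp: input_tape_def blank_tape_def)
    show "?\<alpha> (Ce 0 i p 0)" if "i \<in> {1..<tm_tapes M}" for i p
      using that ti[of i] by (auto simp: blank_tape_def)
    show "\<exists>s \<in> {0, 1, 2}. ?\<alpha> (Ce 0 0 (T + j) s)" for j
    proof -
      have "bit_symbol b \<in> {1, 2}" for b by (cases b) auto
      then show ?thesis by (auto simp: cell')
    qed
    show "?\<alpha> (Ce 0 0 (T + Suc j) 0)" if "?\<alpha> (Ce 0 0 (T + j) 0)" for j
      using that cell'[of j] cell'[of "Suc j"] by (auto split: if_splits)
    show "?\<alpha> (St 0 (tm_start M))" by (simp add: R0 tm_init_def)
  qed (use y in \<open>auto simp: cell cell' nth_append\<close>)
  moreover have "holds ?\<alpha> (read_cnf M T)"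
    unfolding holds_read_cnf by (auto simp: read_tape_eq)
  moreover have "holds ?\<alpha> (frame_cnf M T)"
    unfolding holds_frame_cnf
    using run_tape_Suc[OF wf, where z = "w @ y", folded R_def] by (auto simp: act_tape_eq)
  moreover have "holds ?\<alpha> (step_cnf M T)"
    unfolding holds_step_cnf
  proof (intro allI impI ballI, unfold split_paired_all)
    fix t q v q' as
    assume t: "t < T" and tr: "(q, v, q', as) \<in> set (transitions M)"
    {
      assume "\<forall>b \<in> set (body M t q v). ?\<alpha> b"
      then have q: "?\<alpha> (St t q)" and rd: "\<forall>i < tm_tapes M. ?\<alpha> (Rd t i (hd (drop i v)))"
        unfolding holds_body by auto
      have lv: "length v = tm_tapes M" using tr by (auto simp: transitions_iff set_n_lists)
      have "map read_tape (snd (R t)) = v"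
        by (rule nth_equalityI)
           (use ok[of t] lv rd in \<open>auto simp: config_ok_def hd_drop_conv_nth\<close>)
      then have act: "actions M (R t) = delta' M q v" using q by (simp add: actions_def)
      then have q': "q' = fst (actions M (R t))" and
        as: "as = map (\<lambda>a. (fst a, dir_code (snd a))) (snd (actions M (R t)))"
        using tr by (auto simp: transitions_iff)
      have "?\<alpha> (St (Suc t) q')" by (simp add: R_def run_Suc tm_step_eq q')
      moreover have "?\<alpha> (Ce (Suc t) i p (fst (hd (drop i as)))) \<and> ?\<alpha> (Hd (Suc t) i (p + snd (hd (drop i as)) - 1))"
        if i: "i < tm_tapes M" and p: "?\<alpha> (Hd t i p)" for i p
      proof -
        have asi: "hd (drop i as) = (fst (snd (actions M (R t)) ! i), dir_code (snd (snd (actions M (R t)) ! i)))"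
          using i actions_ok(2)[OF wf ok] by (simp add: as hd_drop_conv_nth)
        have tp: "snd (R (Suc t)) ! i = act_tape (snd (actions M (R t)) ! i) (snd (R t) ! i)"
          using run_tape_Suc[OF wf i] by (simp add: R_def)
        have h: "\<bar>snd (snd (R t) ! i)\<bar> \<le> int t" using ok[of t] i by (auto simp: config_ok_def)
        show ?thesis
          using p shift_code[OF _ h t, of p] by (simp add: asi tp act_tape_eq)
      qed
      ultimately have "?\<alpha> (St (Suc t) q') \<and> (\<forall>i < tm_tapes M. \<forall>p. ?\<alpha> (Hd t i p) \<longrightarrow>
          ?\<alpha> (Ce (Suc t) i p (fst (hd (drop i as)))) \<and>
          ?\<alpha> (Hd (Suc t) i (p + snd (hd (drop i as)) - 1)))"
        by blast
    }
    then show "closed_under ?\<alpha> M T t (q, v, q', as)"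
      unfolding closed_under_def prod.case
      by blast
  qed
  moreover have "holds ?\<alpha> [[(False, Rd T 0 1)]]"
    using acc by (simp add: holds_def R_def)
  ultimately show ?thesis unfolding tm_cnf_def R_def by simp
qed

text \<open>The clauses are definite except for the guesses, so an assignment satisfying them contains all
  facts about the run on the guessed certificate.\<close>

lemma holds_run:
  assumes wf: "wf_tm M" and "holds \<alpha> (tm_cnf M w P T)" and T: "length w + P \<le> T"
    and z: "length z \<le> T"
    and init: "\<And>p. p \<le> 2 * T \<Longrightarrow> \<alpha> (Ce 0 0 p (fst (input_tape z) (int p - int T)))"
  shows "t \<le> T \<Longrightarrow> \<alpha> (St t (fst (run M z t))) \<and>
    (\<forall>i < tm_tapes M. \<alpha> (Hd t i (nat (int T + snd (snd (run M z t) ! i)))) \<and>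
       \<alpha> (Rd t i (read_tape (snd (run M z t) ! i))) \<and>
       (\<forall>p \<le> 2 * T. \<alpha> (Ce t i p (fst (snd (run M z t) ! i) (int p - int T)))))"
proof (induction t)
  have h: "holds \<alpha> (init_cnf M w P T)" "holds \<alpha> (read_cnf M T)" "holds \<alpha> (frame_cnf M T)"
    "holds \<alpha> (step_cnf M T)"
    using assms(2) by (auto simp: tm_cnf_def)
  note ok = config_ok_run[OF wf, where z = z]
  have pos: "nat (int T + snd (snd (run M z t) ! i)) \<le> 2 * T"
    "int (nat (int T + snd (snd (run M z t) ! i))) - int T = snd (snd (run M z t) ! i)"
    if "i < tm_tapes M" "t \<le> T" for t i
    using ok[of t] that by (auto simp: config_ok_def)
  have read: "\<alpha> (Rd t i (read_tape (snd (run M z t) ! i)))"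
    if "i < tm_tapes M" "t \<le> T" "\<alpha> (Hd t i (nat (int T + snd (snd (run M z t) ! i))))"
      "\<forall>p \<le> 2 * T. \<alpha> (Ce t i p (fst (snd (run M z t) ! i) (int p - int T)))" for t i
  proof -
    let ?p = "nat (int T + snd (snd (run M z t) ! i))"
    have "\<alpha> (Ce t i ?p (read_tape (snd (run M z t) ! i)))"
      using that(4)[rule_format, OF pos(1)[OF that(1,2)]] pos(2)[OF that(1,2)] by (simp add: read_tape_eq)
    moreover have "read_tape (snd (run M z t) ! i) < tm_symbols M"
      using ok[of t] that(1) by (auto simp: config_ok_def read_tape_eq)
    ultimately show ?thesis
      using h(2) that(1-3) pos(1)[OF that(1,2)] unfolding holds_read_cnf by blast
  qed
  {
    case 0
    have s: "fst (run M z 0) = tm_start M" by (simp add: run_def tm_init_def)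
    have t0: "snd (run M z 0) ! 0 = input_tape z" by (simp add: run_def tm_init_def)
    have ti: "snd (run M z 0) ! i = blank_tape" if "i \<noteq> 0" "i < tm_tapes M" for i
      using that by (cases i) (auto simp: run_def tm_init_def)
    have "\<alpha> (Hd 0 i (nat (int T + snd (snd (run M z 0) ! i))))" if "i < tm_tapes M" for i
      using h(1) that ti[of i] t0 unfolding holds_init_cnf
      by (cases "i = 0") (auto simp: input_tape_def blank_tape_def)
    moreover have "\<alpha> (Ce 0 i p (fst (snd (run M z 0) ! i) (int p - int T)))"
      if "i < tm_tapes M" "p \<le> 2 * T" for i p
      using h(1) that ti[of i] t0 init[of p] unfolding holds_init_cnf
      by (cases "i = 0") (auto simp: blank_tape_def)
    moreover have "\<alpha> (St 0 (fst (run M z 0)))" using h(1) s unfolding holds_init_cnf by auto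
    ultimately show ?case using read[of _ 0] by auto
  next
    case (Suc t)
    define c where "c = run M z t"
    have t: "t < T" "t \<le> T" using Suc.prems by auto
    have IH: "\<alpha> (St t (fst c))"
      "\<And>i. i < tm_tapes M \<Longrightarrow> \<alpha> (Hd t i (nat (int T + snd (snd c ! i))))"
      "\<And>i. i < tm_tapes M \<Longrightarrow> \<alpha> (Rd t i (read_tape (snd c ! i)))"
      "\<And>i p. i < tm_tapes M \<Longrightarrow> p \<le> 2 * T \<Longrightarrow> \<alpha> (Ce t i p (fst (snd c ! i) (int p - int T)))"
      using Suc.IH[OF t(2)] by (auto simp: c_def)
    note ok = ok[of t, folded c_def]
    let ?v = "map read_tape (snd c)"
    let ?as = "map (\<lambda>a. (fst a, dir_code (snd a))) (snd (actions M c))"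
    have tr: "(fst c, ?v, fst (actions M c), ?as) \<in> set (transitions M)"
      using actions_ok(4)[OF wf ok] ok by (auto simp: transitions_iff actions_def config_ok_def)
    have rd: "\<forall>i < tm_tapes M. \<alpha> (Rd t i (hd (drop i ?v)))"
      using IH(3) length_read[OF ok] by auto
    have step: "\<alpha> (St (Suc t) (fst (actions M c)))"
      "\<And>i p. i < tm_tapes M \<Longrightarrow> p \<le> 2 * T \<Longrightarrow> \<alpha> (Hd t i p) \<Longrightarrow>
        \<alpha> (Ce (Suc t) i p (fst (hd (drop i ?as)))) \<and> \<alpha> (Hd (Suc t) i (p + snd (hd (drop i ?as)) - 1))"
      using h(4)[unfolded holds_step_cnf, rule_format, OF t(1) tr] IH(1) rd
      unfolding closed_under_def prod.case holds_body by blast+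
    have asi: "hd (drop i ?as) = (fst (snd (actions M c) ! i), dir_code (snd (snd (actions M c) ! i)))"
      if "i < tm_tapes M" for i
      using that actions_ok(2)[OF wf ok] by (simp add: hd_drop_conv_nth)
    have tp: "snd (run M z (Suc t)) ! i = act_tape (snd (actions M c) ! i) (snd c ! i)"
      if "i < tm_tapes M" for i
      using run_tape_Suc[OF wf that] by (simp add: c_def)
    have head: "\<alpha> (Hd (Suc t) i (nat (int T + snd (snd (run M z (Suc t)) ! i))))"
      and cells: "\<alpha> (Ce (Suc t) i p (fst (snd (run M z (Suc t)) ! i) (int p - int T)))"
      if i: "i < tm_tapes M" and p: "p \<le> 2 * T" for i p
    proof -
      let ?h = "snd (snd c ! i)" and ?p = "nat (int T + snd (snd c ! i))"
      have hp: "?p \<le> 2 * T" "int ?p - int T = ?h" using pos[OF i t(2)] by (auto simp: c_def)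
      have hb: "\<bar>?h\<bar> \<le> int t" using ok i by (auto simp: config_ok_def)
      note st = step(2)[OF i hp(1) IH(2)[OF i]]
      have "int (?p + dir_code (snd (snd (actions M c) ! i)) - 1) - int T
          = shift (snd (snd (actions M c) ! i)) ?h"
        by (rule shift_code[OF hp(2) hb t(1)])
      then show "\<alpha> (Hd (Suc t) i (nat (int T + snd (snd (run M z (Suc t)) ! i))))"
        using st unfolding asi[OF i] tp[OF i] act_tape_eq snd_conv by (metis add_diff_cancel_left' diff_add_cancel nat_int add.commute)
      show "\<alpha> (Ce (Suc t) i p (fst (snd (run M z (Suc t)) ! i) (int p - int T)))"
      proof (cases "p = ?p")
        case True
        then have "int p - int T = ?h" using hp(2) by simp
        then show ?thesis using st True unfolding asi[OF i] tp[OF i] by (simp add: act_tape_eq)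
      next
        case False
        then have ne: "int p - int T \<noteq> ?h" using hp(2) by auto
        have "fst (snd c ! i) (int p - int T) < tm_symbols M" using ok i by (auto simp: config_ok_def)
        then have "\<alpha> (Ce (Suc t) i p (fst (snd c ! i) (int p - int T)))"
          using h(3)[unfolded holds_frame_cnf, rule_format, OF t(1) i p, of ?p] hp(1) False IH(2)[OF i] IH(4)[OF i p]
          by blast
        then show ?thesis using ne by (simp add: tp[OF i] act_tape_eq)
      qed
    qed
    have "fst (run M z (Suc t)) = fst (actions M c)" by (simp add: run_Suc tm_step_eq c_def)
    then show ?case
      using step(1) head[OF _ le0] cells read[OF _ Suc.prems] by auto
  }
qed

theorem satisfiable_tm_cnf:
  assumes wf: "wf_tm M" and T: "length w + P \<le> T"
  shows "satisfiable (tm_cnf M w P T) \<longleftrightarrow>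
    (\<exists>y. length y \<le> P \<and> read_tape (snd (run M (w @ y) T) ! 0) \<noteq> 1)"
proof
  assume "satisfiable (tm_cnf M w P T)"
  then obtain \<alpha> where \<alpha>: "holds \<alpha> (tm_cnf M w P T)" by (auto simp: satisfiable_iff_holds)
  then have init: "holds \<alpha> (init_cnf M w P T)" by (simp add: tm_cnf_def)
  let ?c = "\<lambda>j s. \<alpha> (Ce 0 0 (T + (length w + j)) s)"
  \<comment> \<open>The certificate ends at the first cell that may be blank, or after all
    \<open>P\<close> cells.\<close>
  define n where "n = (LEAST j. j = P \<or> ?c j 0)"
  have n: "n = P \<or> ?c n 0" unfolding n_def by (rule LeastI[of _ P]) simp
  have nP: "n \<le> P" unfolding n_def by (rule Least_le) simp
  have before: "\<not> ?c j 0" if "j < n" for j using not_less_Least[of j] that unfolding n_def by blast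
  have after: "?c j 0" if "n \<le> j" "length w + j \<le> T" for j
    using that
  proof (induction j rule: dec_induct)
    case base
    show ?case
    proof (cases "?c n 0")
      case False
      then have "n = P" using n by auto
      then show ?thesis using init base unfolding holds_init_cnf by auto
    qed
  next
    case (step j)
    show ?case
    proof (cases "j < P")
      case True
      then show ?thesis
        using init step unfolding holds_init_cnf by (auto dest!: bspec[of _ _ "length w + j"])
    next
      case False
      then show ?thesis using init step.prems unfolding holds_init_cnf by auto
    qed
  qed
  \<comment> \<open>An assignment may claim both bits for a cell; the bit 1, with symbol 2, is then
    taken.\<close>
  define y where "y = map (\<lambda>j. ?c j 2) [0..<n]"
  have cert: "?c j (bit_symbol (y ! j))" if "j < n" for j
  proof -
    have "length w + j \<in> {length w..<length w + P}" using that nP by auto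
    then have "\<exists>s \<in> {0, 1, 2}. ?c j s" using init unfolding holds_init_cnf by blast
    then show ?thesis using before[OF that] that by (cases "?c j 2") (auto simp: y_def)
  qed
  have ly: "length y = n" by (simp add: y_def)
  have "\<alpha> (Ce 0 0 p (fst (input_tape (w @ y)) (int p - int T)))" if p: "p \<le> 2 * T" for p
  proof (cases "p < T")
    case True
    then show ?thesis using init unfolding holds_init_cnf by (auto simp: input_tape_def)
  next
    case False
    then obtain d where d: "p = T + d" using le_Suc_ex not_less by blast
    show ?thesis
    proof (cases "d < length w")
      case True
      then show ?thesis
        using init unfolding holds_init_cnf by (auto simp: input_tape_def d nth_append)
    next
      case False
      then obtain j where j: "d = length w + j" using le_Suc_ex not_less by blast
      show ?thesis
        using cert[of j] after[of j] p by (cases "j < n") (auto simp: input_tape_def d j ly nth_append nat_int_add)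
    qed
  qed
  from holds_run[OF wf \<alpha> T _ this, of T]
  have "\<alpha> (Rd T 0 (read_tape (snd (run M (w @ y) T) ! 0)))"
    using wf ly nP T by (auto simp: wf_tm_def)
  moreover have "\<not> \<alpha> (Rd T 0 1)" using \<alpha> by (simp add: tm_cnf_def holds_def)
  ultimately show "\<exists>y. length y \<le> P \<and> read_tape (snd (run M (w @ y) T) ! 0) \<noteq> 1"
    using ly nP by metis
next
  assume "\<exists>y. length y \<le> P \<and> read_tape (snd (run M (w @ y) T) ! 0) \<noteq> 1"
  then show "satisfiable (tm_cnf M w P T)"
    using holds_truth[OF assms] unfolding satisfiable_iff_holds by blast
qed

lemma PF_bit_symbol [PF_intros]:
  assumes "PF f"
  shows "PF (\<lambda>x. bit_symbol (f x))"
proof -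
  have "PF (\<lambda>x. if f x then 2 else 1 :: nat)" by (intro PF_intros assms)
  moreover have "(if b then 2 else 1) = bit_symbol b" for b by (cases b) auto
  ultimately show ?thesis by simp
qed

text \<open>The machine is fixed, so its table of transitions is a constant. The rest is nested
  iteration over ranges of unary numbers.\<close>

lemma PF_tm_cnf: "PF (\<lambda>z. tm_cnf M (fst z) (fst (snd z)) (snd (snd z)))"
  unfolding tm_cnf_def init_cnf_def read_cnf_def frame_cnf_def step_cnf_def body_def rule_def
    St_def Hd_def Ce_def Rd_def
  by (intro PF_intros)

section \<open>Membership in NP\<close>

lemma PF_distinct [PF_intros]:
  assumes "PF f"
  shows "PF (\<lambda>x. distinct (f x))"
proof -
  have "PF (\<lambda>x. \<forall>i \<in> set [0..<length (f x)]. \<forall>j \<in> set [0..<i]. hd (drop i (f x)) \<noteq> hd (drop j (f x)))"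
    by (intro PF_intros assms PF_comp[OF assms])
  moreover have "(\<forall>i \<in> set [0..<length l]. \<forall>j \<in> set [0..<i]. hd (drop i l) \<noteq> hd (drop j l)) = distinct l"
    for l :: "'b list"
    unfolding distinct_conv_nth by (auto simp: hd_drop_conv_nth) (metis atLeastLessThan_iff linorder_neqE_nat zero_le)
  ultimately show ?thesis by simp
qed

lemma PF_Nd [PF_intros]: "PF f \<Longrightarrow> PF g \<Longrightarrow> PF (\<lambda>x. Nd (f x) (g x))"
  unfolding PF_def by (simp add: FP_Nd)

lemma PF_dec: "PF (dec :: tree \<Rightarrow> 'a::enc)"
  unfolding PF_def using FP_norm[where 'a = 'a] by (simp add: dec_tree_def)

text \<open>Read backwards, Polish notation is evaluated on a stack of finished subtrees; a node
  symbol merges two of them. Ill-formed words get some value as well, which does no harm because the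
  resulting certificate is checked.\<close>

definition parse_step :: "tree list \<Rightarrow> bool \<Rightarrow> tree list" where
  "parse_step s b = (if b then if s = [] \<or> tl s = [] then s else Nd (hd s) (hd (tl s)) # tl (tl s)
     else Lf # s)"

definition parse :: "bool list \<Rightarrow> tree" where
  "parse w = hd (foldl parse_step [] (rev w))"

lemma foldl_parse_step: "foldl parse_step s (rev (pol t)) = t # s"
  by (induction t arbitrary: s) (auto simp: parse_step_def)

lemma parse_pol [simp]: "parse (pol t) = t"
  by (simp add: parse_def foldl_parse_step)

lemma PF_parse: "PF parse"
  unfolding parse_def
proof (intro PF_hd PF_foldl[where b = "\<lambda>_. 2"])
  show "PF (\<lambda>p. parse_step (fst (snd p)) (snd (snd p)))"
    unfolding parse_step_def by (intro PF_intros)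
  show "tsize (enc (parse_step s b)) \<le> tsize (enc s) + 2" for s b
    by (cases s; cases "tl s") (auto simp: parse_step_def)
qed (intro PF_intros poly_bounded_intros)+

text \<open>The first component of the state is 0 in front of a marker bit, 1 in front of a letter of the
  first word, and 2 within the second word.\<close>

definition unpair_step :: "nat \<times> bool list \<times> bool list \<Rightarrow> bool \<Rightarrow> nat \<times> bool list \<times> bool list" where
  "unpair_step s b =
     (if fst s = 0 then (if b then 1 else 2, snd s)
      else if fst s = 1 then (0, b # fst (snd s), snd (snd s))
      else (fst s, fst (snd s), b # snd (snd s)))"

definition unpair :: "bool list \<Rightarrow> bool list \<times> bool list" where
  "unpair z = (let s = foldl unpair_step (0, [], []) z in (rev (fst (snd s)), rev (snd (snd s))))"

lemma unpair_encode_pair [simp]: "unpair (encode_pair x y) = (x, y)"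
proof -
  have "foldl unpair_step (0, u, []) (delimited x) = (2, rev x @ u, [])" for u
    by (induction x arbitrary: u) (auto simp: delimited_def unpair_step_def)
  moreover have "foldl unpair_step (2, u, v) y = (2, u, rev y @ v)" for u v
    by (induction y arbitrary: v) (auto simp: unpair_step_def)
  ultimately show ?thesis by (simp add: unpair_def encode_pair_def)
qed

lemma PF_unpair: "PF unpair"
proof -
  have "PF (foldl unpair_step (0, [], []))"
  proof (rule PF_foldl[where b = "\<lambda>_. 8" and l = "\<lambda>z. z" and g = "\<lambda>_. (0, [], [])"])
    show "PF (\<lambda>p. unpair_step (fst (snd p)) (snd (snd p)))"
      unfolding unpair_step_def by (intro PF_intros)
    show "tsize (enc (unpair_step s b)) \<le> tsize (enc s) + 8" for s b
      using tsize_bool[of b] by (cases s) (auto simp: unpair_step_def)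
  qed (intro PF_intros poly_bounded_intros)+
  from PF_comp[of "\<lambda>s. (rev (fst (snd s)), rev (snd (snd s)))", OF _ this] show ?thesis
    unfolding unpair_def Let_def by (simp add: PF_intros)
qed

section \<open>Binary words as numbers\<close>

definition val :: "bool list \<Rightarrow> nat" where
  "val w = foldr (\<lambda>b v. of_bool b + 2 * v) w 0"

lemma val_simps [simp]:
  "val [] = 0" "val (b # w) = of_bool b + 2 * val w"
  by (simp_all add: val_def)

lemma val_append: "val (u @ v) = val u + 2 ^ length u * val v"
  by (induction u) auto

lemma val_less: "val w < 2 ^ length w"
  by (induction w) (auto simp: of_bool_def)

lemma val_replicate_False [simp]: "val (replicate n False) = 0"
  by (induction n) auto

lemma val_binary [simp]: "val (binary n) = n"
proof (induction n rule: less_induct)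
  case (less n)
  show ?case
  proof (cases "n = 0")
    case False
    then show ?thesis using less[of "n div 2"] by (subst binary.simps) (auto simp: of_bool_def)
  qed (simp add: binary.simps)
qed

text \<open>The words that represent a number have no leading zero, which is the last letter.\<close>

definition canonical :: "bool list \<Rightarrow> bool" where
  "canonical w \<longleftrightarrow> w = [] \<or> hd (rev w)"

lemma canonical_binary: "canonical (binary n)"
proof (induction n rule: less_induct)
  case (less n)
  show ?case
  proof (cases "n \<le> 1")
    case True
    then show ?thesis by (subst binary.simps, subst binary.simps) (auto simp: canonical_def)
  next
    case False
    then have "binary (n div 2) \<noteq> []" by (subst binary.simps) auto
    then show ?thesis
      using less[of "n div 2"] False by (subst binary.simps) (auto simp: canonical_def)
  qed
qed

lemma val_pos: "canonical w \<Longrightarrow> w \<noteq> [] \<Longrightarrow> 2 ^ (length w - 1) \<le> val w"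
  unfolding canonical_def by (cases w rule: rev_cases) (auto simp: val_append)

lemma binary_val: "canonical w \<Longrightarrow> binary (val w) = w"
proof (induction w)
  case Nil
  then show ?case by (simp add: binary.simps)
next
  case (Cons b w)
  show ?case
  proof (cases "w = []")
    case True
    then show ?thesis using Cons.prems by (subst binary.simps, subst binary.simps) (auto simp: canonical_def)
  next
    case False
    then have c: "canonical w" using Cons.prems by (auto simp: canonical_def)
    then have "0 < val w" using val_pos[OF c False] by (metis gr0I le_zero_eq power_not_zero zero_neq_numeral)
    then show ?thesis using Cons.IH[OF c] by (subst binary.simps) auto
  qed
qed

text \<open>The least significant digit comes first, so each later digit overrules the verdict of
  the earlier ones unless the two digits are equal.\<close>

definition le_step :: "bool \<Rightarrow> bool \<times> bool \<Rightarrow> bool" where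
  "le_step s p = (if fst p = snd p then s else snd p)"

text \<open>Colours are compared as words because their values can be exponential in the length of
  the instance. The test of the lengths presupposes that the first word has no leading
  zeros.\<close>

definition le_bits :: "bool list \<Rightarrow> bool list \<Rightarrow> bool" where
  "le_bits u v \<longleftrightarrow> length u \<le> length v \<and>
     foldl le_step True (zip (u @ replicate (length v - length u) False) v)"

lemma foldl_le_step: "length u = length v \<Longrightarrow> foldl le_step True (zip u v) \<longleftrightarrow> val u \<le> val v"
proof (induction u arbitrary: v rule: rev_induct)
  case (snoc a u)
  then obtain b w where v: "v = w @ [b]" "length u = length w"
    by (cases v rule: rev_cases) auto
  show ?case
    using snoc.IH[OF v(2)] val_less[of u] val_less[of w] v
    by (auto simp: le_step_def val_append of_bool_def)
qed auto

lemma le_bits_iff: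
  assumes "canonical u"
  shows "le_bits u v \<longleftrightarrow> val u \<le> val v"
proof -
  have "length u \<le> length v" if "val u \<le> val v"
  proof (rule ccontr)
    assume *: "\<not> length u \<le> length v"
    then have "u \<noteq> []" by auto
    then have "(2::nat) ^ (length u - 1) < 2 ^ length v"
      using val_pos[OF assms] that val_less[of v] by linarith
    then show False using * by simp
  qed
  then show ?thesis unfolding le_bits_def by (auto simp: foldl_le_step val_append)
qed

lemma PF_le_bits [PF_intros]:
  assumes "PF f" "PF g"
  shows "PF (\<lambda>x. le_bits (f x) (g x))"
proof -
  have "PF (\<lambda>x. foldl le_step True (zip (f x @ replicate (length (g x) - length (f x)) False) (g x)))"
  proof (rule PF_foldl[where b = "\<lambda>_. 3"])
    show "PF (\<lambda>p. le_step (fst (snd p)) (snd (snd p)))"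
      unfolding le_step_def by (intro PF_intros)
    show "tsize (enc (le_step s b)) \<le> tsize (enc s) + 3" for s b
      using tsize_bool[of "le_step s b"] by linarith
  qed (intro PF_intros poly_bounded_intros assms)+
  then show ?thesis unfolding le_bits_def by (intro PF_intros assms)
qed

lemma PF_canonical [PF_intros]: "PF f \<Longrightarrow> PF (\<lambda>x. canonical (f x))"
  unfolding canonical_def by (intro PF_intros)

text \<open>The certificate repeats the instance in decoded form in front of the colouring. The
  verifier encodes it again and compares the result with its input, instead of parsing the
  input.\<close>

type_synonym certificate =
  "nat \<times> nat \<times> bool list \<times> ((nat \<times> nat) \<times> bool list) list \<times> bool list list list"

definition encode_bits :: "nat \<Rightarrow> nat \<Rightarrow> bool list \<Rightarrow> ((nat \<times> nat) \<times> bool list) list \<Rightarrow> bool list" where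
  "encode_bits N M c T = unary N @ unary M @ delimited c @
     concat (map (\<lambda>e. unary (fst (fst e)) @ unary (snd (fst e)) @ delimited (snd e)) T)"

text \<open>Beyond the given rows and columns this is some fixed word. As \<open>check\<close>
  accesses every cell of the grid through \<open>cell\<close>, lists of wrong length cannot mislead
  it.\<close>

definition cell :: "bool list list list \<Rightarrow> nat \<Rightarrow> nat \<Rightarrow> bool list" where
  "cell \<psi> a b = hd (drop b (hd (drop a \<psi>)))"

definition check :: "bool list \<Rightarrow> certificate \<Rightarrow> bool" where
  "check x = (\<lambda>(N, M, c, T, \<psi>).
     x = encode_bits N M c T \<and> canonical c \<and> distinct (map fst T) \<and>
     (\<forall>e \<in> set T. (0 < fst (fst e) \<and> fst (fst e) \<le> N \<and> 0 < snd (fst e) \<and> snd (fst e) \<le> M) \<and>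
        cell \<psi> (fst (fst e) - 1) (snd (fst e) - 1) = snd e) \<and>
     (\<forall>a \<in> set [0..<N]. \<forall>b \<in> set [0..<M].
        canonical (cell \<psi> a b) \<and> cell \<psi> a b \<noteq> [] \<and> le_bits (cell \<psi> a b) c) \<and>
     (\<forall>a' \<in> set [0..<N]. \<forall>a \<in> set [0..<a']. \<forall>b' \<in> set [0..<M]. \<forall>b \<in> set [0..<b'].
        \<not> (cell \<psi> a b = cell \<psi> a' b \<and> cell \<psi> a b = cell \<psi> a' b' \<and> cell \<psi> a b = cell \<psi> a b')))"

lemma PF_check: "PF (\<lambda>z. check (fst z) (snd z))"
  unfolding check_def encode_bits_def cell_def by (intro PF_intros)

lemma encode_bits_eq:
  assumes "\<And>e. e \<in> set T \<Longrightarrow> binary (g e) = snd e"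
  shows "encode_bits N M (binary c) T = encode_instance N M c (map (\<lambda>e. (fst e, g e)) T)"
proof -
  have "concat (map (\<lambda>e. unary (fst (fst e)) @ unary (snd (fst e)) @ delimited (snd e)) T)
      = concat (map encode_entry (map (\<lambda>e. (fst e, g e)) T))"
    using assms by (induction T) (auto simp: split_paired_all)
  then show ?thesis by (simp add: encode_bits_def encode_instance_def)
qed

lemma check_imp:
  assumes "check x (N, M, c, T, \<psi>)"
  shows "x \<in> GCE_language"
proof -
  define \<chi> where "\<chi> z = val (cell \<psi> (fst z - 1) (snd z - 1))" for z :: "nat \<times> nat"
  define T' where "T' = map (\<lambda>e. (fst e, val (snd e))) T"
  note A = assms[unfolded check_def prod.case]
  note x = A[THEN conjunct1]
  note cc = A[THEN conjunct2, THEN conjunct1]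
  note d = A[THEN conjunct2, THEN conjunct2, THEN conjunct1]
  note B = A[THEN conjunct2, THEN conjunct2, THEN conjunct2]
  have T: "p \<in> grid N M \<and> cell \<psi> (fst p - 1) (snd p - 1) = k" if "(p, k) \<in> set T" for p k
    using bspec[OF B[THEN conjunct1] that] by (cases p) (simp add: grid_def Suc_le_eq)
  have cells: "canonical (cell \<psi> a b) \<and> cell \<psi> a b \<noteq> [] \<and> le_bits (cell \<psi> a b) c"
    if "a < N" "b < M" for a b
    using B[THEN conjunct2, THEN conjunct1] that by simp
  have rect: "\<not> (cell \<psi> a b = cell \<psi> a' b \<and> cell \<psi> a b = cell \<psi> a' b' \<and> cell \<psi> a b = cell \<psi> a b')"
    if "a' < N" "a < a'" "b' < M" "b < b'" for a a' b b'
    using B[THEN conjunct2, THEN conjunct2] that by simp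
  have inj: "cell \<psi> a b = cell \<psi> a' b'" if "val (cell \<psi> a b) = val (cell \<psi> a' b')"
    "a < N" "b < M" "a' < N" "b' < M" for a b a' b'
    using that binary_val cells by metis
  have range: "val (cell \<psi> a b) \<in> {1..val c}" if "a < N" "b < M" for a b
  proof -
    have "0 < val (cell \<psi> a b)"
      using val_pos[of "cell \<psi> a b"] cells[OF that]
        less_le_trans[of 0 "2 ^ (length (cell \<psi> a b) - 1)" "val (cell \<psi> a b)"]
      by simp
    then show ?thesis
      using cells[OF that] le_bits_iff[of "cell \<psi> a b" c] by auto
  qed
  have col: "coloring N M (val c) \<chi>"
    unfolding coloring_iff
  proof (intro conjI allI impI notI)
    show "\<chi> (Suc a, Suc b) \<in> {1..val c}" if "a < N" "b < M" for a b
      using range[OF that] by (simp add: \<chi>_def)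
    fix a a' b b'
    assume *: "a < a'" "a' < N" "b < b'" "b' < M"
      "\<chi> (Suc a, Suc b) = \<chi> (Suc a', Suc b) \<and> \<chi> (Suc a, Suc b) = \<chi> (Suc a', Suc b') \<and>
       \<chi> (Suc a, Suc b) = \<chi> (Suc a, Suc b')"
    then have "cell \<psi> a b = cell \<psi> a' b" "cell \<psi> a b = cell \<psi> a' b'" "cell \<psi> a b = cell \<psi> a b'"
      by (auto simp: \<chi>_def intro!: inj)
    then show False using rect[of a' a b' b] * by simp
  qed
  have T': "p \<in> grid N M \<and> k = \<chi> p" if "(p, k) \<in> set T'" for p k
    using that T unfolding T'_def \<chi>_def by auto
  then have T'_some: "map_of T' p = Some k \<Longrightarrow> p \<in> grid N M \<and> k = \<chi> p" for p k
    using map_of_SomeD by metis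
  have "\<chi> p \<in> {1..val c}" if "p \<in> grid N M" for p
    using col that unfolding coloring_def by blast
  then have "k \<in> {1..val c}" if "map_of T' p = Some k" for p k
    using T'_some[OF that] by metis
  then have "partial_mapping N M (val c) (map_of T')"
    unfolding partial_mapping_def dom_def ran_def using T'_some by blast
  moreover have "extendable N M (val c) (map_of T')"
    unfolding extendable_def using col T'_some by (intro exI[of _ \<chi>]) (auto simp: dom_def)
  ultimately have "(N, M, val c, map_of T') \<in> GCE" by (simp add: GCE_def)
  moreover have "x = encode_instance N M (val c) T'"
  proof -
    \<comment> \<open>The word of an entry equals that of a cell in the grid, and cells are
      canonical; so it is the binary form of its value.\<close>
    have "binary (val (snd e)) = snd e" if "e \<in> set T" for e
    proof -
      have "fst e \<in> grid N M" "snd e = cell \<psi> (fst (fst e) - 1) (snd (fst e) - 1)"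
        using T[of "fst e" "snd e"] that by auto
      then show ?thesis
        using cells[of "fst (fst e) - 1" "snd (fst e) - 1"] binary_val by (auto simp: grid_def)
    qed
    then show ?thesis
      using encode_bits_eq[of T "\<lambda>e. val (snd e)" N M "val c"] binary_val[OF cc] x by (simp add: T'_def)
  qed
  moreover have "distinct (map fst T')" using d by (simp add: T'_def comp_def)
  ultimately show ?thesis unfolding GCE_language_def by blast
qed

lemma tsize_list_le:
  assumes "\<And>a. a \<in> set l \<Longrightarrow> tsize (enc a) \<le> B"
  shows "tsize (enc l) \<le> 1 + length l * (1 + B)"
  using assms by (induction l) (auto intro: add_mono order_trans)

lemma length_delimited: "length (delimited x) = 2 * length x + 1"
  by (induction x) (auto simp: delimited_def)

lemma length_encode_instance:
  "length (encode_instance N M c T) = N + 1 + (M + 1) + (2 * length (binary c) + 1) + length (concat (map encode_entry T))"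
  by (simp add: encode_instance_def unary_def length_delimited)

lemma tsize_word: "tsize (enc w) \<le> 4 * length w + 1" for w :: "bool list"
  using tsize_word_tree(2)[of w] by (simp add: word_tree_eq_enc)

lemma tsize_table:
  "tsize (enc (map (\<lambda>e. (fst e, binary (snd e))) T)) \<le> 1 + 4 * length (concat (map encode_entry T))"
proof (induction T)
  case (Cons e T)
  obtain a b k where e: "e = ((a, b), k)" by (cases e) auto
  show ?case using Cons.IH tsize_word[of "binary k"] by (simp add: e unary_def length_delimited)
qed simp

text \<open>The cubic term is the colouring: at most \<open>n\<close> rows of at most
  \<open>n\<close> words of at most \<open>n\<close> bits, each bit taking up to 4 symbols. The
  sides are at most \<open>n\<close> because they are unary in the instance.\<close>

definition certificate_size :: "nat \<Rightarrow> nat" where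
  "certificate_size n = 20 * n + 20 + n * (2 + n * (2 + 4 * n))"

lemma ex_certificate:
  assumes "x \<in> GCE_language"
  shows "\<exists>z. tsize (enc z) \<le> certificate_size (length x) \<and> check x z"
proof -
  from assms obtain N M c T where x: "x = encode_instance N M c T" "distinct (map fst T)"
    "(N, M, c, map_of T) \<in> GCE" unfolding GCE_language_def by blast
  then obtain \<chi> where pm: "partial_mapping N M c (map_of T)" and col: "coloring N M c \<chi>"
    and ext: "\<And>z. z \<in> dom (map_of T) \<Longrightarrow> map_of T z = Some (\<chi> z)"
    by (auto simp: GCE_def extendable_def)
  define T' where "T' = map (\<lambda>e. (fst e, binary (snd e))) T"
  define \<psi> where "\<psi> = map (\<lambda>a. map (\<lambda>b. binary (\<chi> (Suc a, Suc b))) [0..<M]) [0..<N]"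
  let ?n = "length x" and ?z = "(N, M, binary c, T', \<psi>)"
  have cell: "cell \<psi> a b = binary (\<chi> (Suc a, Suc b))" if "a < N" "b < M" for a b
    using that by (simp add: cell_def \<psi>_def hd_drop_conv_nth)
  have range: "\<chi> (Suc a, Suc b) \<in> {1..c}" if "a < N" "b < M" for a b
    using col that unfolding coloring_iff by blast
  have entry: "p \<in> grid N M \<and> \<chi> p = k" if "(p, k) \<in> set T" for p k
  proof -
    have "map_of T p = Some k" using that x(2) by simp
    then show ?thesis using pm ext[of p] unfolding partial_mapping_def by auto
  qed
  have "check x ?z"
    unfolding check_def prod.case
  proof (intro conjI ballI)
    show "x = encode_bits N M (binary c) T'"
    proof -
      have "binary (val (snd e)) = snd e" if "e \<in> set T'" for e
        using that by (auto simp: T'_def)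
      from encode_bits_eq[OF this, of T' N M c] show ?thesis
        by (simp add: x(1) T'_def comp_def)
    qed
    show "canonical (binary c)" by (rule canonical_binary)
    show "distinct (map fst T')" using x(2) by (simp add: T'_def comp_def)
  next
    fix e assume "e \<in> set T'"
    then obtain a b k where e: "e = ((a, b), binary k)" "((a, b), k) \<in> set T" by (auto simp: T'_def)
    then have g: "0 < a" "a \<le> N" "0 < b" "b \<le> M" "\<chi> (a, b) = k" using entry[OF e(2)] by (auto simp: grid_def)
    then show "0 < fst (fst e)" "fst (fst e) \<le> N" "0 < snd (fst e)" "snd (fst e) \<le> M"
      using e by auto
    show "cell \<psi> (fst (fst e) - 1) (snd (fst e) - 1) = snd e"
      using g e cell[of "a - 1" "b - 1"] by auto
  next
    fix a b assume "a \<in> set [0..<N]" "b \<in> set [0..<M]"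
    then have ab: "a < N" "b < M" by auto
    show "canonical (cell \<psi> a b)" by (simp add: cell[OF ab] canonical_binary)
    show "cell \<psi> a b \<noteq> []" using range[OF ab] by (subst cell[OF ab], subst binary.simps) auto
    show "le_bits (cell \<psi> a b) (binary c)"
      using range[OF ab] by (simp add: cell[OF ab] le_bits_iff[OF canonical_binary])
  next
    fix a' a b' b assume "a' \<in> set [0..<N]" "a \<in> set [0..<a']" "b' \<in> set [0..<M]" "b \<in> set [0..<b']"
    then have *: "a < a'" "a' < N" "b < b'" "b' < M" by auto
    have inj: "binary i = binary j \<Longrightarrow> i = j" for i j using val_binary by metis
    show "\<not> (cell \<psi> a b = cell \<psi> a' b \<and> cell \<psi> a b = cell \<psi> a' b' \<and> cell \<psi> a b = cell \<psi> a b')"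
      using col[unfolded coloring_iff, THEN conjunct2, rule_format, of a a' b b'] *
      by (auto simp: cell dest!: inj)
  qed
  moreover have "tsize (enc ?z) \<le> certificate_size ?n"
  proof -
    have len: "?n = N + 1 + (M + 1) + (2 * length (binary c) + 1) + length (concat (map encode_entry T))"
      unfolding x(1) by (rule length_encode_instance)
    have le: "N \<le> ?n" "M \<le> ?n" using len by auto
    have bits: "tsize (enc (binary (\<chi> (Suc a, Suc b)))) \<le> 4 * ?n + 1" if "a < N" "b < M" for a b
    proof -
      \<comment> \<open>The comparison includes the lengths, so no colour has more digits than
        \<open>c\<close>.\<close>
      have "le_bits (binary (\<chi> (Suc a, Suc b))) (binary c)"
        using range[OF that] by (simp add: le_bits_iff[OF canonical_binary])
      then have "length (binary (\<chi> (Suc a, Suc b))) \<le> ?n" using len by (auto simp: le_bits_def)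
      then show ?thesis using tsize_word[of "binary (\<chi> (Suc a, Suc b))"] by linarith
    qed
    have row: "tsize (enc (map (\<lambda>b. binary (\<chi> (Suc a, Suc b))) [0..<M])) \<le> 1 + ?n * (2 + 4 * ?n)" if "a < N" for a
    proof -
      have "tsize (enc (map (\<lambda>b. binary (\<chi> (Suc a, Suc b))) [0..<M]))
          \<le> 1 + length (map (\<lambda>b. binary (\<chi> (Suc a, Suc b))) [0..<M]) * (1 + (4 * ?n + 1))"
        by (rule tsize_list_le) (use that bits in auto)
      also have "\<dots> \<le> 1 + ?n * (2 + 4 * ?n)"
        using mult_le_mono1[OF le(2), of "2 + 4 * ?n"] by simp
      finally show ?thesis .
    qed
    have "tsize (enc \<psi>) \<le> 1 + length \<psi> * (1 + (1 + ?n * (2 + 4 * ?n)))"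
      by (rule tsize_list_le) (use row in \<open>auto simp: \<psi>_def\<close>)
    also have "\<dots> \<le> 1 + ?n * (2 + ?n * (2 + 4 * ?n))"
      using mult_le_mono1[OF le(1), of "2 + ?n * (2 + 4 * ?n)"] by (simp add: \<psi>_def)
    finally have psi: "tsize (enc \<psi>) \<le> 1 + ?n * (2 + ?n * (2 + 4 * ?n))" .
    have "tsize (enc T') \<le> 1 + 4 * ?n" using tsize_table[of T] len unfolding T'_def by linarith
    moreover have "tsize (enc (binary c)) \<le> 4 * ?n + 1" using tsize_word[of "binary c"] len by linarith
    ultimately show ?thesis using psi le unfolding certificate_size_def by simp
  qed
  ultimately show ?thesis by blast
qed

theorem GCE_in_NP: "in_NP GCE_language"
proof -
  define V where "V = {z. check (fst (unpair z)) (dec (parse (snd (unpair z))))}"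
  have "PF (\<lambda>z. (fst (unpair z), dec (parse (snd (unpair z))) :: certificate))"
    by (intro PF_Pair PF_fst PF_comp[OF PF_dec] PF_comp[OF PF_parse] PF_snd PF_unpair)
  from PF_comp[OF PF_check this] have "PF (\<lambda>z. [z \<in> V])"
    unfolding V_def by (auto intro: PF_Cons PF_const)
  then have V: "polytime_decidable V"
    unfolding polytime_decidable_def by (rule polytime_computable_PF)
  have "poly_bounded certificate_size"
    unfolding certificate_size_def by (intro poly_bounded_intros)
  then obtain p where p: "\<And>n. certificate_size n \<le> poly p n" unfolding poly_bounded_def by blast
  have "x \<in> GCE_language \<longleftrightarrow> (\<exists>y. length y \<le> poly p (length x) \<and> encode_pair x y \<in> V)" for x
  proof
    assume "x \<in> GCE_language"
    then obtain z where "tsize (enc z) \<le> certificate_size (length x)" "check x z"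
      using ex_certificate by blast
    then show "\<exists>y. length y \<le> poly p (length x) \<and> encode_pair x y \<in> V"
      using p[of "length x"] by (intro exI[of _ "pol (enc z)"]) (auto simp: V_def simp del: dec_prod intro: order_trans)
  next
    assume "\<exists>y. length y \<le> poly p (length x) \<and> encode_pair x y \<in> V"
    then obtain z where "check x z" by (auto simp: V_def)
    then show "x \<in> GCE_language" using check_imp by (cases z) auto
  qed
  then show ?thesis using V unfolding in_NP_def by blast
qed

section \<open>NP-hardness\<close>

lemma run_halted:
  assumes "halts_with M z t u" "t \<le> T"
  shows "run M z T = run M z t"
proof -
  have h: "fst (run M z t) = tm_halt M" using assms(1) by (simp add: halts_with_def run_def)
  have "run M z (t + d) = run M z t" for d
    by (induction d) (use h in \<open>auto simp: run_Suc prod_eq_iff tm_step_eq actions_def delta'_def\<close>)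
  then show ?thesis using assms(2) le_Suc_ex by metis
qed

lemma run_accepts:
  assumes "wf_tm M" "halts_with M z t [z \<in> V]" "t \<le> T"
  shows "read_tape (snd (run M z T) ! 0) \<noteq> 1 \<longleftrightarrow> z \<in> V"
proof -
  have "snd (run M z t) \<noteq> []"
    using config_ok_run[OF assms(1), of t z] assms(1) by (auto simp: config_ok_def wf_tm_def)
  then have "tape_output (snd (run M z t) ! 0) [z \<in> V]"
    using assms(2) by (simp add: halts_with_def run_def hd_conv_nth)
  then have "read_tape (snd (run M z t) ! 0) = bit_symbol (z \<in> V)"
    by (simp add: tape_output_def read_tape_eq)
  then show ?thesis using run_halted[OF assms(2,3)] by (cases "z \<in> V") auto
qed

section \<open>Normalising formulas\<close>

definition tautological :: "(bool \<times> 'v) list \<Rightarrow> bool" where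
  "tautological C \<longleftrightarrow> (\<exists>l \<in> set C. (\<not> fst l, snd l) \<in> set C)"

definition index :: "'v list \<Rightarrow> 'v \<Rightarrow> nat" where
  "index vs v = hd (filter (\<lambda>i. hd (drop i vs) = v) [0..<length vs])"

definition rename :: "'v list \<Rightarrow> 'v cnf \<Rightarrow> nat cnf" where
  "rename vs \<phi> = map (map (\<lambda>l. (fst l, index vs (snd l)))) \<phi>"

text \<open>Repetitions are kept. Since \<open>index\<close> takes the first position, it is still
  injective on the variables, and the length of the list serves as an upper bound on them.\<close>

definition variables :: "'v cnf \<Rightarrow> 'v list" where
  "variables \<phi> = map snd (concat \<phi>)"

lemma index_less: "v \<in> set vs \<Longrightarrow> index vs v < length vs"
  and nth_index: "v \<in> set vs \<Longrightarrow> vs ! index vs v = v"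
proof -
  assume "v \<in> set vs"
  then have "filter (\<lambda>i. hd (drop i vs) = v) [0..<length vs] \<noteq> []"
    by (auto simp: filter_empty_conv in_set_conv_nth hd_drop_conv_nth)
  from hd_in_set[OF this] show "index vs v < length vs" "vs ! index vs v = v"
    by (auto simp: index_def hd_drop_conv_nth)
qed

lemma satisfiable_filter: "satisfiable (filter (\<lambda>C. \<not> tautological C) \<phi>) \<longleftrightarrow> satisfiable \<phi>"
proof -
  have key: "\<exists>l \<in> set C. \<alpha> (snd l) = fst l" if "tautological C" for C and \<alpha> :: "'a \<Rightarrow> bool"
  proof -
    obtain l where l: "l \<in> set C" "(\<not> fst l, snd l) \<in> set C"
      using \<open>tautological C\<close> unfolding tautological_def by blast
    have "\<alpha> (snd l) = fst l \<or> \<alpha> (snd (\<not> fst l, snd l)) = fst (\<not> fst l, snd l)" by auto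
    then show ?thesis using l by metis
  qed
  have "holds \<alpha> (filter (\<lambda>C. \<not> tautological C) \<phi>) \<longleftrightarrow> holds \<alpha> \<phi>" for \<alpha>
  proof
    assume *: "holds \<alpha> (filter (\<lambda>C. \<not> tautological C) \<phi>)"
    show "holds \<alpha> \<phi>"
      unfolding holds_def
    proof
      show "\<exists>l \<in> set C. \<alpha> (snd l) = fst l" if "C \<in> set \<phi>" for C
        using that * key[of C \<alpha>] by (cases "tautological C") (simp_all add: holds_def)
    qed
  qed (simp add: holds_def)
  then show ?thesis by (simp add: satisfiable_iff_holds)
qed

lemma satisfiable_rename:
  assumes "\<And>C l. C \<in> set \<phi> \<Longrightarrow> l \<in> set C \<Longrightarrow> snd l \<in> set vs"
  shows "satisfiable (rename vs \<phi>) \<longleftrightarrow> satisfiable \<phi>"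
proof
  assume "satisfiable (rename vs \<phi>)"
  then obtain \<beta> where "holds \<beta> (rename vs \<phi>)" by (auto simp: satisfiable_iff_holds)
  then have "holds (\<lambda>v. \<beta> (index vs v)) \<phi>" by (simp add: holds_def rename_def)
  then show "satisfiable \<phi>" by (auto simp: satisfiable_iff_holds)
next
  assume "satisfiable \<phi>"
  then obtain \<alpha> where "holds \<alpha> \<phi>" by (auto simp: satisfiable_iff_holds)
  have "\<exists>l \<in> set C. \<alpha> (vs ! snd l) = fst l" if C: "C \<in> set (rename vs \<phi>)" for C
  proof -
    obtain D where D: "D \<in> set \<phi>" "C = map (\<lambda>l. (fst l, index vs (snd l))) D"
      using C by (auto simp: rename_def)
    then obtain l where "l \<in> set D" "\<alpha> (snd l) = fst l"
      using \<open>holds \<alpha> \<phi>\<close> unfolding holds_def by blast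
    then show ?thesis
      using D nth_index[OF assms] by (intro bexI[of _ "(fst l, index vs (snd l))"]) auto
  qed
  then have "holds (\<lambda>i. \<alpha> (vs ! i)) (rename vs \<phi>)" by (simp add: holds_def)
  then show "satisfiable (rename vs \<phi>)" by (auto simp: satisfiable_iff_holds)
qed

definition grid_instance :: "nat \<Rightarrow> nat cnf \<Rightarrow> bool list" where
  "grid_instance V \<phi> =
     encode_instance (grid_rows V \<phi>) (grid_cols V \<phi>) (n_colours V \<phi>) (grid_table V \<phi>)"

text \<open>Tautological clauses are always true and would violate \<open>no_taut\<close>, so they
  are dropped. Variables become numbers because they act as colours.\<close>

definition cnf_instance :: "'v cnf \<Rightarrow> bool list" where
  "cnf_instance \<phi> = (let \<psi> = filter (\<lambda>C. \<not> tautological C) \<phi>; vs = variables \<psi>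
     in grid_instance (length vs) (rename vs \<psi>))"

lemma unary_append_inject: "unary a @ u = unary b @ w \<longleftrightarrow> a = b \<and> u = w"
proof (induction a arbitrary: b)
  case 0
  then show ?case by (cases b) (auto simp: unary_def)
next
  case (Suc a)
  then show ?case by (cases b) (auto simp: unary_def)
qed

lemma delimited_append_inject: "delimited x @ u = delimited y @ w \<longleftrightarrow> x = y \<and> u = w"
proof (induction x arbitrary: y)
  case Nil
  then show ?case by (cases y) (auto simp: delimited_def)
next
  case (Cons b x)
  then show ?case by (cases y) (auto simp: delimited_def)
qed

lemma binary_inject: "binary m = binary n \<longleftrightarrow> m = n"
  using val_binary by metis

lemma encode_entry_append_inject: "encode_entry e @ u = encode_entry e' @ w \<longleftrightarrow> e = e' \<and> u = w"
  by (cases e rule: encode_entry.cases; cases e' rule: encode_entry.cases)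
     (simp add: unary_append_inject delimited_append_inject binary_inject)

lemma encode_table_inject: "concat (map encode_entry T) = concat (map encode_entry T') \<longleftrightarrow> T = T'"
proof (induction T arbitrary: T')
  case Nil
  have "encode_entry e \<noteq> []" for e by (cases e rule: encode_entry.cases) (simp add: unary_def)
  then show ?case by (cases T') auto
next
  case (Cons e T)
  have "encode_entry e \<noteq> []" by (cases e rule: encode_entry.cases) (simp add: unary_def)
  then show ?case using Cons.IH by (cases T') (auto simp: encode_entry_append_inject)
qed

text \<open>Membership in \<open>GCE_language\<close> asks for some instance with the given code.
  Unique readability makes it the instance at hand, so the grid of an unsatisfiable formula cannot
  enter the language as the code of another instance.\<close>

lemma encode_instance_inject:
  "encode_instance N M c T = encode_instance N' M' c' T' \<longleftrightarrow> N = N' \<and> M = M' \<and> c = c' \<and> T = T'"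
  by (auto simp: encode_instance_def unary_append_inject delimited_append_inject binary_inject encode_table_inject)

lemma encode_instance_in_language:
  "encode_instance N M c T \<in> GCE_language \<longleftrightarrow> distinct (map fst T) \<and> (N, M, c, map_of T) \<in> GCE"
  unfolding GCE_language_def by (auto simp: encode_instance_inject)

lemma cnf_instance_correct: "cnf_instance \<phi> \<in> GCE_language \<longleftrightarrow> satisfiable \<phi>"
proof -
  define \<psi> where "\<psi> = filter (\<lambda>C. \<not> tautological C) \<phi>"
  define vs where "vs = variables \<psi>"
  have vs: "snd l \<in> set vs" if "C \<in> set \<psi>" "l \<in> set C" for C l
    using that by (auto simp: vs_def variables_def)
  have less: "v < length vs" if C: "C \<in> set (rename vs \<psi>)" "(b, v) \<in> set C" for C b v
  proof -
    obtain D l where "D \<in> set \<psi>" "l \<in> set D" "v = index vs (snd l)"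
      using C by (auto simp: rename_def)
    then show ?thesis using index_less[OF vs] by simp
  qed
  have no_taut: "(False, v) \<notin> set C" if C: "C \<in> set (rename vs \<psi>)" and v: "(True, v) \<in> set C" for C v
  proof
    assume "(False, v) \<in> set C"
    with C v obtain D u u' where D: "D \<in> set \<psi>" "(True, u) \<in> set D" "(False, u') \<in> set D"
      "v = index vs u" "v = index vs u'"
      by (auto simp: rename_def)
    then have "vs ! index vs u = u" "vs ! index vs u' = u'"
      using nth_index[OF vs[of D "(True, u)"]] nth_index[OF vs[of D "(False, u')"]] by auto
    then have "u = u'" using D(4,5) by simp
    then have "tautological D" using D(2,3) unfolding tautological_def by force
    then show False using D(1) by (simp add: \<psi>_def)
  qed
  have "satisfiable (rename vs \<psi>) \<longleftrightarrow> grid_instance (length vs) (rename vs \<psi>) \<in> GCE_language"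
    unfolding grid_instance_def encode_instance_in_language
    using satisfiable_iff_extendable[OF less no_taut] distinct_grid_table by simp
  moreover have "satisfiable (rename vs \<psi>) \<longleftrightarrow> satisfiable \<phi>"
    using satisfiable_rename[OF vs] satisfiable_filter[of \<phi>, folded \<psi>_def] by simp
  moreover have "cnf_instance \<phi> = grid_instance (length vs) (rename vs \<psi>)"
    by (simp add: cnf_instance_def Let_def vs_def \<psi>_def)
  ultimately show ?thesis by simp
qed

lemma PF_product [PF_intros]:
  assumes "PF f" "PF g"
  shows "PF (\<lambda>x. List.product (f x) (g x))"
  unfolding product_concat_map by (intro PF_intros assms PF_comp[OF assms(2)])

lemma PF_cell_colour:
  "PF (\<lambda>z. cell_colour (fst (fst z)) (snd (fst z)) (fst (snd z)) (snd (snd z)))"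
  unfolding cell_colour_def conflict_colour_def conflict_at_def occurs_def clause_def
    n_colours_def n_conflicts_def
  by (intro PF_intros)

lemma PF_grid_table: "PF (\<lambda>z. grid_table (fst z) (snd z))"
  unfolding grid_table_def grid_rows_def grid_cols_def n_colours_def n_conflicts_def
  by (intro PF_intros PF_comp[OF PF_cell_colour, of "\<lambda>p. (fst p, snd p)", simplified])

lemma PF_encode_table: "PF (\<lambda>T. concat (map encode_entry T))"
proof -
  have eq: "encode_entry e = unary (fst (fst e)) @ unary (snd (fst e)) @ delimited (binary (snd e))" for e
    by (cases e rule: encode_entry.cases) simp
  show ?thesis unfolding eq by (intro PF_intros)
qed

lemma PF_grid_instance: "PF (\<lambda>z. grid_instance (fst z) (snd z))"
  unfolding grid_instance_def encode_instance_def grid_rows_def grid_cols_def n_colours_def n_conflicts_def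
  by (intro PF_append PF_unary PF_delimited PF_binary PF_comp[OF PF_encode_table PF_grid_table] PF_intros)

lemma PF_cnf_instance: "PF (cnf_instance :: 'v::enc cnf \<Rightarrow> bool list)"
proof -
  have "PF (\<lambda>\<phi>::'v cnf. filter (\<lambda>C. \<not> tautological C) \<phi>)"
    unfolding tautological_def by (intro PF_intros)
  moreover have "PF (\<lambda>\<psi>::'v cnf. (length (variables \<psi>), rename (variables \<psi>) \<psi>))"
    unfolding variables_def rename_def index_def by (intro PF_intros)
  from PF_comp[OF PF_grid_instance this]
  have "PF (\<lambda>\<psi>::'v cnf. grid_instance (length (variables \<psi>)) (rename (variables \<psi>) \<psi>))" by simp
  ultimately show ?thesis
    unfolding cnf_instance_def Let_def by (rule PF_comp[rotated])
qed

theorem GCE_NP_hard: "NP_hard GCE_language"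
  unfolding NP_hard_def
proof (intro allI impI)
  fix L assume "in_NP L"
  then obtain V p where V: "polytime_decidable V"
    and L: "\<And>x. x \<in> L \<longleftrightarrow> (\<exists>y. length y \<le> poly p (length x) \<and> encode_pair x y \<in> V)"
    unfolding in_NP_def by blast
  from V obtain M q where wf: "wf_tm M"
    and M: "\<And>z. \<exists>t \<le> poly q (length z). halts_with M z t [z \<in> V]"
    unfolding polytime_decidable_def polytime_computable_def by blast
  define P where "P x = poly p (length x)" for x :: "bool list"
  \<comment> \<open>The first summand bounds the running time on all inputs
    \<open>delimited x @ y\<close> with \<open>length y \<le> P x\<close>. The second makes the
    window of \<open>2 * T + 1\<close> cells wide enough to contain these inputs.\<close>
  define T where "T x = poly q (length (delimited x) + P x) + (length (delimited x) + P x)" for x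
  \<comment> \<open>\<open>encode_pair x y\<close> is \<open>delimited x @ y\<close>, a fixed word
    followed by the certificate, which is the shape that the formula describes.\<close>
  define f where "f x = cnf_instance (tm_cnf M (delimited x) (P x) (T x))" for x
  have "PF (\<lambda>x. (delimited x, P x, T x))" unfolding P_def T_def by (intro PF_intros)
  from PF_comp[OF PF_cnf_instance PF_comp[OF PF_tm_cnf[of M] this]]
  have "PF f" by (simp add: f_def[abs_def])
  moreover have "x \<in> L \<longleftrightarrow> f x \<in> GCE_language" for x
  proof -
    have acc: "read_tape (snd (run M (delimited x @ y) (T x)) ! 0) \<noteq> 1 \<longleftrightarrow> encode_pair x y \<in> V"
      if "length y \<le> P x" for y
    proof -
      obtain t where t: "t \<le> poly q (length (encode_pair x y))"
        "halts_with M (encode_pair x y) t [encode_pair x y \<in> V]" using M by blast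
      have "poly q (length (encode_pair x y)) \<le> poly q (length (delimited x) + P x)"
        using that by (intro poly_mono_nat) (simp add: encode_pair_def)
      then have "t \<le> T x" using t(1) by (simp add: T_def)
      from run_accepts[OF wf t(2) this] show ?thesis by (simp add: encode_pair_def)
    qed
    have "f x \<in> GCE_language \<longleftrightarrow>
        (\<exists>y. length y \<le> P x \<and> read_tape (snd (run M (delimited x @ y) (T x)) ! 0) \<noteq> 1)"
      unfolding f_def cnf_instance_correct by (rule satisfiable_tm_cnf[OF wf]) (simp add: T_def)
    then show ?thesis using acc L by (auto simp: P_def)
  qed
  ultimately show "polytime_reducible L GCE_language"
    unfolding polytime_reducible_def using polytime_computable_PF by blast
qed

theorem theorem2p1: "NP_complete GCE_language"
  unfolding NP_complete_def using GCE_in_NP GCE_NP_hard by blast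

end
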